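(* Assume the following setting. $\mathcal X,\mathcal Y$ are complex Hilbert spaces, $A:\mathcal X\supset\operatorname{dom}A\to\mathcal Y$ is closed, densely defined with $\|Ax\|_{\mathcal Y}\ge c\|x\|_{\mathcal X}$ ($c>0$), $\mathcal X_h$ is $\operatorname{dom}A$ with inner product $\langle Ax,Ay\rangle_{\mathcal Y}$, $\mathcal Y_1=\operatorname{ran}A$ with the inner product of $\mathcal Y$ (so $A:\mathcal X_h\to\mathcal Y_1$ is an isometric isomorphism), $B:\mathcal Y\supset\operatorname{dom}B\to\mathcal X$ is closed, densely defined with $A^*\subset-B$, and $B_{\mathcal Y_1}$ is the restriction of $B$ to $\operatorname{dom}B\cap\mathcal Y_1$. Let $\mathcal G_1,\mathcal G_2$ be Hilbert spaces, $\Lambda=(\Lambda_1,\Lambda_2):\operatorname{dom}A\to\mathcal G_1\times\mathcal G_2^*$ and $\Pi=(\Pi_1,\Pi_2):\operatorname{dom}B\to\mathcal G_1^*\times\mathcal G_2$ surjective linear maps with $-\langle By,x\rangle_{\mathcal X}-\langle y,Ax\rangle_{\mathcal Y}=\langle\Pi_1y,\Lambda_1x\rangle_{\mathcal G_1^*,\mathcal G_1}-\langle\Pi_2y,\Lambda_2x\rangle_{\mathcal G_2,\mathcal G_2^*}$ for all $y\in\operatorname{dom}B$, $x\in\operatorname{dom}A$. Let $\mathcal G=\mathcal G_1\times\mathcal G_2$, $\mathcal G^*=\mathcal G_1^*\times\mathcal G_2^*$, and define on $(\operatorname{dom}B\cap\mathcal Y_1)\times\mathcal X_h$ the maps $\Xi_0(v,w)=(\Lambda_1w,\Pi_2v)\in\mathcal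 G$, $\Xi_1(v,w)=(-\Pi_1v,\Lambda_2w)\in\mathcal G^*$. Let $M\in L(\mathcal X)$ be self-adjoint and uniformly positive, $D\in L(\mathcal X)$ with $-D$ dissipative, and $\mathcal X_M$ the space $\mathcal X$ with inner product $\langle M^{-1}\cdot,\cdot\rangle_{\mathcal X}$. Let $\mathcal A_M$ on $\mathcal X_h\times\mathcal X_M$ be given by $\operatorname{dom}\mathcal A_M=\{(z_1,z_2)\in\mathcal X_h\times M\mathcal X_h: Az_1\in\operatorname{dom}B_{\mathcal Y_1}\}$, $\mathcal A_M(z_1,z_2)=(M^{-1}z_2,\ B_{\mathcal Y_1}Az_1-DM^{-1}z_2)$, and define $\mathcal B_M:=\operatorname{diag}(A,I)\mathcal A_M\operatorname{diag}(A^{-1},I)$ on $\mathcal Y_1\times\mathcal X_M$, i.e. $\operatorname{dom}\mathcal B_M=\operatorname{diag}(A,I)\operatorname{dom}\mathcal A_M$ and $\mathcal B_M(w_1,w_2)=(AM^{-1}w_2,\ B_{\mathcal Y_1}w_1-DM^{-1}w_2)$. Let $P\in L(\mathcal G^* )$ with $\|P\|\le1$ and let $L$ be the colligation with input and output space $\mathcal G^*$, state space $\mathcal Y_1\times\mathcal X_M$, domain $\operatorname{dom}\mathcal B_M$, input boundary operator $\tfrac12\big((1-P)\mathcal R_{\mathcal G}\Xi_0+(1+P)\Xi_1\big)\operatorname{diag}(I_{\mathcal Y_1},M^{-1})$, interior operator $\mathcal B_M$, and output boundary operator $\tfrac12\big((1+P)\mathcal R_{\mathcal G}\Xi_0+(1-P)\Xi_1\big)\operatorname{diag}(I_{\mathcal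 Y_1},M^{-1})$. Then $L$ is an impedance passive internally well-posed boundary node.
   Context: All Hilbert spaces are complex; $\mathcal H^*$ is the anti-dual of $\mathcal H$ with duality pairing $\langle\cdot,\cdot\rangle_{\mathcal H^*,\mathcal H}$, $\langle h,\phi\rangle_{\mathcal H,\mathcal H^*}:=\overline{\langle\phi,h\rangle_{\mathcal H^*,\mathcal H}}$, and $\mathcal R_{\mathcal H}:\mathcal H\to\mathcal H^*$ is the Riesz isomorphism; $\mathcal H^*$ carries the Hilbert structure making $\mathcal R_{\mathcal H}$ unitary. $-D$ dissipative means $\operatorname{Re}\langle Dx,x\rangle_{\mathcal X}\ge0$ for all $x$. A colligation with input space $\mathcal U$, state space $\mathcal V$, output space $\mathcal W$ consists of linear maps $G,L,K$ with common domain $\mathcal Z\subset\mathcal V$ and values in $\mathcal U,\mathcal V,\mathcal W$. It is a boundary node if (a) $z\mapsto(Gz,Lz,Kz)$ is a closed operator from $\mathcal V$ to $\mathcal U\times\mathcal V\times\mathcal W$; (b) $G$ is surjective with $\ker G$ dense in $\mathcal V$; (c) $L|_{\ker G}$ has nonempty resolvent set; it is internally well-posed if moreover $L|_{\ker G}$ generates a $C_0$-semigroup. Smooth solutions: $u\in C^2(\mathbb R_{\ge0};\mathcal U)$, $z\in C^1(\mathbb R_{\ge0};\mathcal V)\cap C(\mathbb R_{\ge0};\mathcal Z)$ (graph norm), $y\in C(\mathbb R_{\ge0};\mathcal W)$ with $u=Gz$, $\dot z=Lz$, $y=Kz$. An internally well-posed boundary node is scattering passive if all smooth solutions satisfy $\frac{d}{dt}\|z(t)\|^2+\|y(t)\|^2\le\|u(t)\|^2$.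 For a colligation $(G,L,K)$ with $\mathcal U=\mathcal W$ and $\operatorname{Re}\beta>0$, its external Cayley transform with parameter $\beta$ has the same domain and interior operator and boundary operators $G^{(\beta)}=\frac1{\sqrt{2\operatorname{Re}\beta}}(\beta G+K)$, $K^{(\beta)}=\frac1{\sqrt{2\operatorname{Re}\beta}}(\bar\beta G-K)$; the colligation is impedance passive if its external Cayley transform is a scattering passive boundary node for some $\beta$ with $\operatorname{Re}\beta>0$. *)

theory Defs
  imports Complex_Main "HOL-Library.Function_Algebras" "HOL-Library.Product_Plus"
begin

class cvec = ab_group_add +
  fixes scaleC :: "complex \<Rightarrow> 'a \<Rightarrow> 'a" (infixr \<open>*\<^sub>C\<close> 75)
  assumes scaleC_add_right: "a *\<^sub>C (x + y) = a *\<^sub>C x + a *\<^sub>C y"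
    and scaleC_add_left: "(a + b) *\<^sub>C x = a *\<^sub>C x + b *\<^sub>C x"
    and scaleC_scaleC: "a *\<^sub>C (b *\<^sub>C x) = (a * b) *\<^sub>C x"
    and scaleC_one: "1 *\<^sub>C x = x"

instantiation complex :: cvec
begin
definition scaleC_complex :: "complex \<Rightarrow> complex \<Rightarrow> complex" where
  "scaleC_complex a x = a * x"
instance by standard (auto simp: scaleC_complex_def algebra_simps)
end

instantiation prod :: (cvec, cvec) cvec
begin
definition scaleC_prod :: "complex \<Rightarrow> 'a \<times> 'b \<Rightarrow> 'a \<times> 'b" where
  "scaleC_prod a x = (a *\<^sub>C fst x, a *\<^sub>C snd x)"
instance by standard
  (auto simp: scaleC_prod_def scaleC_add_right scaleC_add_left scaleC_scaleC scaleC_one prod_eq_iff)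
end

instantiation "fun" :: (type, cvec) cvec
begin
definition scaleC_fun :: "complex \<Rightarrow> ('a \<Rightarrow> 'b) \<Rightarrow> 'a \<Rightarrow> 'b" where
  "scaleC_fun a f = (\<lambda>x. a *\<^sub>C f x)"
instance by standard
  (auto simp: scaleC_fun_def scaleC_add_right scaleC_add_left scaleC_scaleC scaleC_one fun_eq_iff)
end

text \<open>Inner products are linear in the first and antilinear in the second argument.
  A Hilbert structure is a pair (carrier, inner product).  The same underlying set may
  carry different inner products (e.g. dom A with the graph-type inner product).\<close>

type_synonym 'a hs = "'a set \<times> ('a \<Rightarrow> 'a \<Rightarrow> complex)"

definition hs_set :: "'a hs \<Rightarrow> 'a set" where "hs_set H = fst H"
definition hs_ip :: "'a hs \<Rightarrow> 'a \<Rightarrow> 'a \<Rightarrow> complex" where "hs_ip H = snd H"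

definition hnorm :: "'a hs \<Rightarrow> 'a \<Rightarrow> real" where
  "hnorm H x = sqrt (Re (hs_ip H x x))"

definition csubspace :: "'a::cvec set \<Rightarrow> bool" where
  "csubspace S \<longleftrightarrow> 0 \<in> S \<and> (\<forall>x\<in>S. \<forall>y\<in>S. x + y \<in> S) \<and> (\<forall>c. \<forall>x\<in>S. c *\<^sub>C x \<in> S)"

definition inner_on :: "'a::cvec hs \<Rightarrow> bool" where
  "inner_on H \<longleftrightarrow> csubspace (hs_set H) \<and>
     (\<forall>x\<in>hs_set H. \<forall>y\<in>hs_set H. \<forall>z\<in>hs_set H.
        hs_ip H (x + y) z = hs_ip H x z + hs_ip H y z) \<and>
     (\<forall>c. \<forall>x\<in>hs_set H. \<forall>y\<in>hs_set H. hs_ip H (c *\<^sub>C x) y = c * hs_ip H x y) \<and>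
     (\<forall>x\<in>hs_set H. \<forall>y\<in>hs_set H. hs_ip H y x = cnj (hs_ip H x y)) \<and>
     (\<forall>x\<in>hs_set H. Re (hs_ip H x x) \<ge> 0) \<and>
     (\<forall>x\<in>hs_set H. hs_ip H x x = 0 \<longrightarrow> x = 0)"

definition hconv :: "'a::cvec hs \<Rightarrow> (nat \<Rightarrow> 'a) \<Rightarrow> 'a \<Rightarrow> bool" where
  "hconv H X x \<longleftrightarrow> (\<lambda>n. hnorm H (X n - x)) \<longlonglongrightarrow> 0"

definition hcauchy :: "'a::cvec hs \<Rightarrow> (nat \<Rightarrow> 'a) \<Rightarrow> bool" where
  "hcauchy H X \<longleftrightarrow> (\<forall>e>0. \<exists>N. \<forall>m\<ge>N. \<forall>n\<ge>N. hnorm H (X m - X n) < e)"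

definition hilbert :: "'a::cvec hs \<Rightarrow> bool" where
  "hilbert H \<longleftrightarrow> inner_on H \<and>
     (\<forall>X. (\<forall>n. X n \<in> hs_set H) \<and> hcauchy H X \<longrightarrow> (\<exists>x\<in>hs_set H. hconv H X x))"

definition prod_hs :: "'a hs \<Rightarrow> 'b hs \<Rightarrow> ('a \<times> 'b) hs" where
  "prod_hs H1 H2 = (hs_set H1 \<times> hs_set H2,
      \<lambda>p q. hs_ip H1 (fst p) (fst q) + hs_ip H2 (snd p) (snd q))"

definition clinear_on :: "'a::cvec set \<Rightarrow> ('a \<Rightarrow> 'b::cvec) \<Rightarrow> bool" where
  "clinear_on D T \<longleftrightarrow> csubspace D \<and>
     (\<forall>x\<in>D. \<forall>y\<in>D. T (x + y) = T x + T y) \<and> (\<forall>c. \<forall>x\<in>D. T (c *\<^sub>C x) = c *\<^sub>C T x)"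

definition bounded_op :: "'a::cvec hs \<Rightarrow> 'b::cvec hs \<Rightarrow> ('a \<Rightarrow> 'b) \<Rightarrow> bool" where
  "bounded_op H1 H2 T \<longleftrightarrow> clinear_on (hs_set H1) T \<and> T ` hs_set H1 \<subseteq> hs_set H2 \<and>
     (\<exists>K. \<forall>x\<in>hs_set H1. hnorm H2 (T x) \<le> K * hnorm H1 x)"

definition dense_in :: "'a::cvec hs \<Rightarrow> 'a set \<Rightarrow> bool" where
  "dense_in H D \<longleftrightarrow> D \<subseteq> hs_set H \<and>
     (\<forall>x\<in>hs_set H. \<forall>e>0. \<exists>d\<in>D. hnorm H (x - d) < e)"

definition closed_op :: "'a::cvec hs \<Rightarrow> 'b::cvec hs \<Rightarrow> 'a set \<Rightarrow> ('a \<Rightarrow> 'b) \<Rightarrow> bool" where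
  "closed_op H1 H2 D T \<longleftrightarrow> D \<subseteq> hs_set H1 \<and> T ` D \<subseteq> hs_set H2 \<and> clinear_on D T \<and>
     (\<forall>X x y. (\<forall>n. X n \<in> D) \<and> x \<in> hs_set H1 \<and> y \<in> hs_set H2 \<and>
        hconv H1 X x \<and> hconv H2 (\<lambda>n. T (X n)) y \<longrightarrow> x \<in> D \<and> T x = y)"

text \<open>The adjoint A* of A : H1 \<supseteq> DA \<rightarrow> H2 is contained in -B (B : H2 \<supseteq> DB \<rightarrow> H1).
  Here y \<in> dom A* iff some z with \<langle>Ax,y\<rangle> = \<langle>x,z\<rangle> for all x \<in> dom A, and then A* y = z
  (unique by density of dom A).\<close>
definition adjoint_subset_neg ::
  "'a::cvec hs \<Rightarrow> 'b::cvec hs \<Rightarrow> 'a set \<Rightarrow> ('a \<Rightarrow> 'b) \<Rightarrow> 'b set \<Rightarrow> ('b \<Rightarrow> 'a) \<Rightarrow> bool" where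
  "adjoint_subset_neg H1 H2 DA A DB B \<longleftrightarrow>
     (\<forall>y\<in>hs_set H2. \<forall>z\<in>hs_set H1. (\<forall>x\<in>DA. hs_ip H2 (A x) y = hs_ip H1 x z) \<longrightarrow>
        y \<in> DB \<and> z = - B y)"

definition resolvent_nonempty :: "'a::cvec hs \<Rightarrow> 'a set \<Rightarrow> ('a \<Rightarrow> 'a) \<Rightarrow> bool" where
  "resolvent_nonempty H D T \<longleftrightarrow> (\<exists>lam::complex.
     (\<forall>y\<in>hs_set H. \<exists>!x. x \<in> D \<and> lam *\<^sub>C x - T x = y) \<and>
     (\<exists>C. \<forall>x\<in>D. hnorm H x \<le> C * hnorm H (lam *\<^sub>C x - T x)))"

definition generates_C0 :: "'a::cvec hs \<Rightarrow> 'a set \<Rightarrow> ('a \<Rightarrow> 'a) \<Rightarrow> bool" where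
  "generates_C0 H D T \<longleftrightarrow> (\<exists>S :: real \<Rightarrow> 'a \<Rightarrow> 'a.
     (\<forall>t\<ge>0. bounded_op H H (S t)) \<and>
     (\<forall>x\<in>hs_set H. S 0 x = x) \<and>
     (\<forall>s\<ge>0. \<forall>t\<ge>0. \<forall>x\<in>hs_set H. S (s + t) x = S s (S t x)) \<and>
     (\<forall>x\<in>hs_set H. ((\<lambda>t. hnorm H (S t x - x)) \<longlongrightarrow> 0) (at_right 0)) \<and>
     D = {x\<in>hs_set H. \<exists>y\<in>hs_set H.
            ((\<lambda>h. hnorm H (complex_of_real (1 / h) *\<^sub>C (S h x - x) - y)) \<longlongrightarrow> 0) (at_right 0)} \<and>
     (\<forall>x\<in>D. T x \<in> hs_set H \<and>
            ((\<lambda>h. hnorm H (complex_of_real (1 / h) *\<^sub>C (S h x - x) - T x)) \<longlongrightarrow> 0) (at_right 0)))"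

definition hcont :: "'a::cvec hs \<Rightarrow> (real \<Rightarrow> 'a) \<Rightarrow> bool" where
  "hcont H f \<longleftrightarrow> (\<forall>t\<ge>0. f t \<in> hs_set H \<and>
     ((\<lambda>s. hnorm H (f s - f t)) \<longlongrightarrow> 0) (at t within {0..}))"

definition hderiv :: "'a::cvec hs \<Rightarrow> (real \<Rightarrow> 'a) \<Rightarrow> (real \<Rightarrow> 'a) \<Rightarrow> bool" where
  "hderiv H f f' \<longleftrightarrow> (\<forall>t\<ge>0. f t \<in> hs_set H \<and> f' t \<in> hs_set H \<and>
     ((\<lambda>s. hnorm H (complex_of_real (1 / (s - t)) *\<^sub>C (f s - f t) - f' t)) \<longlongrightarrow> 0)
        (at t within {0..}))"

definition hC1 :: "'a::cvec hs \<Rightarrow> (real \<Rightarrow> 'a) \<Rightarrow> bool" where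
  "hC1 H f \<longleftrightarrow> hcont H f \<and> (\<exists>f'. hderiv H f f' \<and> hcont H f')"

definition hC2 :: "'a::cvec hs \<Rightarrow> (real \<Rightarrow> 'a) \<Rightarrow> bool" where
  "hC2 H f \<longleftrightarrow> hcont H f \<and> (\<exists>f'. hderiv H f f' \<and> hC1 H f')"

text \<open>A colligation (G, L, K) with common domain Z \<subseteq> V, input space U, state space V,
  output space W.\<close>
definition colligation ::
  "'u::cvec hs \<Rightarrow> 'v::cvec hs \<Rightarrow> 'w::cvec hs \<Rightarrow> 'v set \<Rightarrow> ('v \<Rightarrow> 'u) \<Rightarrow> ('v \<Rightarrow> 'v) \<Rightarrow> ('v \<Rightarrow> 'w) \<Rightarrow> bool" where
  "colligation U V W Z G L K \<longleftrightarrow> Z \<subseteq> hs_set V \<and>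
     clinear_on Z G \<and> clinear_on Z L \<and> clinear_on Z K \<and>
     G ` Z \<subseteq> hs_set U \<and> L ` Z \<subseteq> hs_set V \<and> K ` Z \<subseteq> hs_set W"

definition boundary_node ::
  "'u::cvec hs \<Rightarrow> 'v::cvec hs \<Rightarrow> 'w::cvec hs \<Rightarrow> 'v set \<Rightarrow> ('v \<Rightarrow> 'u) \<Rightarrow> ('v \<Rightarrow> 'v) \<Rightarrow> ('v \<Rightarrow> 'w) \<Rightarrow> bool" where
  "boundary_node U V W Z G L K \<longleftrightarrow> colligation U V W Z G L K \<and>
     \<comment> \<open>(a) z \<mapsto> (Gz, Lz, Kz) is closed from V to U \<times> V \<times> W\<close>
     (\<forall>X z u v w. (\<forall>n. X n \<in> Z) \<and> z \<in> hs_set V \<and> u \<in> hs_set U \<and> v \<in> hs_set V \<and> w \<in> hs_set W \<and>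
        hconv V X z \<and> hconv U (\<lambda>n. G (X n)) u \<and> hconv V (\<lambda>n. L (X n)) v \<and> hconv W (\<lambda>n. K (X n)) w
        \<longrightarrow> z \<in> Z \<and> G z = u \<and> L z = v \<and> K z = w) \<and>
     \<comment> \<open>(b) G surjective, ker G dense in V\<close>
     G ` Z = hs_set U \<and> dense_in V {z\<in>Z. G z = 0} \<and>
     \<comment> \<open>(c) L restricted to ker G has nonempty resolvent set\<close>
     resolvent_nonempty V {z\<in>Z. G z = 0} L"

definition internally_well_posed ::
  "'u::cvec hs \<Rightarrow> 'v::cvec hs \<Rightarrow> 'w::cvec hs \<Rightarrow> 'v set \<Rightarrow> ('v \<Rightarrow> 'u) \<Rightarrow> ('v \<Rightarrow> 'v) \<Rightarrow> ('v \<Rightarrow> 'w) \<Rightarrow> bool" where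
  "internally_well_posed U V W Z G L K \<longleftrightarrow> boundary_node U V W Z G L K \<and>
     generates_C0 V {z\<in>Z. G z = 0} L"

text \<open>Smooth solutions; continuity into Z is with respect to the graph norm of (G, L, K).\<close>
definition smooth_solution ::
  "'u::cvec hs \<Rightarrow> 'v::cvec hs \<Rightarrow> 'w::cvec hs \<Rightarrow> 'v set \<Rightarrow> ('v \<Rightarrow> 'u) \<Rightarrow> ('v \<Rightarrow> 'v) \<Rightarrow> ('v \<Rightarrow> 'w)
    \<Rightarrow> (real \<Rightarrow> 'u) \<Rightarrow> (real \<Rightarrow> 'v) \<Rightarrow> (real \<Rightarrow> 'w) \<Rightarrow> bool" where
  "smooth_solution U V W Z G L K u z y \<longleftrightarrow>
     hC2 U u \<and> hC1 V z \<and>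
     (\<forall>t\<ge>0. z t \<in> Z) \<and> hcont V z \<and> hcont U (\<lambda>t. G (z t)) \<and> hcont V (\<lambda>t. L (z t)) \<and>
     hcont W (\<lambda>t. K (z t)) \<and>
     hcont W y \<and>
     (\<forall>t\<ge>0. u t = G (z t)) \<and> hderiv V z (\<lambda>t. L (z t)) \<and> (\<forall>t\<ge>0. y t = K (z t))"

definition scattering_passive ::
  "'u::cvec hs \<Rightarrow> 'v::cvec hs \<Rightarrow> 'w::cvec hs \<Rightarrow> 'v set \<Rightarrow> ('v \<Rightarrow> 'u) \<Rightarrow> ('v \<Rightarrow> 'v) \<Rightarrow> ('v \<Rightarrow> 'w) \<Rightarrow> bool" where
  "scattering_passive U V W Z G L K \<longleftrightarrow> internally_well_posed U V W Z G L K \<and>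
     (\<forall>u z y. smooth_solution U V W Z G L K u z y \<longrightarrow>
        (\<forall>t\<ge>0. \<exists>d. ((\<lambda>s. (hnorm V (z s))\<^sup>2) has_real_derivative d) (at t within {0..}) \<and>
                 d + (hnorm W (y t))\<^sup>2 \<le> (hnorm U (u t))\<^sup>2))"

definition cayley_in :: "complex \<Rightarrow> ('v \<Rightarrow> 'u::cvec) \<Rightarrow> ('v \<Rightarrow> 'u) \<Rightarrow> 'v \<Rightarrow> 'u" where
  "cayley_in \<beta> G K = (\<lambda>z. complex_of_real (1 / sqrt (2 * Re \<beta>)) *\<^sub>C (\<beta> *\<^sub>C G z + K z))"

definition cayley_out :: "complex \<Rightarrow> ('v \<Rightarrow> 'u::cvec) \<Rightarrow> ('v \<Rightarrow> 'u) \<Rightarrow> 'v \<Rightarrow> 'u" where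
  "cayley_out \<beta> G K = (\<lambda>z. complex_of_real (1 / sqrt (2 * Re \<beta>)) *\<^sub>C (cnj \<beta> *\<^sub>C G z - K z))"

definition impedance_passive ::
  "'u::cvec hs \<Rightarrow> 'v::cvec hs \<Rightarrow> 'v set \<Rightarrow> ('v \<Rightarrow> 'u) \<Rightarrow> ('v \<Rightarrow> 'v) \<Rightarrow> ('v \<Rightarrow> 'u) \<Rightarrow> bool" where
  "impedance_passive U V Z G L K \<longleftrightarrow> (\<exists>\<beta>. Re \<beta> > 0 \<and>
     scattering_passive U V U Z (cayley_in \<beta> G K) L (cayley_out \<beta> G K))"

text \<open>The anti-dual H* = bounded antilinear functionals on H (normalised to 0 off the carrier);
  the duality pairing is \<langle>\<phi>,h\<rangle>_{H*,H} = \<phi> h.\<close>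
definition antidual :: "'a::cvec hs \<Rightarrow> ('a \<Rightarrow> complex) set" where
  "antidual H = {\<phi>. (\<forall>x\<in>hs_set H. \<forall>y\<in>hs_set H. \<phi> (x + y) = \<phi> x + \<phi> y) \<and>
       (\<forall>c. \<forall>x\<in>hs_set H. \<phi> (c *\<^sub>C x) = cnj c * \<phi> x) \<and>
       (\<exists>K. \<forall>x\<in>hs_set H. cmod (\<phi> x) \<le> K * hnorm H x) \<and>
       (\<forall>x. x \<notin> hs_set H \<longrightarrow> \<phi> x = 0)}"

definition riesz :: "'a::cvec hs \<Rightarrow> 'a \<Rightarrow> 'a \<Rightarrow> complex" where
  "riesz H h = (\<lambda>g. if g \<in> hs_set H then hs_ip H h g else 0)"

definition riesz_inv :: "'a::cvec hs \<Rightarrow> ('a \<Rightarrow> complex) \<Rightarrow> 'a" where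
  "riesz_inv H \<phi> = (THE h. h \<in> hs_set H \<and> riesz H h = \<phi>)"

text \<open>H* with the Hilbert structure making the Riesz map unitary.\<close>
definition dual_hs :: "'a::cvec hs \<Rightarrow> ('a \<Rightarrow> complex) hs" where
  "dual_hs H = (antidual H, \<lambda>\<phi> \<psi>. hs_ip H (riesz_inv H \<phi>) (riesz_inv H \<psi>))"


definition XM_hs :: "('x::cvec \<Rightarrow> 'x \<Rightarrow> complex) \<Rightarrow> ('x \<Rightarrow> 'x) \<Rightarrow> 'x hs" where
  "XM_hs ipX M = (UNIV, \<lambda>x x'. ipX (inv M x) x')"

definition Y1_hs :: "('y::cvec \<Rightarrow> 'y \<Rightarrow> complex) \<Rightarrow> 'x set \<Rightarrow> ('x \<Rightarrow> 'y) \<Rightarrow> 'y hs" where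
  "Y1_hs ipY domA A = (A ` domA, ipY)"

definition Gstar_hs :: "('g1::cvec \<Rightarrow> 'g1 \<Rightarrow> complex) \<Rightarrow> ('g2::cvec \<Rightarrow> 'g2 \<Rightarrow> complex)
    \<Rightarrow> (('g1 \<Rightarrow> complex) \<times> ('g2 \<Rightarrow> complex)) hs" where
  "Gstar_hs ip1 ip2 = prod_hs (dual_hs (UNIV, ip1)) (dual_hs (UNIV, ip2))"

definition RG :: "('g1::cvec \<Rightarrow> 'g1 \<Rightarrow> complex) \<Rightarrow> ('g2::cvec \<Rightarrow> 'g2 \<Rightarrow> complex)
    \<Rightarrow> 'g1 \<times> 'g2 \<Rightarrow> ('g1 \<Rightarrow> complex) \<times> ('g2 \<Rightarrow> complex)" where
  "RG ip1 ip2 g = (riesz (UNIV, ip1) (fst g), riesz (UNIV, ip2) (snd g))"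

definition Xi0 :: "('x \<Rightarrow> 'g1) \<Rightarrow> ('y \<Rightarrow> 'g2) \<Rightarrow> 'y \<Rightarrow> 'x \<Rightarrow> 'g1 \<times> 'g2" where
  "Xi0 \<Lambda>1 \<Pi>2 v w = (\<Lambda>1 w, \<Pi>2 v)"

definition Xi1 :: "('y \<Rightarrow> 'g1s::uminus) \<Rightarrow> ('x \<Rightarrow> 'g2s) \<Rightarrow> 'y \<Rightarrow> 'x \<Rightarrow> 'g1s \<times> 'g2s" where
  "Xi1 \<Pi>1 \<Lambda>2 v w = (- \<Pi>1 v, \<Lambda>2 w)"

definition domAM :: "'x set \<Rightarrow> ('x \<Rightarrow> 'y) \<Rightarrow> 'y set \<Rightarrow> ('x \<Rightarrow> 'x) \<Rightarrow> ('x \<times> 'x) set" where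
  "domAM domA A domB M = {(z1, z2). z1 \<in> domA \<and> z2 \<in> M ` domA \<and> A z1 \<in> domB \<inter> A ` domA}"

definition domBM :: "'x set \<Rightarrow> ('x \<Rightarrow> 'y) \<Rightarrow> 'y set \<Rightarrow> ('x \<Rightarrow> 'x) \<Rightarrow> ('y \<times> 'x) set" where
  "domBM domA A domB M = (\<lambda>(z1, z2). (A z1, z2)) ` domAM domA A domB M"

definition BM :: "('x \<Rightarrow> 'y) \<Rightarrow> ('y \<Rightarrow> 'x::ab_group_add) \<Rightarrow> ('x \<Rightarrow> 'x) \<Rightarrow> ('x \<Rightarrow> 'x) \<Rightarrow> 'y \<times> 'x \<Rightarrow> 'y \<times> 'x" where
  "BM A B D M w = (A (inv M (snd w)), B (fst w) - D (inv M (snd w)))"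

definition Gin :: "('g1::cvec \<Rightarrow> 'g1 \<Rightarrow> complex) \<Rightarrow> ('g2::cvec \<Rightarrow> 'g2 \<Rightarrow> complex)
    \<Rightarrow> ('x \<Rightarrow> 'g1) \<Rightarrow> ('x \<Rightarrow> 'g2 \<Rightarrow> complex) \<Rightarrow> ('y \<Rightarrow> 'g1 \<Rightarrow> complex) \<Rightarrow> ('y \<Rightarrow> 'g2)
    \<Rightarrow> ('x \<Rightarrow> 'x) \<Rightarrow> (('g1 \<Rightarrow> complex) \<times> ('g2 \<Rightarrow> complex) \<Rightarrow> ('g1 \<Rightarrow> complex) \<times> ('g2 \<Rightarrow> complex))
    \<Rightarrow> 'y \<times> 'x \<Rightarrow> ('g1 \<Rightarrow> complex) \<times> ('g2 \<Rightarrow> complex)" where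
  "Gin ip1 ip2 \<Lambda>1 \<Lambda>2 \<Pi>1 \<Pi>2 M P w =
     (let a = RG ip1 ip2 (Xi0 \<Lambda>1 \<Pi>2 (fst w) (inv M (snd w)));
          b = Xi1 \<Pi>1 \<Lambda>2 (fst w) (inv M (snd w))
      in (1/2 :: complex) *\<^sub>C ((a - P a) + (b + P b)))"

definition Kout :: "('g1::cvec \<Rightarrow> 'g1 \<Rightarrow> complex) \<Rightarrow> ('g2::cvec \<Rightarrow> 'g2 \<Rightarrow> complex)
    \<Rightarrow> ('x \<Rightarrow> 'g1) \<Rightarrow> ('x \<Rightarrow> 'g2 \<Rightarrow> complex) \<Rightarrow> ('y \<Rightarrow> 'g1 \<Rightarrow> complex) \<Rightarrow> ('y \<Rightarrow> 'g2)
    \<Rightarrow> ('x \<Rightarrow> 'x) \<Rightarrow> (('g1 \<Rightarrow> complex) \<times> ('g2 \<Rightarrow> complex) \<Rightarrow> ('g1 \<Rightarrow> complex) \<times> ('g2 \<Rightarrow> complex))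
    \<Rightarrow> 'y \<times> 'x \<Rightarrow> ('g1 \<Rightarrow> complex) \<times> ('g2 \<Rightarrow> complex)" where
  "Kout ip1 ip2 \<Lambda>1 \<Lambda>2 \<Pi>1 \<Pi>2 M P w =
     (let a = RG ip1 ip2 (Xi0 \<Lambda>1 \<Pi>2 (fst w) (inv M (snd w)));
          b = Xi1 \<Pi>1 \<Lambda>2 (fst w) (inv M (snd w))
      in (1/2 :: complex) *\<^sub>C ((a + P a) + (b - P b)))"

end

theory Submission
  imports Defs
begin

text \<open>
  Write \<open>w = M\<inverse> z\<^sub>2\<close>, \<open>a = R \<Xi>\<^sub>0\<close>, \<open>b = \<Xi>\<^sub>1\<close>.  Green's identity gives
  \<open>Re \<langle>L z, z\<rangle> \<le> Re \<langle>a z, b z\<rangle> = (\<parallel>a z + b z\<parallel>\<^sup>2 - \<parallel>a z - b z\<parallel>\<^sup>2) / 4\<close>, and the boundary condition \<open>G z = 0\<close>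
  reads \<open>a z + b z = P (a z - b z)\<close>, so \<open>L\<close> is dissipative on \<open>ker G\<close>.  For the range condition, first
  solve \<open>\<lambda> z - L z = f\<close>, \<open>a z + b z = q\<close>: this is a Robin problem, coercive on \<open>dom A\<close>, and its weak
  solution is strong because \<open>A* \<subseteq> -B\<close> and \<open>\<Pi>\<close> is onto.  For fixed \<open>f\<close> the energy balance makes
  \<open>q \<mapsto> a z - b z\<close> a strict contraction, since \<open>\<Lambda>\<close> and \<open>\<Pi>\<close> are bounded in the graph norms (uniform
  boundedness applied to Green's identity), and a fixed point of \<open>q \<mapsto> P (a z - b z) + const\<close> gives the
  range condition for \<open>ker G\<close>.  A maximal dissipative operator generates a contraction semigroup, the
  limit of the implicit Euler scheme along dyadic step sizes.  The external Cayley transform with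
  parameter \<open>1\<close> has boundary operators \<open>(a + b) / sqrt 2\<close> and \<open>P (b - a) / sqrt 2\<close>, the same situation
  with \<open>0\<close> in place of the contraction \<open>P\<close> at the input.
\<close>

section \<open>Hilbert structures on a carrier\<close>

text \<open>The obstacle is that \<open>P\<close> may have norm exactly 1 and may fail to be
  injective. With norm 1 the contraction must come from the system: two Robin solutions with the
  same \<open>f\<close> differ by some \<open>d\<close> with \<open>L d = l d\<close>, so the energy
  balance loses \<open>4 * l\<close> times the squared norm of \<open>d\<close>. The trace bounds
  estimate the boundary data of \<open>d\<close> by the norm of \<open>d\<close>, which turns this
  loss into a fixed fraction of the data. Without injectivity, \<open>a z - b z\<close> cannot in
  general be read off from input and output, only \<open>a z + b z\<close> can. Closedness of the
  node is therefore deduced from Robin solvability and the energy estimate. Green's identity becomes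
  a single inner product in \<open>G1 \<times> G2*\<close>, while the node has its signals in
  \<open>G1* \<times> G2*\<close>. The second-order system is treated with one pair of traces into
  the former space, and the Riesz maps enter only in the final reduction. Density of the kernel of
  \<open>G\<close> follows from dissipativity and the range condition.\<close>

interpretation cvec: vector_space "scaleC :: complex \<Rightarrow> 'a::cvec \<Rightarrow> 'a"
  by unfold_locales (auto simp: scaleC_add_right scaleC_add_left scaleC_scaleC scaleC_one)

lemma squeeze_zero:
  fixes f g :: "'b \<Rightarrow> real"
  assumes "(g \<longlongrightarrow> 0) F" "\<forall>\<^sub>F x in F. 0 \<le> f x \<and> f x \<le> g x"
  shows "(f \<longlongrightarrow> 0) F"
  by (rule tendsto_sandwich[of "\<lambda>_. 0" f F g])
    (use assms in \<open>auto elim: eventually_mono\<close>)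

lemma cadd_mem: "csubspace S \<Longrightarrow> x \<in> S \<Longrightarrow> y \<in> S \<Longrightarrow> x + y \<in> S"
  and cscale_mem: "csubspace S \<Longrightarrow> x \<in> S \<Longrightarrow> c *\<^sub>C x \<in> S"
  and czero_mem: "csubspace S \<Longrightarrow> 0 \<in> S"
  by (auto simp: csubspace_def)

lemma cneg_mem: "csubspace S \<Longrightarrow> x \<in> S \<Longrightarrow> - x \<in> S"
  using cscale_mem[of S x "-1"] by simp

lemma cdiff_mem: "csubspace S \<Longrightarrow> x \<in> S \<Longrightarrow> y \<in> S \<Longrightarrow> x - y \<in> S"
  using cadd_mem[of S x "-y"] cneg_mem[of S y] by simp

lemma clinear_on_add: "clinear_on D T \<Longrightarrow> x \<in> D \<Longrightarrow> y \<in> D \<Longrightarrow> T (x + y) = T x + T y"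
  and clinear_on_scale: "clinear_on D T \<Longrightarrow> x \<in> D \<Longrightarrow> T (c *\<^sub>C x) = c *\<^sub>C T x"
  and clinear_on_subspace: "clinear_on D T \<Longrightarrow> csubspace D"
  by (auto simp: clinear_on_def)

lemma clinear_on_neg: "clinear_on D T \<Longrightarrow> x \<in> D \<Longrightarrow> T (- x) = - T x"
  using clinear_on_scale[of D T x "-1"] by simp

lemma clinear_on_diff: "clinear_on D T \<Longrightarrow> x \<in> D \<Longrightarrow> y \<in> D \<Longrightarrow> T (x - y) = T x - T y"
  using clinear_on_add[of D T x "-y"] cneg_mem[of D y]
  by (simp add: clinear_on_neg clinear_on_subspace)

lemma clinear_on_zero: "clinear_on D T \<Longrightarrow> T 0 = 0"
  using clinear_on_scale[of D T 0 0] czero_mem[of D] by (simp add: clinear_on_subspace)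

lemmas clinear_on_simps =
  clinear_on_add clinear_on_scale clinear_on_neg clinear_on_diff clinear_on_zero

locale ips =
  fixes H :: "'a::cvec hs"
  assumes inner_on: "inner_on H"
begin

abbreviation "car \<equiv> hs_set H"
abbreviation "ip \<equiv> hs_ip H"
abbreviation "nrm \<equiv> hnorm H"

lemma car_subspace: "csubspace car"
  using inner_on by (simp add: inner_on_def)

lemma mem [simp]:
  "0 \<in> car"
  "x \<in> car \<Longrightarrow> y \<in> car \<Longrightarrow> x + y \<in> car"
  "x \<in> car \<Longrightarrow> y \<in> car \<Longrightarrow> x - y \<in> car"
  "x \<in> car \<Longrightarrow> - x \<in> car"
  "x \<in> car \<Longrightarrow> c *\<^sub>C x \<in> car"
  using car_subspace by (simp_all add: czero_mem cadd_mem cdiff_mem cneg_mem cscale_mem)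

lemma ip_add_left: "x \<in> car \<Longrightarrow> y \<in> car \<Longrightarrow> z \<in> car \<Longrightarrow> ip (x + y) z = ip x z + ip y z"
  and ip_scale_left: "x \<in> car \<Longrightarrow> y \<in> car \<Longrightarrow> ip (c *\<^sub>C x) y = c * ip x y"
  and ip_commute: "x \<in> car \<Longrightarrow> y \<in> car \<Longrightarrow> ip y x = cnj (ip x y)"
  and ip_ge0: "x \<in> car \<Longrightarrow> 0 \<le> Re (ip x x)"
  and ip_eq0: "x \<in> car \<Longrightarrow> ip x x = 0 \<Longrightarrow> x = 0"
  using inner_on unfolding inner_on_def by blast+

lemma ip_zero_left: "x \<in> car \<Longrightarrow> ip 0 x = 0"
  using ip_scale_left[of 0 x 0] by simp

lemma ip_neg_left: "x \<in> car \<Longrightarrow> y \<in> car \<Longrightarrow> ip (- x) y = - ip x y"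
  using ip_scale_left[of x y "-1"] by simp

lemma ip_diff_left: "x \<in> car \<Longrightarrow> y \<in> car \<Longrightarrow> z \<in> car \<Longrightarrow> ip (x - y) z = ip x z - ip y z"
  using ip_add_left[of x "-y" z] by (simp add: ip_neg_left)

lemma ip_add_right: "x \<in> car \<Longrightarrow> y \<in> car \<Longrightarrow> z \<in> car \<Longrightarrow> ip x (y + z) = ip x y + ip x z"
  by (subst (1 2 3) ip_commute) (auto simp: ip_add_left)

lemma ip_diff_right: "x \<in> car \<Longrightarrow> y \<in> car \<Longrightarrow> z \<in> car \<Longrightarrow> ip x (y - z) = ip x y - ip x z"
  by (subst (1 2 3) ip_commute) (auto simp: ip_diff_left)

lemma ip_scale_right: "x \<in> car \<Longrightarrow> y \<in> car \<Longrightarrow> ip x (c *\<^sub>C y) = cnj c * ip x y"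
  by (subst (1 2) ip_commute) (auto simp: ip_scale_left)

lemma ip_neg_right: "x \<in> car \<Longrightarrow> y \<in> car \<Longrightarrow> ip x (- y) = - ip x y"
  by (subst (1 2) ip_commute) (auto simp: ip_neg_left)

lemma ip_zero_right: "x \<in> car \<Longrightarrow> ip x 0 = 0"
  by (subst ip_commute) (auto simp: ip_zero_left)

lemmas ip_simps = ip_add_left ip_scale_left ip_zero_left ip_neg_left ip_diff_left
  ip_add_right ip_scale_right ip_zero_right ip_neg_right ip_diff_right

lemma Re_ip_commute: "x \<in> car \<Longrightarrow> y \<in> car \<Longrightarrow> Re (ip y x) = Re (ip x y)"
  by (subst ip_commute) auto

lemma nrm_sq: "x \<in> car \<Longrightarrow> (nrm x)\<^sup>2 = Re (ip x x)"
  by (simp add: hnorm_def ip_ge0)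

lemma ip_self: "x \<in> car \<Longrightarrow> ip x x = complex_of_real ((nrm x)\<^sup>2)"
  using ip_commute[of x x] by (simp add: complex_eq_iff nrm_sq)

lemma nrm_ge0 [simp]: "x \<in> car \<Longrightarrow> 0 \<le> nrm x"
  by (simp add: hnorm_def ip_ge0)

lemma nrm_zero [simp]: "nrm 0 = 0"
  by (simp add: hnorm_def ip_zero_left)

lemma nrm_eq0: "x \<in> car \<Longrightarrow> nrm x = 0 \<longleftrightarrow> x = 0"
  using ip_self[of x] ip_eq0[of x] by auto

lemma nrm_scale: "x \<in> car \<Longrightarrow> nrm (c *\<^sub>C x) = cmod c * nrm x"
proof -
  assume x: "x \<in> car"
  have "ip (c *\<^sub>C x) (c *\<^sub>C x) = (c * cnj c) * ip x x"
    using x by (simp add: ip_simps)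
  also have "\<dots> = complex_of_real ((cmod c * nrm x)\<^sup>2)"
    using x by (simp add: ip_self power_mult_distrib flip: complex_norm_square)
  finally have "(nrm (c *\<^sub>C x))\<^sup>2 = (cmod c * nrm x)\<^sup>2"
    using x by (metis Re_complex_of_real mem(5) nrm_sq)
  then show ?thesis
    using x by (metis mem(5) nrm_ge0 norm_ge_zero power2_eq_imp_eq mult_nonneg_nonneg)
qed

lemma nrm_minus: "x \<in> car \<Longrightarrow> nrm (- x) = nrm x"
  using nrm_scale[of x "-1"] by simp

lemma nrm_minus_commute: "x \<in> car \<Longrightarrow> y \<in> car \<Longrightarrow> nrm (x - y) = nrm (y - x)"
  using nrm_minus[of "x - y"] by simp

lemma nrm_add_sq: "x \<in> car \<Longrightarrow> y \<in> car \<Longrightarrow>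
    (nrm (x + y))\<^sup>2 = (nrm x)\<^sup>2 + 2 * Re (ip x y) + (nrm y)\<^sup>2"
  using Re_ip_commute[of x y] by (simp add: nrm_sq ip_simps)

lemma nrm_diff_sq: "x \<in> car \<Longrightarrow> y \<in> car \<Longrightarrow>
    (nrm (x - y))\<^sup>2 = (nrm x)\<^sup>2 - 2 * Re (ip x y) + (nrm y)\<^sup>2"
  using Re_ip_commute[of x y] by (simp add: nrm_sq ip_simps)

lemma polarization: "x \<in> car \<Longrightarrow> y \<in> car \<Longrightarrow>
    4 * Re (ip x y) = (nrm (x + y))\<^sup>2 - (nrm (x - y))\<^sup>2"
  by (simp add: nrm_add_sq nrm_diff_sq)

lemma cauchy_schwarz: "x \<in> car \<Longrightarrow> y \<in> car \<Longrightarrow> cmod (ip x y) \<le> nrm x * nrm y"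
proof (cases "y = 0")
  case False
  assume x: "x \<in> car" and y: "y \<in> car"
  have ny: "nrm y > 0"
    using False y nrm_eq0[of y] nrm_ge0[of y] by linarith
  \<comment> \<open>\<open>c *\<^sub>C y\<close> is the orthogonal projection of \<open>x\<close>
    onto the line through \<open>y\<close>; the inequality says that the remainder has nonnegative
    squared norm.\<close>
  define c where "c = ip x y / complex_of_real ((nrm y)\<^sup>2)"
  have "(nrm (x - c *\<^sub>C y))\<^sup>2 = (nrm x)\<^sup>2 - 2 * Re (cnj c * ip x y) + (cmod c * nrm y)\<^sup>2"
    using x y by (simp add: nrm_diff_sq ip_simps nrm_scale)
  moreover have "cnj c * ip x y = complex_of_real ((cmod (ip x y))\<^sup>2 / (nrm y)\<^sup>2)"
    by (simp add: c_def complex_norm_square[symmetric] mult.commute)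
  moreover have "(cmod c * nrm y)\<^sup>2 = (cmod (ip x y))\<^sup>2 / (nrm y)\<^sup>2"
  proof -
    have "cmod c * nrm y = cmod (ip x y) / nrm y"
      using ny by (simp add: c_def norm_divide norm_mult norm_power power2_eq_square[of "nrm y"])
    then show ?thesis
      by (simp add: power_divide)
  qed
  ultimately have "0 \<le> (nrm x)\<^sup>2 - (cmod (ip x y))\<^sup>2 / (nrm y)\<^sup>2"
    by (metis (no_types, lifting) Re_complex_of_real add_diff_cancel_right diff_add_eq
        diff_diff_eq2 mult_2 zero_le_power2)
  then have "(cmod (ip x y))\<^sup>2 \<le> (nrm x * nrm y)\<^sup>2"
    using ny by (simp add: field_simps power_mult_distrib)
  then show ?thesis
    using x y by (metis abs_le_square_iff abs_of_nonneg mult_nonneg_nonneg norm_ge_zero nrm_ge0)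
qed (simp add: ip_zero_right)

lemma Re_ip_le: "x \<in> car \<Longrightarrow> y \<in> car \<Longrightarrow> Re (ip x y) \<le> nrm x * nrm y"
  using cauchy_schwarz[of x y] complex_Re_le_cmod[of "ip x y"] by linarith

lemma nrm_triangle: "x \<in> car \<Longrightarrow> y \<in> car \<Longrightarrow> nrm (x + y) \<le> nrm x + nrm y"
  by (rule power2_le_imp_le) (use Re_ip_le[of x y] in \<open>auto simp: nrm_add_sq power2_sum\<close>)

lemma nrm_triangle_diff: "x \<in> car \<Longrightarrow> y \<in> car \<Longrightarrow> nrm (x - y) \<le> nrm x + nrm y"
  using nrm_triangle[of x "-y"] by (simp add: nrm_minus)

lemma nrm_dist_triangle: "x \<in> car \<Longrightarrow> y \<in> car \<Longrightarrow> z \<in> car \<Longrightarrow> nrm (x - z) \<le> nrm (x - y) + nrm (y - z)"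
  using nrm_triangle[of "x - y" "y - z"] by simp

lemma nrm_le_add_diff: "x \<in> car \<Longrightarrow> y \<in> car \<Longrightarrow> nrm x \<le> nrm y + nrm (x - y)"
  using nrm_triangle[of y "x - y"] by simp

lemma nrm_diff_abs: "x \<in> car \<Longrightarrow> y \<in> car \<Longrightarrow> \<bar>nrm x - nrm y\<bar> \<le> nrm (x - y)"
  using nrm_le_add_diff[of x y] nrm_le_add_diff[of y x] nrm_minus_commute[of x y] by auto

section \<open>Convergence in a carrier\<close>

lemma hconv_unique:
  assumes "\<And>n. X n \<in> car" "x \<in> car" "y \<in> car" "hconv H X x" "hconv H X y"
  shows "x = y"
proof -
  have "(\<lambda>n. nrm (X n - x) + nrm (X n - y)) \<longlonglongrightarrow> 0 + 0"
    using assms by (intro tendsto_add) (simp_all add: hconv_def)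
  moreover have "nrm (x - y) \<le> nrm (X n - x) + nrm (X n - y)" for n
    using nrm_dist_triangle[of x "X n" y] nrm_minus_commute[of x "X n"] assms by simp
  ultimately have "nrm (x - y) \<le> 0 + 0"
    by (intro tendsto_lowerbound[of _ _ sequentially]) auto
  then show ?thesis
    using assms nrm_eq0[of "x - y"] nrm_ge0[of "x - y"] by (simp add: order_antisym)
qed

lemma hconv_nrm:
  assumes "\<And>n. X n \<in> car" "x \<in> car" "hconv H X x"
  shows "(\<lambda>n. nrm (X n)) \<longlonglongrightarrow> nrm x"
proof (rule LIM_zero_cancel, rule tendsto_rabs_zero_cancel, rule squeeze_zero)
  show "(\<lambda>n. nrm (X n - x)) \<longlonglongrightarrow> 0"
    using assms by (simp add: hconv_def)
  show "\<forall>\<^sub>F n in sequentially. 0 \<le> \<bar>nrm (X n) - nrm x\<bar> \<and> \<bar>nrm (X n) - nrm x\<bar> \<le> nrm (X n - x)"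
    using assms by (auto simp: nrm_diff_abs)
qed

lemma hconv_nrm_diff:
  assumes "\<And>n. X n \<in> car" "x \<in> car" "y \<in> car" "hconv H X x"
  shows "(\<lambda>n. nrm (X n - y)) \<longlonglongrightarrow> nrm (x - y)"
  using assms by (intro hconv_nrm) (auto simp: hconv_def)

lemma hconv_add:
  assumes "\<And>n. X n \<in> car" "x \<in> car" "hconv H X x" "\<And>n. Y n \<in> car" "y \<in> car" "hconv H Y y"
  shows "hconv H (\<lambda>n. X n + Y n) (x + y)"
  unfolding hconv_def
proof (rule squeeze_zero)
  show "(\<lambda>n. nrm (X n - x) + nrm (Y n - y)) \<longlonglongrightarrow> 0"
    using tendsto_add[of "\<lambda>n. nrm (X n - x)" 0 sequentially "\<lambda>n. nrm (Y n - y)" 0] assms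
    by (simp add: hconv_def)
  show "\<forall>\<^sub>F n in sequentially. 0 \<le> nrm (X n + Y n - (x + y)) \<and>
      nrm (X n + Y n - (x + y)) \<le> nrm (X n - x) + nrm (Y n - y)"
    using assms nrm_triangle[of "X n - x" "Y n - y" for n] by (simp add: add_diff_add)
qed

lemma hconv_scale:
  assumes "\<And>n. X n \<in> car" "x \<in> car" "hconv H X x"
  shows "hconv H (\<lambda>n. c *\<^sub>C X n) (c *\<^sub>C x)"
  using tendsto_mult_right_zero[of "\<lambda>n. nrm (X n - x)" sequentially "cmod c"] assms
  by (simp add: hconv_def nrm_scale flip: cvec.scale_right_diff_distrib)

lemma hconv_neg:
  assumes "\<And>n. X n \<in> car" "x \<in> car" "hconv H X x"
  shows "hconv H (\<lambda>n. - X n) (- x)"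
  using hconv_scale[of X x "-1"] assms by simp

lemma hconv_diff:
  assumes "\<And>n. X n \<in> car" "x \<in> car" "hconv H X x" "\<And>n. Y n \<in> car" "y \<in> car" "hconv H Y y"
  shows "hconv H (\<lambda>n. X n - Y n) (x - y)"
  using hconv_add[of X x "\<lambda>n. - Y n" "- y"] assms by (simp add: hconv_neg)

lemma hconv_const: "hconv H (\<lambda>n. x) x"
  by (simp add: hconv_def)

lemma hconv_hcauchy:
  assumes "\<And>n. X n \<in> car" "x \<in> car" "hconv H X x"
  shows "hcauchy H X"
  unfolding hcauchy_def
proof (intro allI impI)
  fix e :: real assume "e > 0"
  then obtain N where N: "\<And>n. n \<ge> N \<Longrightarrow> nrm (X n - x) < e / 2"
    using order_tendstoD(2)[of "\<lambda>n. nrm (X n - x)" 0 sequentially "e / 2"] assms(3)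
    by (auto simp: hconv_def eventually_sequentially)
  have "nrm (X m - X n) < e" if "m \<ge> N" "n \<ge> N" for m n
    using N[OF that(1)] N[OF that(2)] nrm_dist_triangle[of "X m" x "X n"]
      nrm_minus_commute[of x "X n"] assms(1,2) by simp
  then show "\<exists>N. \<forall>m\<ge>N. \<forall>n\<ge>N. nrm (X m - X n) < e"
    by blast
qed

end

lemma hcauchy_le:
  assumes "ips H" "\<And>n. X n \<in> hs_set H" "\<And>m n. m \<le> n \<Longrightarrow> hnorm H (X n - X m) \<le> f m" "f \<longlonglongrightarrow> (0::real)"
  shows "hcauchy H X"
  unfolding hcauchy_def
proof (intro allI impI)
  interpret ips H by fact
  fix e :: real assume "e > 0"
  then obtain N where N: "\<And>n. n \<ge> N \<Longrightarrow> f n < e"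
    using assms(4) order_tendstoD(2)[of f 0 sequentially e] by (auto simp: eventually_sequentially)
  have "nrm (X m - X n) < e" if "m \<ge> N" "n \<ge> N" for m n
    using assms(3)[of m n] assms(3)[of n m] N[OF that(1)] N[OF that(2)]
      nrm_minus_commute[of "X m" "X n"] assms(2) by (cases "m \<le> n") auto
  then show "\<exists>N. \<forall>m\<ge>N. \<forall>n\<ge>N. nrm (X m - X n) < e"
    by blast
qed

locale hil = ips H for H :: "'a::cvec hs" +
  assumes complete: "\<And>X. (\<And>n. X n \<in> hs_set H) \<Longrightarrow> hcauchy H X \<Longrightarrow> \<exists>x\<in>hs_set H. hconv H X x"

lemma hilbert_iff_hil: "hilbert H \<longleftrightarrow> hil H"
  unfolding hilbert_def hil_def hil_axioms_def ips_def by blast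

section \<open>Completeness: fixed points, Riesz representation, Lax-Milgram, uniform
  boundedness\<close>

context hil
begin

text \<open>The partial geometric sum is kept in the induction so that the tail bound comes out
  explicitly: the gliding hump below must know how far the limit is from every \<open>X n\<close>,
  not only that it exists.\<close>

lemma geometric_limit:
  assumes X: "\<And>n. X n \<in> car" and k: "0 \<le> k" "k < 1"
    and step: "\<And>n. nrm (X (Suc n) - X n) \<le> C * k ^ n"
  shows "\<exists>x\<in>car. hconv H X x \<and> (\<forall>n. nrm (x - X n) \<le> C * k ^ n / (1 - k))"
proof -
  have C: "C \<ge> 0"
    using step[of 0] nrm_ge0[OF mem(3)[OF X X, of 1 0]] by simp
  have tel: "nrm (X (n + m) - X n) \<le> C * k ^ n * (1 - k ^ m) / (1 - k)" for m n
  proof (induction m)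
    case (Suc m)
    have "nrm (X (n + Suc m) - X n) \<le> nrm (X (Suc (n + m)) - X (n + m)) + nrm (X (n + m) - X n)"
      using nrm_dist_triangle X by simp
    also have "\<dots> \<le> C * k ^ (n + m) + C * k ^ n * (1 - k ^ m) / (1 - k)"
      using Suc step by (intro add_mono) auto
    also have "\<dots> = C * k ^ n * (1 - k ^ Suc m) / (1 - k)"
      using k by (simp add: field_simps power_add)
    finally show ?case .
  qed simp
  have tel': "nrm (X (n + m) - X n) \<le> C * k ^ n / (1 - k)" for m n
    using tel[of n m] k C
    by (smt (verit, best) divide_right_mono mult_left_le mult_nonneg_nonneg zero_le_power)
  have "(\<lambda>n. C * k ^ n / (1 - k)) \<longlonglongrightarrow> C * 0 / (1 - k)"
    using k by (intro tendsto_intros LIMSEQ_realpow_zero) auto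
  then have "hcauchy H X"
    using X tel' by (intro hcauchy_le[of _ _ "\<lambda>n. C * k ^ n / (1 - k)"])
      (auto simp: ips_axioms dest!: le_Suc_ex)
  then obtain x where x: "x \<in> car" "hconv H X x"
    using complete X by blast
  have "nrm (x - X n) \<le> C * k ^ n / (1 - k)" for n
  proof (rule LIMSEQ_le_const2)
    show "(\<lambda>m. nrm (X m - X n)) \<longlonglongrightarrow> nrm (x - X n)"
      using hconv_nrm_diff X x by simp
    show "\<exists>N. \<forall>m\<ge>N. nrm (X m - X n) \<le> C * k ^ n / (1 - k)"
      using tel' by (intro exI[of _ n]) (auto dest!: le_Suc_ex)
  qed
  with x show ?thesis by blast
qed

lemma banach_fixpoint:
  assumes F: "\<And>x. x \<in> car \<Longrightarrow> F x \<in> car" and k: "0 \<le> k" "k < 1"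
    and contr: "\<And>x y. x \<in> car \<Longrightarrow> y \<in> car \<Longrightarrow> nrm (F x - F y) \<le> k * nrm (x - y)"
  shows "\<exists>x\<in>car. F x = x"
proof -
  define X where "X n = (F ^^ n) 0" for n
  have X: "X n \<in> car" for n
    by (induction n) (simp_all add: X_def F)
  have XS: "X (Suc n) = F (X n)" for n
    by (simp add: X_def)
  have step: "nrm (X (Suc n) - X n) \<le> nrm (F 0) * k ^ n" for n
  proof (induction n)
    case (Suc n)
    have "nrm (X (Suc (Suc n)) - X (Suc n)) \<le> k * nrm (X (Suc n) - X n)"
      using contr[OF X X, of "Suc n" n] by (simp add: XS)
    also have "\<dots> \<le> k * (nrm (F 0) * k ^ n)"
      using Suc k by (intro mult_left_mono) auto
    finally show ?case by (simp add: algebra_simps)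
  qed (simp add: X_def)
  obtain x where x: "x \<in> car" "hconv H X x"
    using geometric_limit[OF X k step] by blast
  have "hconv H (\<lambda>n. X (Suc n)) x"
    using x(2) LIMSEQ_Suc by (simp add: hconv_def)
  moreover have "hconv H (\<lambda>n. X (Suc n)) (F x)"
    unfolding hconv_def
  proof (rule squeeze_zero)
    show "(\<lambda>n. k * nrm (X n - x)) \<longlonglongrightarrow> 0"
      using tendsto_mult_right_zero x(2) by (auto simp: hconv_def)
    show "\<forall>\<^sub>F n in sequentially. 0 \<le> nrm (X (Suc n) - F x) \<and>
        nrm (X (Suc n) - F x) \<le> k * nrm (X n - x)"
      using contr[OF X x(1)] F[OF X] F[OF x(1)] by (simp add: XS)
  qed
  ultimately have "F x = x"
    using hconv_unique[of "\<lambda>n. X (Suc n)" "F x" x] X x F by blast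
  then show ?thesis
    using x by blast
qed

text \<open>Direct minimisation of the quadratic functional \<open>J\<close>: it is bounded below,
  the parallelogram law makes a minimising sequence Cauchy, and the vanishing first variation
  identifies the real parts. Testing with \<open>\<i> *\<^sub>C y\<close> recovers the imaginary
  parts. As \<open>\<phi>\<close> is antilinear, the representing vector stands in the first slot of
  \<open>ip\<close>.\<close>

lemma riesz_representation:
  assumes add: "\<And>x y. x \<in> car \<Longrightarrow> y \<in> car \<Longrightarrow> \<phi> (x + y) = \<phi> x + \<phi> y"
    and scale: "\<And>c x. x \<in> car \<Longrightarrow> \<phi> (c *\<^sub>C x) = cnj c * \<phi> x"
    and bdd: "\<And>x. x \<in> car \<Longrightarrow> cmod (\<phi> x) \<le> K * nrm x"
  shows "\<exists>h\<in>car. \<forall>x\<in>car. \<phi> x = ip h x"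
proof -
  define J where "J x = (nrm x)\<^sup>2 - 2 * Re (\<phi> x)" for x
  have "J x \<ge> - K\<^sup>2" if "x \<in> car" for x
  proof -
    have "Re (\<phi> x) \<le> K * nrm x"
      using bdd[OF that] complex_Re_le_cmod[of "\<phi> x"] by linarith
    moreover have "0 \<le> (nrm x - K)\<^sup>2" by simp
    ultimately show ?thesis
      unfolding J_def power2_diff by (simp add: mult.commute)
  qed
  then have bb: "bdd_below (J ` car)"
    by (auto intro!: bdd_belowI2)
  define m where "m = Inf (J ` car)"
  have m_le: "m \<le> J x" if "x \<in> car" for x
    unfolding m_def using bb that by (intro cInf_lower) auto
  have "\<exists>x\<in>car. J x < m + e" if "e > 0" for e
    using cInf_lessD[of "J ` car" "m + e"] that mem(1) unfolding m_def by (auto simp del: mem(1))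
  then have "\<forall>n. \<exists>x. x \<in> car \<and> J x < m + inverse (real (Suc n))"
    by (meson inverse_positive_iff_positive of_nat_0_less_iff zero_less_Suc)
  then obtain X where X: "\<And>n. X n \<in> car" "\<And>n. J (X n) < m + inverse (real (Suc n))"
    by metis
  \<comment> \<open>Parallelogram law: \<open>J x + J y - 2 * J ((x + y) / 2) = (nrm (x - y))\<^sup>2 / 2\<close>.\<close>
  have par: "(nrm (x - y))\<^sup>2 \<le> 2 * (J x - m) + 2 * (J y - m)" if xy: "x \<in> car" "y \<in> car" for x y
  proof -
    have "J ((1/2) *\<^sub>C (x + y)) = (nrm (x + y))\<^sup>2 / 4 - Re (\<phi> x) - Re (\<phi> y)"
      using xy by (simp add: J_def nrm_scale scale add power_mult_distrib norm_divide power_divide add_divide_distrib)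
    moreover have "m \<le> J ((1/2) *\<^sub>C (x + y))"
      using m_le xy by simp
    ultimately have "m \<le> (nrm (x + y))\<^sup>2 / 4 - Re (\<phi> x) - Re (\<phi> y)"
      by simp
    then show ?thesis
      unfolding J_def nrm_add_sq[OF xy] nrm_diff_sq[OF xy] by argo
  qed
  have "hcauchy H X"
  proof (rule hcauchy_le)
    show "nrm (X n - X k) \<le> sqrt (4 * inverse (real (Suc k)))" if "k \<le> n" for k n
    proof (rule real_le_rsqrt)
      have "inverse (real (Suc n)) \<le> inverse (real (Suc k))"
        using that by simp
      then show "(nrm (X n - X k))\<^sup>2 \<le> 4 * inverse (real (Suc k))"
        using par[OF X(1) X(1), of n k] X(2)[of n] X(2)[of k] by argo
    qed
    have "(\<lambda>k. sqrt (4 * inverse (real (Suc k)))) \<longlonglongrightarrow> sqrt (4 * 0)"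
      by (intro tendsto_intros LIMSEQ_inverse_real_of_nat)
    then show "(\<lambda>k. sqrt (4 * inverse (real (Suc k)))) \<longlonglongrightarrow> 0"
      by simp
  qed (use X ips_axioms in auto)
  then obtain x where x: "x \<in> car" "hconv H X x"
    using complete X(1) by blast
  have phi0: "\<phi> (y - z) = \<phi> y - \<phi> z" if "y \<in> car" "z \<in> car" for y z
    using add[of y "-z"] scale[of z "-1"] that by simp
  have "(\<lambda>n. \<phi> (X n)) \<longlonglongrightarrow> \<phi> x"
  proof (rule LIM_zero_cancel, rule tendsto_norm_zero_cancel, rule squeeze_zero)
    show "(\<lambda>n. K * nrm (X n - x)) \<longlonglongrightarrow> 0"
      using tendsto_mult_right_zero x(2) by (auto simp: hconv_def)
    show "\<forall>\<^sub>F n in sequentially. 0 \<le> cmod (\<phi> (X n) - \<phi> x) \<and>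
        cmod (\<phi> (X n) - \<phi> x) \<le> K * nrm (X n - x)"
      using bdd[of "X n - x" for n] X(1) x(1) by (simp add: phi0)
  qed
  then have "(\<lambda>n. J (X n)) \<longlonglongrightarrow> J x"
    unfolding J_def using hconv_nrm[OF X(1) x] by (intro tendsto_intros) auto
  moreover have "(\<lambda>n. m + inverse (real (Suc n))) \<longlonglongrightarrow> m + 0"
    by (intro tendsto_intros LIMSEQ_inverse_real_of_nat)
  ultimately have Jx: "J x \<le> m"
    using X(2) by (intro LIMSEQ_le[of "\<lambda>n. J (X n)" "J x" "\<lambda>n. m + inverse (real (Suc n))"])
      (auto intro!: less_imp_le)
  have Re0: "Re (ip x y) = Re (\<phi> y)" if y: "y \<in> car" for y
  proof (cases "y = 0")
    case False
    then have ny: "nrm y > 0"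
      using y nrm_eq0[of y] nrm_ge0[of y] by linarith
    define d where "d = Re (ip x y) - Re (\<phi> y)"
    \<comment> \<open>\<open>e\<close> minimises
      \<open>2 * e * d + e\<^sup>2 * (nrm y)\<^sup>2\<close>, the change of \<open>J\<close> along
      \<open>y\<close>; the minimum is negative unless \<open>d = 0\<close>.\<close>
    define e where "e = - d / (nrm y)\<^sup>2"
    have "J (x + complex_of_real e *\<^sub>C y) = J x + (2 * e * d + e\<^sup>2 * (nrm y)\<^sup>2)"
      using x(1) y by (simp add: J_def nrm_add_sq ip_simps nrm_scale add scale d_def
          power_mult_distrib) (simp add: algebra_simps)
    also have "2 * e * d + e\<^sup>2 * (nrm y)\<^sup>2 = - (d\<^sup>2 / (nrm y)\<^sup>2)"
      using ny by (simp add: e_def field_simps power2_eq_square)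
    finally have "d\<^sup>2 / (nrm y)\<^sup>2 \<le> 0"
      using m_le[of "x + complex_of_real e *\<^sub>C y"] Jx x(1) y by simp
    then have "d = 0"
      using ny by (simp add: divide_le_0_iff)
    then show ?thesis by (simp add: d_def)
  qed (use x scale[of 0 0] in \<open>simp add: ip_simps\<close>)
  have "\<phi> y = ip x y" if y: "y \<in> car" for y
    using Re0[OF y] Re0[of "\<i> *\<^sub>C y"] y x(1) by (simp add: scale ip_simps complex_eq_iff)
  then show ?thesis
    using x(1) by blast
qed

text \<open>Riesz turns the form into a map \<open>T\<close> and the right-hand side into
  \<open>r\<close>; by boundedness and coercivity the damped iteration \<open>F\<close> is a strict
  contraction, and its fixed point solves \<open>T w = r\<close>. The form is not assumed symmetric,
  since \<open>D\<close> need not be self-adjoint.\<close>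

lemma lax_milgram:
  assumes add1: "\<And>w v x. w \<in> car \<Longrightarrow> v \<in> car \<Longrightarrow> x \<in> car \<Longrightarrow> a (w - v) x = a w x - a v x"
    and add2: "\<And>w x y. w \<in> car \<Longrightarrow> x \<in> car \<Longrightarrow> y \<in> car \<Longrightarrow> a w (x + y) = a w x + a w y"
    and scale2: "\<And>c w x. w \<in> car \<Longrightarrow> x \<in> car \<Longrightarrow> a w (c *\<^sub>C x) = cnj c * a w x"
    and bdd: "\<And>w x. w \<in> car \<Longrightarrow> x \<in> car \<Longrightarrow> cmod (a w x) \<le> C * nrm w * nrm x"
    and coercive: "\<And>w. w \<in> car \<Longrightarrow> Re (a w w) \<ge> \<alpha> * (nrm w)\<^sup>2" and \<alpha>: "\<alpha> > 0"
    and ladd: "\<And>x y. x \<in> car \<Longrightarrow> y \<in> car \<Longrightarrow> l (x + y) = l x + l y"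
    and lscale: "\<And>c x. x \<in> car \<Longrightarrow> l (c *\<^sub>C x) = cnj c * l x"
    and lbdd: "\<And>x. x \<in> car \<Longrightarrow> cmod (l x) \<le> K * nrm x"
  shows "\<exists>w\<in>car. \<forall>x\<in>car. a w x = l x"
proof -
  have "\<forall>w\<in>car. \<exists>t\<in>car. \<forall>x\<in>car. a w x = ip t x"
    by (intro ballI riesz_representation) (auto simp: add2 scale2 intro: bdd)
  then obtain T where T: "\<And>w. w \<in> car \<Longrightarrow> T w \<in> car"
      "\<And>w x. w \<in> car \<Longrightarrow> x \<in> car \<Longrightarrow> a w x = ip (T w) x"
    by metis
  obtain r where r: "r \<in> car" "\<And>x. x \<in> car \<Longrightarrow> l x = ip r x"
    using riesz_representation[of l K, OF ladd lscale lbdd] by blast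
  have ext: "x = y" if "x \<in> car" "y \<in> car" "\<And>z. z \<in> car \<Longrightarrow> ip x z = ip y z" for x y
    using that ip_eq0[of "x - y"] that(3)[of "x - y"] by (simp add: ip_diff_left)
  have Tdiff: "T (w - v) = T w - T v" if "w \<in> car" "v \<in> car" for w v
    using that T by (intro ext) (auto simp: ip_diff_left add1 simp flip: T(2))
  \<comment> \<open>Enlarging the bound to at least \<alpha> makes it positive and keeps the
    radicand of \<open>\<kappa>\<close> nonnegative.\<close>
  define C' where "C' = \<bar>C\<bar> + \<alpha>"
  have C': "C' > 0" "\<alpha> \<le> C'" "C \<le> C'" using \<alpha> by (auto simp: C'_def)
  have Tbdd: "nrm (T w) \<le> C' * nrm w" if w: "w \<in> car" for w
  proof (cases "nrm (T w) = 0")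
    case False
    then have pos: "nrm (T w) > 0" using nrm_ge0[OF T(1)[OF w]] by linarith
    have "(nrm (T w))\<^sup>2 = cmod (a w (T w))"
      using w T by (simp add: ip_self norm_power)
    also have "\<dots> \<le> C * nrm w * nrm (T w)"
      using bdd w T by blast
    finally have "nrm (T w) \<le> C * nrm w"
      using pos by (simp add: power2_eq_square)
    also have "\<dots> \<le> C' * nrm w"
      using C' w by (intro mult_right_mono) auto
    finally show ?thesis .
  qed (use C' w in auto)
  \<comment> \<open>This damping minimises
    \<open>1 - 2 * \<rho> * \<alpha> + \<rho>\<^sup>2 * C'\<^sup>2\<close>; the minimum is
    \<open>\<kappa>\<^sup>2\<close>.\<close>
  define \<rho> where "\<rho> = \<alpha> / C'\<^sup>2"
  define \<kappa> where "\<kappa> = sqrt (1 - \<alpha>\<^sup>2 / C'\<^sup>2)"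
  define F where "F w = w - complex_of_real \<rho> *\<^sub>C (T w - r)" for w
  have q: "0 < \<alpha>\<^sup>2 / C'\<^sup>2" "\<alpha>\<^sup>2 / C'\<^sup>2 \<le> 1"
    using \<alpha> C' by (auto intro!: power_mono)
  have \<rho>: "\<rho> > 0" using \<alpha> C' by (simp add: \<rho>_def)
  have "\<exists>w\<in>car. F w = w"
  proof (rule banach_fixpoint[of _ \<kappa>])
    show "nrm (F x - F y) \<le> \<kappa> * nrm (x - y)" if xy: "x \<in> car" "y \<in> car" for x y
    proof (rule power2_le_imp_le)
      define d where "d = x - y"
      have d: "d \<in> car" using xy by (simp add: d_def)
      have "F x - F y = d - complex_of_real \<rho> *\<^sub>C T d"
        using xy T by (simp add: F_def d_def Tdiff cvec.scale_right_diff_distrib)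
      then have "(nrm (F x - F y))\<^sup>2 = (nrm d)\<^sup>2 - 2 * \<rho> * Re (a d d) + \<rho>\<^sup>2 * (nrm (T d))\<^sup>2"
        using d T by (simp add: nrm_diff_sq nrm_scale ip_simps power_mult_distrib Re_ip_commute[of d])
      also have "\<dots> \<le> (nrm d)\<^sup>2 - 2 * \<rho> * (\<alpha> * (nrm d)\<^sup>2) + \<rho>\<^sup>2 * (C' * nrm d)\<^sup>2"
        using \<rho> d T coercive[OF d] Tbdd[OF d]
        by (intro add_mono diff_mono mult_left_mono power_mono) auto
      also have "\<dots> = (1 - 2 * \<rho> * \<alpha> + \<rho>\<^sup>2 * C'\<^sup>2) * (nrm d)\<^sup>2"
        by (simp add: algebra_simps power_mult_distrib)
      also have "1 - 2 * \<rho> * \<alpha> + \<rho>\<^sup>2 * C'\<^sup>2 = 1 - \<alpha>\<^sup>2 / C'\<^sup>2"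
        using C' by (simp add: \<rho>_def field_simps power2_eq_square)
      also have "\<dots> = \<kappa>\<^sup>2"
        using q by (simp add: \<kappa>_def)
      finally show "(nrm (F x - F y))\<^sup>2 \<le> (\<kappa> * nrm (x - y))\<^sup>2"
        by (simp add: d_def power_mult_distrib)
    qed (use q xy in \<open>simp add: \<kappa>_def\<close>)
  qed (use q T r in \<open>auto simp: F_def \<kappa>_def\<close>)
  then obtain w where w: "w \<in> car" "F w = w" by blast
  then have "complex_of_real \<rho> *\<^sub>C (T w - r) = 0"
    by (simp add: F_def)
  then have "T w = r"
    using \<rho> by simp
  then show ?thesis
    using w T(2) r(2) by metis
qed

text \<open>Sokal's gliding-hump argument, which needs no Baire category.\<close>

lemma uniform_boundedness:
  assumes F: "F \<subseteq> car" and pw: "\<And>g. g \<in> car \<Longrightarrow> \<exists>K. \<forall>f\<in>F. cmod (ip f g) \<le> K"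
  shows "\<exists>C. \<forall>f\<in>F. nrm f \<le> C"
proof (rule ccontr)
  assume "\<nexists>C. \<forall>f\<in>F. nrm f \<le> C"
  then have "\<forall>n. \<exists>f\<in>F. nrm f > 4 ^ n"
    by (meson not_le)
  then obtain f where f: "\<And>n. f n \<in> F" "\<And>n. nrm (f n) > 4 ^ n"
    by metis
  have fc: "f n \<in> car" for n using f F by blast
  \<comment> \<open>The values at \<open>g + \<xi>\<close> and \<open>g - \<xi>\<close> differ by
    twice the value at \<open>\<xi>\<close>, so one of them is large whatever \<open>g\<close>
    is.\<close>
  have hump: "\<exists>h\<in>car. nrm (h - g) \<le> (1/3) ^ n \<and> cmod (ip (f n) h) \<ge> (1/3) ^ n * nrm (f n)"
    if g: "g \<in> car" for g n
  proof -
    have pos: "nrm (f n) > 0" using f(2)[of n] by (smt (verit) zero_less_power)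
    define \<xi> where "\<xi> = complex_of_real ((1/3) ^ n / nrm (f n)) *\<^sub>C f n"
    have x: "\<xi> \<in> car" using fc by (simp add: \<xi>_def)
    have nx: "nrm \<xi> = (1/3) ^ n"
      unfolding \<xi>_def nrm_scale[OF fc] norm_of_real using pos by simp
    have ipx: "cmod (ip (f n) \<xi>) = (1/3) ^ n * nrm (f n)"
      unfolding \<xi>_def ip_scale_right[OF fc fc] ip_self[OF fc] using pos
      by (simp add: norm_mult norm_divide norm_power power2_eq_square del: of_real_divide)
    have "2 * ip (f n) \<xi> = ip (f n) (g + \<xi>) - ip (f n) (g - \<xi>)"
      using x g fc by (simp add: ip_simps)
    then have "2 * cmod (ip (f n) \<xi>) \<le> cmod (ip (f n) (g + \<xi>)) + cmod (ip (f n) (g - \<xi>))"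
      by (metis norm_mult norm_numeral norm_triangle_ineq4)
    then have "cmod (ip (f n) (g + \<xi>)) \<ge> (1/3) ^ n * nrm (f n) \<or> cmod (ip (f n) (g - \<xi>)) \<ge> (1/3) ^ n * nrm (f n)"
      using ipx by linarith
    then show ?thesis
    proof
      assume "cmod (ip (f n) (g + \<xi>)) \<ge> (1/3) ^ n * nrm (f n)"
      then show ?thesis
        using g x nx by (intro bexI[of _ "g + \<xi>"]) auto
    next
      assume "cmod (ip (f n) (g - \<xi>)) \<ge> (1/3) ^ n * nrm (f n)"
      then show ?thesis
        using g x nx nrm_minus[OF x] by (intro bexI[of _ "g - \<xi>"]) auto
    qed
  qed
  define pick where "pick n g = (SOME h. h \<in> car \<and> nrm (h - g) \<le> (1/3) ^ n \<and>
      cmod (ip (f n) h) \<ge> (1/3) ^ n * nrm (f n))" for n g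
  have pick: "pick n g \<in> car" "nrm (pick n g - g) \<le> (1/3) ^ n"
      "cmod (ip (f n) (pick n g)) \<ge> (1/3) ^ n * nrm (f n)" if "g \<in> car" for n g
    using someI_ex[of "\<lambda>h. h \<in> car \<and> nrm (h - g) \<le> (1/3) ^ n \<and>
      cmod (ip (f n) h) \<ge> (1/3) ^ n * nrm (f n)"] hump[OF that, of n]
    unfolding pick_def by blast+
  define X where "X = rec_nat 0 pick"
  have XS: "X (Suc n) = pick n (X n)" and X0: "X 0 = 0" for n
    by (simp_all add: X_def)
  have Xc: "X n \<in> car" for n
    by (induction n) (simp_all add: XS X0 pick)
  obtain g where g: "g \<in> car" "\<And>n. nrm (g - X n) \<le> 1 * (1/3) ^ n / (1 - 1/3)"
    using geometric_limit[of X "1/3" 1] Xc pick(2)[OF Xc] XS by auto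
  \<comment> \<open>All corrections after stage \<open>n\<close> add up to at most (1/3)^(n+1) / (1
    - 1/3) = (1/2) (1/3)^n, so half of the value gained at stage \<open>n\<close> survives in the
    limit; norms above 4^n outgrow this factor.\<close>
  have big: "cmod (ip (f n) g) \<ge> (1/2) * (4/3) ^ n" for n
  proof -
    have "ip (f n) (X (Suc n)) = ip (f n) g - ip (f n) (g - X (Suc n))"
      using fc g Xc by (simp add: ip_simps)
    then have "cmod (ip (f n) (X (Suc n))) \<le> cmod (ip (f n) g) + cmod (ip (f n) (g - X (Suc n)))"
      by (metis norm_triangle_ineq4)
    also have "cmod (ip (f n) (g - X (Suc n))) \<le> nrm (f n) * nrm (g - X (Suc n))"
      using cauchy_schwarz fc g(1) Xc by simp
    also have "\<dots> \<le> nrm (f n) * ((1/2) * (1/3) ^ n)"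
      using g(2)[of "Suc n"] fc by (intro mult_left_mono) auto
    finally have "(1/2) * (1/3) ^ n * nrm (f n) \<le> cmod (ip (f n) g)"
      using pick(3)[OF Xc, of n n] by (simp add: XS algebra_simps)
    moreover have "(1/2) * (1/3) ^ n * 4 ^ n \<le> (1/2) * (1/3) ^ n * nrm (f n)"
      using f(2)[of n] by (intro mult_left_mono) auto
    ultimately show ?thesis
      by (simp add: power_divide)
  qed
  obtain K where K: "\<And>n. cmod (ip (f n) g) \<le> K"
    using pw[OF g(1)] f(1) by blast
  obtain n where "2 * K < (4/3 :: real) ^ n"
    using real_arch_pow[of "4/3" "2 * K"] by auto
  then show False
    using big[of n] K[of n] by linarith
qed

end

section \<open>Maximal dissipative operators generate contraction semigroups\<close>

abbreviation rscale :: "real \<Rightarrow> 'a::cvec \<Rightarrow> 'a" (infixr "*\<^sub>r" 75) where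
  "r *\<^sub>r x \<equiv> complex_of_real r *\<^sub>C x"

section \<open>Closed subspaces and a density criterion\<close>

lemma hil_closed_subspace:
  assumes "hil H" "csubspace C" "C \<subseteq> hs_set H"
    and closed: "\<And>X x. (\<And>n. X n \<in> C) \<Longrightarrow> x \<in> hs_set H \<Longrightarrow> hconv H X x \<Longrightarrow> x \<in> C"
  shows "hil (C, hs_ip H)"
proof -
  interpret H: hil H by fact
  have e [simp]: "hs_set (C, hs_ip H) = C" "hs_ip (C, hs_ip H) = hs_ip H" "hnorm (C, hs_ip H) = hnorm H"
    by (auto simp: hs_set_def hs_ip_def hnorm_def)
  have [simp]: "hconv (C, hs_ip H) X x \<longleftrightarrow> hconv H X x" "hcauchy (C, hs_ip H) X \<longleftrightarrow> hcauchy H X" for X x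
    by (auto simp: hconv_def hcauchy_def)
  have C: "x \<in> hs_set H" if "x \<in> C" for x using that assms by blast
  show ?thesis
  proof
    show "inner_on (C, hs_ip H)"
      using H.inner_on assms(2) C unfolding inner_on_def e by blast
    show "\<exists>x\<in>hs_set (C, hs_ip H). hconv (C, hs_ip H) X x"
      if "\<And>n. X n \<in> hs_set (C, hs_ip H)" "hcauchy (C, hs_ip H) X" for X
      using H.complete[of X] that closed C by auto
  qed
qed

text \<open>Riesz representation in the closure \<open>C\<close> does the work of an orthogonal
  projection: the functional \<open>ip x\<close> on \<open>C\<close> is represented by some
  \<open>h\<close> in \<open>C\<close>, and \<open>x - h\<close> is orthogonal to \<open>D\<close>,
  hence zero.\<close>

lemma (in hil) dense_in_if_orthogonal_trivial:
  assumes "csubspace D" "D \<subseteq> car"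
    and triv: "\<And>y. y \<in> car \<Longrightarrow> (\<And>x. x \<in> D \<Longrightarrow> ip y x = 0) \<Longrightarrow> y = 0"
  shows "dense_in H D"
proof -
  define C where "C = {x\<in>car. \<forall>e>0. \<exists>d\<in>D. nrm (x - d) < e}"
  have D: "x \<in> car" if "x \<in> D" for x using that assms(2) by blast
  have DC: "D \<subseteq> C"
    by (auto simp: C_def D intro!: bexI)
  have approx: "\<exists>d\<in>D. nrm (x - d) < e" if "x \<in> C" "e > 0" for x e
    using that by (simp add: C_def)
  have sub: "csubspace C"
    unfolding csubspace_def
  proof (intro conjI ballI allI)
    show "0 \<in> C" using DC czero_mem[OF assms(1)] by blast
  next
    fix x y assume xy: "x \<in> C" "y \<in> C"
    show "x + y \<in> C"
      unfolding C_def
    proof (intro CollectI conjI allI impI)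
      fix e :: real assume "e > 0"
      then obtain d d' where d: "d \<in> D" "nrm (x - d) < e / 2" "d' \<in> D" "nrm (y - d') < e / 2"
        using approx[OF xy(1), of "e / 2"] approx[OF xy(2), of "e / 2"] by auto
      have "nrm ((x + y) - (d + d')) \<le> nrm (x - d) + nrm (y - d')"
        using nrm_triangle[of "x - d" "y - d'"] xy d D by (simp add: C_def add_diff_add)
      then show "\<exists>d\<in>D. nrm (x + y - d) < e"
        using d cadd_mem[OF assms(1)] by (intro bexI[of _ "d + d'"]) auto
    qed (use xy in \<open>simp add: C_def\<close>)
  next
    fix c x assume x: "x \<in> C"
    show "c *\<^sub>C x \<in> C"
      unfolding C_def
    proof (intro CollectI conjI allI impI)
      fix e :: real assume e: "e > 0"
      have "e / (cmod c + 1) > 0"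
        using e by (intro divide_pos_pos add_nonneg_pos) auto
      then obtain d where d: "d \<in> D" "nrm (x - d) < e / (cmod c + 1)"
        using approx[OF x] by blast
      have xd: "x - d \<in> car" using x d D by (simp add: C_def)
      have "nrm (c *\<^sub>C x - c *\<^sub>C d) = cmod c * nrm (x - d)"
        using xd by (simp add: nrm_scale flip: cvec.scale_right_diff_distrib)
      also have "\<dots> \<le> (cmod c + 1) * nrm (x - d)"
        using xd by (intro mult_right_mono) auto
      also have "\<dots> < e"
        using d(2) by (simp add: pos_less_divide_eq add_nonneg_pos mult.commute)
      finally show "\<exists>d\<in>D. nrm (c *\<^sub>C x - d) < e"
        using d cscale_mem[OF assms(1)] by (intro bexI[of _ "c *\<^sub>C d"]) auto
    qed (use x in \<open>simp add: C_def\<close>)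
  qed
  have closed: "x \<in> C" if X: "\<And>n. X n \<in> C" "x \<in> car" "hconv H X x" for X x
    unfolding C_def
  proof (intro CollectI conjI allI impI)
    fix e :: real assume "e > 0"
    then obtain n where n: "nrm (X n - x) < e / 2"
      using order_tendstoD(2)[of "\<lambda>n. nrm (X n - x)" 0 sequentially "e / 2"] X(3)
      by (auto simp: hconv_def eventually_sequentially)
    obtain d where d: "d \<in> D" "nrm (X n - d) < e / 2"
      using approx[OF X(1), of "e / 2" n] \<open>e > 0\<close> by auto
    have "X n \<in> car" using X(1) by (simp add: C_def)
    then show "\<exists>d\<in>D. nrm (x - d) < e"
      using nrm_dist_triangle[of x "X n" d] nrm_minus_commute[of x "X n"] X(2) D d n
      by (intro bexI[of _ d]) auto
  qed (use X in auto)
  have Cc: "x \<in> car" if "x \<in> C" for x using that by (simp add: C_def)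
  interpret C: hil "(C, ip)"
    by (rule hil_closed_subspace[OF hil_axioms sub]) (auto intro: Cc closed)
  have [simp]: "hs_set (C, ip) = C" "hs_ip (C, ip) = ip" "hnorm (C, ip) = nrm"
    by (auto simp: hs_set_def hs_ip_def hnorm_def)
  have "x \<in> C" if x: "x \<in> car" for x
  proof -
    have "\<exists>h\<in>hs_set (C, ip). \<forall>y\<in>hs_set (C, ip). ip x y = hs_ip (C, ip) h y"
    proof (rule C.riesz_representation)
      show "cmod (ip x y) \<le> nrm x * hnorm (C, ip) y" if "y \<in> hs_set (C, ip)" for y
        using that Cc x cauchy_schwarz by simp
    qed (use x Cc in \<open>auto simp: ip_simps\<close>)
    then obtain h where h: "h \<in> C" "\<And>y. y \<in> C \<Longrightarrow> ip x y = ip h y"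
      by auto
    have "x - h = 0"
    proof (rule triv)
      show "ip (x - h) y = 0" if "y \<in> D" for y
        using that DC h x Cc[of y] Cc[OF h(1)] by (auto simp: ip_diff_left)
    qed (use x h Cc in auto)
    then show ?thesis using h by simp
  qed
  then show ?thesis
    unfolding dense_in_def using assms(2) by (auto simp: C_def)
qed

text \<open>The range condition is assumed for every \<open>l > 0\<close>, the form in which the
  boundary value problem delivers it, so that an implicit Euler step exists for every step size.
  Density of \<open>D\<close> is a consequence.\<close>

locale maximal_dissipative = hil V for V :: "'v::cvec hs" +
  fixes D :: "'v set" and T :: "'v \<Rightarrow> 'v"
  assumes D_sub: "D \<subseteq> hs_set V" and T_lin: "clinear_on D T"
    and T_mem: "\<And>x. x \<in> D \<Longrightarrow> T x \<in> hs_set V"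
    and diss: "\<And>x. x \<in> D \<Longrightarrow> Re (hs_ip V (T x) x) \<le> 0"
    and range: "\<And>l y. l > 0 \<Longrightarrow> y \<in> hs_set V \<Longrightarrow> \<exists>x\<in>D. l *\<^sub>r x - T x = y"
begin

lemma D_car [simp]: "x \<in> D \<Longrightarrow> x \<in> car"
  and T_car [simp]: "x \<in> D \<Longrightarrow> T x \<in> car"
  using D_sub T_mem by auto

lemma D_mem:
  "x \<in> D \<Longrightarrow> y \<in> D \<Longrightarrow> x + y \<in> D"
  "x \<in> D \<Longrightarrow> y \<in> D \<Longrightarrow> x - y \<in> D"
  "x \<in> D \<Longrightarrow> c *\<^sub>C x \<in> D"
  using clinear_on_subspace[OF T_lin] by (auto simp: cadd_mem cdiff_mem cscale_mem)

lemma T_simps: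
  "x \<in> D \<Longrightarrow> y \<in> D \<Longrightarrow> T (x + y) = T x + T y"
  "x \<in> D \<Longrightarrow> y \<in> D \<Longrightarrow> T (x - y) = T x - T y"
  "x \<in> D \<Longrightarrow> T (c *\<^sub>C x) = c *\<^sub>C T x"
  using T_lin by (auto simp: clinear_on_simps)

section \<open>Resolvents as implicit Euler steps\<close>

lemma nrm_le_resolvent:
  assumes x: "x \<in> D" and "h \<ge> 0"
  shows "nrm x \<le> nrm (x - h *\<^sub>r T x)"
proof (cases "nrm x = 0")
  case False
  then have pos: "nrm x > 0"
    using nrm_ge0[OF D_car[OF x]] by linarith
  have "(nrm x)\<^sup>2 \<le> (nrm x)\<^sup>2 - h * Re (ip (T x) x)"
    using diss[OF x] \<open>h \<ge> 0\<close> by (simp add: mult_nonneg_nonpos)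
  also have "\<dots> = Re (ip (x - h *\<^sub>r T x) x)"
    using x by (simp add: ip_simps nrm_sq)
  also have "\<dots> \<le> nrm (x - h *\<^sub>r T x) * nrm x"
    using x by (intro Re_ip_le) auto
  finally show ?thesis
    using pos by (simp add: power2_eq_square)
qed (use x in simp)

text \<open>For \<open>y\<close> orthogonal to \<open>D\<close>, solve \<open>x - T x = y\<close>
  and pair with \<open>x\<close>: the squared norm of \<open>x\<close> equals
  \<open>Re (ip (T x) x)\<close>, which is not positive. So \<open>x\<close>, and with it
  \<open>y\<close>, vanishes.\<close>

lemma D_dense: "dense_in V D"
proof (rule dense_in_if_orthogonal_trivial)
  fix y assume y: "y \<in> car" "\<And>x. x \<in> D \<Longrightarrow> ip y x = 0"
  obtain x where x: "x \<in> D" "1 *\<^sub>r x - T x = y"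
    using range[of 1 y] y by auto
  have "(nrm x)\<^sup>2 - Re (ip (T x) x) = Re (ip y x)"
    using x by (auto simp: ip_simps nrm_sq)
  then have "(nrm x)\<^sup>2 \<le> 0"
    using y(2)[OF x(1)] diss[OF x(1)] by simp
  then have "x = 0"
    using nrm_eq0[of x] x by simp
  then show "y = 0"
    using x(2) clinear_on_zero[OF T_lin] by simp
qed (use clinear_on_subspace[OF T_lin] in auto)

text \<open>Setting \<open>J 0 = id\<close> lets the commutation and comparison estimates below cover the case
  of step size \<open>0\<close>, which compares one step of size \<open>2 * m\<close> with two steps of size \<open>m\<close>.\<close>

definition J :: "real \<Rightarrow> 'v \<Rightarrow> 'v" where
  "J h y = (if h = 0 then y else (SOME x. x \<in> D \<and> x - h *\<^sub>r T x = y))"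

lemma resolvent_inj:
  assumes "x \<in> D" "y \<in> D" "h \<ge> 0" "x - h *\<^sub>r T x = y - h *\<^sub>r T y"
  shows "x = y"
proof -
  have "(x - y) - h *\<^sub>r T (x - y) = (x - h *\<^sub>r T x) - (y - h *\<^sub>r T y)"
    using assms(1,2) by (simp add: T_simps cvec.scale_right_diff_distrib)
  then have "nrm (x - y) \<le> 0"
    using nrm_le_resolvent[of "x - y" h] D_mem assms by simp
  then show ?thesis
    using nrm_eq0[of "x - y"] nrm_ge0[of "x - y"] assms by (simp add: order_antisym)
qed

lemma J_dom:
  assumes "h > 0" "y \<in> car"
  shows "J h y \<in> D" "J h y - h *\<^sub>r T (J h y) = y"
proof -
  obtain x where x: "x \<in> D" "(1 / h) *\<^sub>r x - T x = (1 / h) *\<^sub>r y"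
    using range[of "1 / h" "(1 / h) *\<^sub>r y"] assms by auto
  have "h *\<^sub>r ((1 / h) *\<^sub>r x - T x) = h *\<^sub>r ((1 / h) *\<^sub>r y)"
    using x(2) by simp
  then have "x - h *\<^sub>r T x = y"
    using assms(1) by (simp add: cvec.scale_right_diff_distrib flip: of_real_mult)
  then have "\<exists>x. x \<in> D \<and> x - h *\<^sub>r T x = y"
    using x(1) by blast
  from someI_ex[OF this] show "J h y \<in> D" "J h y - h *\<^sub>r T (J h y) = y"
    using assms(1) by (auto simp: J_def)
qed

lemma J_eqI:
  assumes "h \<ge> 0" "x \<in> D" "x - h *\<^sub>r T x = y"
  shows "J h y = x"
proof (cases "h = 0")
  case False
  have y: "y \<in> car" using assms by auto
  show ?thesis
    using False assms J_dom[of h y] y by (intro resolvent_inj[of _ x h]) auto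
qed (use assms in \<open>auto simp: J_def\<close>)

lemma J_0 [simp]: "J 0 x = x"
  by (simp add: J_def)

lemma J_car [simp]: "h \<ge> 0 \<Longrightarrow> y \<in> car \<Longrightarrow> J h y \<in> car"
  using J_dom[of h y] by (cases "h = 0") auto

lemma J_D:
  assumes "h \<ge> 0" "x \<in> D"
  shows "J h x \<in> D" "J h x - h *\<^sub>r T (J h x) = x"
  using J_dom[of h x] assms by (cases "h = 0"; simp)+

lemma J_nrm: "h \<ge> 0 \<Longrightarrow> y \<in> car \<Longrightarrow> nrm (J h y) \<le> nrm y"
  using J_dom[of h y] nrm_le_resolvent[of "J h y" h] by (cases "h = 0") auto

lemma J_add: "h \<ge> 0 \<Longrightarrow> x \<in> car \<Longrightarrow> y \<in> car \<Longrightarrow> J h (x + y) = J h x + J h y"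
proof (cases "h = 0")
  case False
  assume h: "h \<ge> 0" "x \<in> car" "y \<in> car"
  then have "J h x + J h y - h *\<^sub>r T (J h x + J h y) =
      (J h x - h *\<^sub>r T (J h x)) + (J h y - h *\<^sub>r T (J h y))"
    using False J_dom[of h x] J_dom[of h y] by (simp add: T_simps cvec.scale_right_distrib add_diff_add)
  then show ?thesis
    using False h J_dom[of h x] J_dom[of h y] by (intro J_eqI) (auto intro: D_mem)
qed simp

lemma J_scale: "h \<ge> 0 \<Longrightarrow> x \<in> car \<Longrightarrow> J h (c *\<^sub>C x) = c *\<^sub>C J h x"
proof (cases "h = 0")
  case False
  assume h: "h \<ge> 0" "x \<in> car"
  then have "c *\<^sub>C J h x - h *\<^sub>r T (c *\<^sub>C J h x) = c *\<^sub>C (J h x - h *\<^sub>r T (J h x))"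
    using False J_dom(1)[of h x] by (simp add: T_simps cvec.scale_right_diff_distrib mult.commute)
  then show ?thesis
    using False h J_dom[of h x] by (intro J_eqI) (auto intro: D_mem)
qed simp

lemma J_diff: "h \<ge> 0 \<Longrightarrow> x \<in> car \<Longrightarrow> y \<in> car \<Longrightarrow> J h (x - y) = J h x - J h y"
  using J_add[of h x "-y"] J_scale[of h y "-1"] by simp

text \<open>The equation \<open>u - h *\<^sub>r T u = x\<close> with \<open>x\<close> in
  \<open>D\<close> forces \<open>T u\<close> into \<open>D\<close> when \<open>h > 0\<close>, so
  \<open>T\<close> may be applied to it.\<close>

lemma J_T:
  assumes "h \<ge> 0" "x \<in> D"
  shows "T (J h x) = J h (T x)"
proof (cases "h = 0")
  case False
  then have h: "h > 0" using assms by simp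
  define u where "u = J h x"
  have u: "u \<in> D" "u - h *\<^sub>r T u = x" using J_D assms by (simp_all add: u_def)
  then have "T u = (1 / h) *\<^sub>r (u - x)"
    using h by (auto simp flip: of_real_mult)
  then have Tu: "T u \<in> D" using D_mem u assms by simp
  have "T u - h *\<^sub>r T (T u) = T (u - h *\<^sub>r T u)"
    using u(1) Tu by (simp add: T_simps D_mem)
  then have "J h (T x) = T u"
    using u Tu assms by (intro J_eqI) auto
  then show ?thesis by (simp add: u_def)
qed simp

text \<open>The same gain of regularity: for positive steps \<open>y = J h (J k x)\<close> lies in
  the domain of the square of \<open>T\<close>, where the factors \<open>1 - h T\<close> and
  \<open>1 - k T\<close> commute.\<close>

lemma J_commute:
  assumes "h \<ge> 0" "k \<ge> 0" "x \<in> car"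
  shows "J h (J k x) = J k (J h x)"
proof (cases "h = 0 \<or> k = 0")
  case False
  then have hk: "h > 0" "k > 0" using assms by auto
  define y where "y = J h (J k x)"
  have y: "y \<in> D" "y - h *\<^sub>r T y = J k x"
    using J_dom[of h "J k x"] hk assms by (auto simp: y_def)
  have Jk: "J k x \<in> D" "J k x - k *\<^sub>r T (J k x) = x"
    using J_dom[of k x] hk assms by auto
  have "T y = (1 / h) *\<^sub>r (y - J k x)"
    using hk by (simp add: y(2)[symmetric] flip: of_real_mult)
  then have Ty: "T y \<in> D" using D_mem y Jk by simp
  have "(y - k *\<^sub>r T y) - h *\<^sub>r T (y - k *\<^sub>r T y) = (y - h *\<^sub>r T y) - k *\<^sub>r T (y - h *\<^sub>r T y)"
    using y(1) Ty by (simp add: T_simps D_mem cvec.scale_right_diff_distrib algebra_simps)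
  also have "\<dots> = x"
    using y Jk by simp
  finally have "J h x = y - k *\<^sub>r T y"
    using y(1) Ty assms by (intro J_eqI) (auto intro: D_mem)
  then have "J k (J h x) = y"
    using y(1) assms by (intro J_eqI) auto
  then show ?thesis by (simp add: y_def)
qed auto

definition D2 :: "'v set" where "D2 = {x \<in> D. T x \<in> D}"

lemma D2I: "x \<in> D \<Longrightarrow> T x \<in> D \<Longrightarrow> x \<in> D2"
  by (simp add: D2_def)

lemma D2_D [simp]: "x \<in> D2 \<Longrightarrow> x \<in> D" "x \<in> D2 \<Longrightarrow> T x \<in> D"
  by (auto simp: D2_def)

lemma J_D2: "h \<ge> 0 \<Longrightarrow> x \<in> D2 \<Longrightarrow> J h x \<in> D2"
  by (rule D2I) (simp_all add: J_D(1) J_T)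

lemma J_near: "h \<ge> 0 \<Longrightarrow> x \<in> D \<Longrightarrow> nrm (J h x - x) \<le> h * nrm (T x)"
proof -
  assume h: "h \<ge> 0" "x \<in> D"
  have "J h x - x = h *\<^sub>r J h (T x)"
    using J_D[OF h] J_T[OF h] by (metis diff_add_cancel add_diff_cancel_left')
  then show ?thesis
    using h J_nrm[of h "T x"] by (simp add: nrm_scale mult_left_mono)
qed

text \<open>\<open>J h\<close> with \<open>h > 0\<close> maps \<open>D\<close> into
  \<open>D2\<close> and moves \<open>y\<close> by at most \<open>h * nrm (T y)\<close>, so a small
  step regularises at little cost.\<close>

lemma D2_dense:
  assumes "x \<in> car" "e > 0"
  shows "\<exists>y\<in>D2. nrm (x - y) < e"
proof -
  obtain y where y: "y \<in> D" "nrm (x - y) < e / 2"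
    using D_dense assms unfolding dense_in_def by (meson half_gt_zero)
  \<comment> \<open>A strictly positive bound, as \<open>T y\<close> may be zero and
    \<open>N\<close> becomes a denominator.\<close>
  obtain N where N: "N > 0" "nrm (T y) \<le> N"
    using nrm_ge0[OF T_car[OF y(1)]] less_add_one[of "nrm (T y)"]
    by (metis less_imp_le order_le_less_trans)
  define h where "h = e / 2 / N"
  have h: "h > 0" using assms N by (simp add: h_def)
  have "h * nrm (T y) \<le> h * N"
    using h N by simp
  also have "\<dots> = e / 2"
    using N by (simp add: h_def)
  finally have "nrm (x - J h y) < e"
    using nrm_dist_triangle[of x y "J h y"] J_near[of h y] nrm_minus_commute[of y "J h y"] y h assms
    by simp
  moreover have "J h y \<in> D2"
    using y h J_dom by (intro D2I) (simp_all add: J_T)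
  ultimately show ?thesis by blast
qed

text \<open>With \<open>m = (h + k) / 2\<close> the difference is
  \<open>(m\<^sup>2 - h * k) *\<^sub>r J h (J k (J m (J m (T (T x)))))\<close>.\<close>

lemma J_compare:
  assumes hk: "h \<ge> 0" "k \<ge> 0" and x: "x \<in> D2" and m: "m = (h + k) / 2"
  shows "nrm (J h (J k x) - J m (J m x)) \<le> ((h - k) / 2)\<^sup>2 * nrm (T (T x))"
proof -
  have m0: "m \<ge> 0" using hk m by simp
  define u where "u = J m x"
  define y where "y = J m u"
  have u: "u \<in> D2" "u - m *\<^sub>r T u = x"
    using J_D2 J_D m0 x by (auto simp: u_def)
  have y: "y \<in> D2" "y - m *\<^sub>r T y = u"
    using J_D2 J_D m0 u by (auto simp: y_def)
  have TTy: "T (T y) = J m (J m (T (T x)))"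
    using x m0 by (simp add: y_def u_def J_T J_D(1))
  \<comment> \<open>Because \<open>h + k = m + m\<close>, the products
    \<open>(1 - h T) (1 - k T)\<close> and \<open>(1 - m T) (1 - m T)\<close> differ only in the
    quadratic term, by \<open>q\<close>.\<close>
  define q where "q = ((h - k) / 2)\<^sup>2"
  have mm: "h * k = m * m - q" and mm': "h + k = m + m"
    by (simp_all add: m q_def power2_eq_square field_simps)
  have "(y - k *\<^sub>r T y) - h *\<^sub>r T (y - k *\<^sub>r T y) = y - (h + k) *\<^sub>r T y + (h * k) *\<^sub>r T (T y)"
    using y(1) by (simp add: T_simps D_mem cvec.scale_right_diff_distrib cvec.scale_left_distrib algebra_simps)
  also have "\<dots> = (y - m *\<^sub>r T y) - m *\<^sub>r T (y - m *\<^sub>r T y) - q *\<^sub>r T (T y)"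
    using y(1) unfolding mm mm' of_real_add of_real_diff of_real_mult
      cvec.scale_left_distrib cvec.scale_left_diff_distrib
    by (simp add: T_simps D_mem cvec.scale_right_diff_distrib algebra_simps)
  also have "\<dots> = x - q *\<^sub>r T (T y)"
    using y u by simp
  finally have "J h (x - q *\<^sub>r T (T y)) = y - k *\<^sub>r T y"
    using y(1) hk by (intro J_eqI) (simp_all add: D_mem)
  then have "J k (J h (x - q *\<^sub>r T (T y))) = y"
    using y hk by (intro J_eqI) auto
  then have "J h (J k x) - y = q *\<^sub>r J k (J h (T (T y)))"
    using x y hk by (simp add: J_diff J_scale J_commute[of h k] algebra_simps)
  then have "nrm (J h (J k x) - y) = q * nrm (J k (J h (T (T y))))"
    using y hk by (simp add: nrm_scale q_def del: of_real_power of_real_divide)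
  also have "nrm (J k (J h (T (T y)))) \<le> nrm (T (T y))"
    using y hk by (meson J_car J_nrm T_car D2_D order_trans)
  also have "\<dots> \<le> nrm (T (T x))"
    unfolding TTy using x m0 by (meson J_car J_nrm T_car D2_D order_trans)
  finally show ?thesis
    by (simp add: y_def u_def q_def mult_left_mono)
qed

section \<open>Powers of commuting nonexpansive maps\<close>

definition nonexp :: "('v \<Rightarrow> 'v) \<Rightarrow> bool" where
  "nonexp E \<longleftrightarrow> (\<forall>x\<in>car. E x \<in> car \<and> nrm (E x) \<le> nrm x) \<and>
     (\<forall>x\<in>car. \<forall>y\<in>car. E (x - y) = E x - E y)"

lemma nonexpD:
  assumes "nonexp E" "x \<in> car"
  shows "E x \<in> car" "nrm (E x) \<le> nrm x" "y \<in> car \<Longrightarrow> E (x - y) = E x - E y"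
  using assms by (auto simp: nonexp_def)

lemma nonexp_J: "h \<ge> 0 \<Longrightarrow> nonexp (J h)"
  by (simp add: nonexp_def J_nrm J_diff)

lemma nonexp_comp: "nonexp E \<Longrightarrow> nonexp F \<Longrightarrow> nonexp (E \<circ> F)"
  unfolding nonexp_def by (auto, meson order_trans)

lemma nonexp_funpow: "nonexp E \<Longrightarrow> nonexp (E ^^ n)"
  by (induction n) (auto intro: nonexp_comp, simp add: nonexp_def)

lemma funpow_commute_on:
  assumes "nonexp E" "\<And>x. x \<in> car \<Longrightarrow> E (F x) = F (E x)" "x \<in> car"
  shows "(E ^^ n) (F x) = F ((E ^^ n) x)"
  using assms(3) by (induction n) (auto simp: assms(2) nonexpD[OF nonexp_funpow[OF assms(1)]])

text \<open>Telescoping. Commutation moves every defect back to the starting point, so that only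
  \<open>E x - F x\<close> has to be estimated and not the difference along an orbit.\<close>

lemma funpow_diff_le:
  assumes E: "nonexp E" and F: "nonexp F" and com: "\<And>x. x \<in> car \<Longrightarrow> E (F x) = F (E x)"
    and x: "x \<in> car"
  shows "nrm ((E ^^ n) x - (F ^^ n) x) \<le> real n * nrm (E x - F x)"
proof (induction n)
  case (Suc n)
  note En = nonexpD[OF nonexp_funpow[OF E, of n]] and Fn = nonexpD[OF nonexp_funpow[OF F, of n]]
  note m = nonexpD(1)[OF E] nonexpD(1)[OF F] En(1) Fn(1)
  have "(E ^^ Suc n) x - (F ^^ Suc n) x = (E ^^ n) (E x - F x) + F ((E ^^ n) x - (F ^^ n) x)"
    using x m by (simp add: En(3) nonexpD(3)[OF F] funpow_commute_on[where E = E and F = F, OF E com] funpow_swap1)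
  then have "nrm ((E ^^ Suc n) x - (F ^^ Suc n) x) \<le>
      nrm ((E ^^ n) (E x - F x)) + nrm (F ((E ^^ n) x - (F ^^ n) x))"
    using x m nrm_triangle by simp
  also have "\<dots> \<le> nrm (E x - F x) + nrm ((E ^^ n) x - (F ^^ n) x)"
    using x m by (intro add_mono En(2) nonexpD(2)[OF F]) auto
  finally show ?case
    using Suc by (simp add: algebra_simps)
qed simp

lemma funpow_J_comp:
  assumes "h \<ge> 0" "k \<ge> 0" "x \<in> car"
  shows "((J h \<circ> J k) ^^ n) x = (J h ^^ n) ((J k ^^ n) x)"
proof (induction n)
  case (Suc n)
  have m: "(J k ^^ n) x \<in> car" "(J h ^^ n) ((J k ^^ n) x) \<in> car"
    using assms nonexpD(1)[OF nonexp_funpow[OF nonexp_J]] by auto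
  show ?case
    using Suc m assms funpow_commute_on[of "J h" "J k" "(J k ^^ n) x" n] nonexp_J J_commute
    by simp
qed simp

text \<open>The \<open>n\<close> local errors just add up, since every step is nonexpansive. Two
  instances carry the construction: \<open>k = 0\<close> compares a step size with its half, and
  unequal \<open>h\<close> and \<open>k\<close> give the semigroup law.\<close>

lemma funpow_J_compare:
  assumes hk: "h \<ge> 0" "k \<ge> 0" and x: "x \<in> D2"
  shows "nrm ((J h ^^ n) ((J k ^^ n) x) - (J ((h + k) / 2) ^^ (2 * n)) x)
    \<le> real n * (((h - k) / 2)\<^sup>2 * nrm (T (T x)))"
proof -
  define m where "m = (h + k) / 2"
  have m: "m \<ge> 0" using hk by (simp add: m_def)
  have "J m ^^ (2 * n) = (J m \<circ> J m) ^^ n"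
    unfolding funpow_mult[symmetric] by (simp add: numeral_2_eq_2 fun_eq_iff comp_def)
  then have "nrm ((J h ^^ n) ((J k ^^ n) x) - (J m ^^ (2 * n)) x)
      = nrm (((J h \<circ> J k) ^^ n) x - ((J m \<circ> J m) ^^ n) x)"
    using x hk by (simp add: funpow_J_comp)
  also have "\<dots> \<le> real n * nrm ((J h \<circ> J k) x - (J m \<circ> J m) x)"
  proof (rule funpow_diff_le)
    show "(J h \<circ> J k) ((J m \<circ> J m) y) = (J m \<circ> J m) ((J h \<circ> J k) y)" if "y \<in> car" for y
      using that hk m by (simp add: J_commute[of h m] J_commute[of k m])
  qed (use hk m x in \<open>auto intro: nonexp_comp nonexp_J\<close>)
  also have "\<dots> \<le> real n * (((h - k) / 2)\<^sup>2 * nrm (T (T x)))"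
    using J_compare[OF hk x, of m] by (intro mult_left_mono) (auto simp: m_def)
  finally show ?thesis by (simp add: m_def)
qed

section \<open>The Euler scheme and its limit\<close>

definition Q :: "nat \<Rightarrow> real \<Rightarrow> 'v \<Rightarrow> 'v" where
  "Q k t = J (t / 2 ^ k) ^^ (2 ^ k)"

lemma nonexp_Q: "t \<ge> 0 \<Longrightarrow> nonexp (Q k t)"
  by (simp add: Q_def nonexp_funpow nonexp_J)

lemma Q_car [simp]: "t \<ge> 0 \<Longrightarrow> x \<in> car \<Longrightarrow> Q k t x \<in> car"
  using nonexpD(1) nonexp_Q by blast

lemma Q_diff: "t \<ge> 0 \<Longrightarrow> x \<in> car \<Longrightarrow> y \<in> car \<Longrightarrow> Q k t (x - y) = Q k t x - Q k t y"
  using nonexpD(3) nonexp_Q by blast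

lemma Q_nrm: "t \<ge> 0 \<Longrightarrow> x \<in> car \<Longrightarrow> nrm (Q k t x) \<le> nrm x"
  using nonexpD(2) nonexp_Q by blast

lemma Q_scale:
  assumes "t \<ge> 0" "x \<in> car"
  shows "Q k t (c *\<^sub>C x) = c *\<^sub>C Q k t x"
proof -
  have "(J h ^^ n) (c *\<^sub>C x) = c *\<^sub>C (J h ^^ n) x" if "h \<ge> 0" for h n
    using that assms(2) nonexpD(1)[OF nonexp_funpow[OF nonexp_J[OF that]]]
    by (induction n) (auto simp: J_scale)
  then show ?thesis using assms by (simp add: Q_def)
qed

text \<open>Each of the 2^k local errors is at most t^2 / 4^(k+1) times
  \<open>nrm (T (T x))\<close>, so their sum is of order 2^-k, which is summable in
  \<open>k\<close>.\<close>

lemma Q_step: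
  assumes t: "t \<ge> 0" and x: "x \<in> D2"
  shows "nrm (Q (Suc k) t x - Q k t x) \<le> t\<^sup>2 * nrm (T (T x)) * (1 / 2) ^ k"
proof -
  define s where "s = t / 2 ^ k"
  have s: "s \<ge> 0" using t by (simp add: s_def)
  have "(J 0 ^^ n) y = y" for n y
    by (induction n) auto
  then have "nrm (Q k t x - Q (Suc k) t x) \<le> real (2 ^ k) * (((s - 0) / 2)\<^sup>2 * nrm (T (T x)))"
    using funpow_J_compare[OF s order_refl x, of "2 ^ k"] by (simp add: Q_def s_def mult.commute)
  also have "\<dots> = (1 / 4) * (t\<^sup>2 * nrm (T (T x)) * (1 / 2) ^ k)"
    by (simp add: s_def power2_eq_square field_simps)
  also have "\<dots> \<le> 1 * (t\<^sup>2 * nrm (T (T x)) * (1 / 2) ^ k)"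
    using x by (intro mult_right_mono) auto
  finally show ?thesis
    using nrm_minus_commute x t by simp
qed

text \<open>Convergence on the dense set \<open>D2\<close> extends to the whole space because all
  \<open>Q k t\<close> are nonexpansive.\<close>

lemma Q_converges:
  assumes t: "t \<ge> 0" and x: "x \<in> car"
  shows "\<exists>z\<in>car. hconv V (\<lambda>k. Q k t x) z"
proof (rule complete)
  show "hcauchy V (\<lambda>k. Q k t x)"
    unfolding hcauchy_def
  proof (intro allI impI)
    fix e :: real assume e: "e > 0"
    then obtain y where y: "y \<in> D2" "nrm (x - y) < e / 3"
      using D2_dense[OF x, of "e / 3"] by auto
    obtain z where "z \<in> car" "hconv V (\<lambda>k. Q k t y) z"
      using geometric_limit[of "\<lambda>k. Q k t y" "1 / 2", OF _ _ _ Q_step[OF t y(1)]] t y by auto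
    then have "hcauchy V (\<lambda>k. Q k t y)"
      using hconv_hcauchy t y by auto
    then obtain N where N: "\<And>m n. m \<ge> N \<Longrightarrow> n \<ge> N \<Longrightarrow> nrm (Q m t y - Q n t y) < e / 3"
      using e unfolding hcauchy_def by (meson divide_pos_pos zero_less_numeral)
    have "nrm (Q m t x - Q n t x) < e" if mn: "m \<ge> N" "n \<ge> N" for m n
    proof -
      have yc: "y \<in> car" using y by simp
      have near: "nrm (Q i t x - Q i t y) < e / 3" for i
        using Q_nrm[OF t, of "x - y" i] Q_diff[OF t x yc, of i] x yc y(2) by simp
      show ?thesis
        using nrm_dist_triangle[of "Q m t x" "Q m t y" "Q n t x"]
          nrm_dist_triangle[of "Q m t y" "Q n t y" "Q n t x"] near[of m] near[of n] N[OF mn]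
          nrm_minus_commute[of "Q n t x" "Q n t y"] x yc t by simp
    qed
    then show "\<exists>N. \<forall>m\<ge>N. \<forall>n\<ge>N. nrm (Q m t x - Q n t x) < e"
      by blast
  qed
qed (use assms in auto)

definition S :: "real \<Rightarrow> 'v \<Rightarrow> 'v" where
  "S t x = (SOME z. z \<in> car \<and> hconv V (\<lambda>k. Q k t x) z)"

lemma S_conv:
  assumes "t \<ge> 0" "x \<in> car"
  shows "S t x \<in> car" "hconv V (\<lambda>k. Q k t x) (S t x)"
  using someI_ex[of "\<lambda>z. z \<in> car \<and> hconv V (\<lambda>k. Q k t x) z"] Q_converges[OF assms]
  unfolding S_def by blast+

lemma S_car [simp]: "t \<ge> 0 \<Longrightarrow> x \<in> car \<Longrightarrow> S t x \<in> car"
  by (rule S_conv)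

lemma S_eqI: "t \<ge> 0 \<Longrightarrow> x \<in> car \<Longrightarrow> z \<in> car \<Longrightarrow> hconv V (\<lambda>k. Q k t x) z \<Longrightarrow> S t x = z"
  using hconv_unique[of "\<lambda>k. Q k t x" "S t x" z] S_conv by simp

lemma S_0: "x \<in> car \<Longrightarrow> S 0 x = x"
proof -
  assume x: "x \<in> car"
  have "(J 0 ^^ n) x = x" for n
    by (induction n) auto
  then show ?thesis
    using x by (intro S_eqI) (auto simp: Q_def hconv_const)
qed

lemma S_scale: "t \<ge> 0 \<Longrightarrow> x \<in> car \<Longrightarrow> S t (c *\<^sub>C x) = c *\<^sub>C S t x"
  by (rule S_eqI) (auto simp: Q_scale hconv_scale S_conv)

lemma S_diff: "t \<ge> 0 \<Longrightarrow> x \<in> car \<Longrightarrow> y \<in> car \<Longrightarrow> S t (x - y) = S t x - S t y"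
  by (rule S_eqI) (auto simp: Q_diff hconv_diff S_conv)

lemma S_add: "t \<ge> 0 \<Longrightarrow> x \<in> car \<Longrightarrow> y \<in> car \<Longrightarrow> S t (x + y) = S t x + S t y"
  using S_diff[of t x "-y"] S_scale[of t y "-1"] by simp

lemma S_bound:
  assumes "t \<ge> 0" "x \<in> car" "y \<in> car" "\<And>k. nrm (Q k t x - y) \<le> c"
  shows "nrm (S t x - y) \<le> c"
  using hconv_nrm_diff[OF _ _ _ S_conv(2)[OF assms(1,2)], of y] assms
  by (intro LIMSEQ_le_const2[of "\<lambda>k. nrm (Q k t x - y)"]) auto

lemma S_nrm: "t \<ge> 0 \<Longrightarrow> x \<in> car \<Longrightarrow> nrm (S t x) \<le> nrm x"
  using S_bound[of t x 0 "nrm x"] Q_nrm by simp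

lemma S_near:
  assumes "t \<ge> 0" "x \<in> D"
  shows "nrm (S t x - x) \<le> t * nrm (T x)"
proof (rule S_bound)
  fix k
  define s where "s = t / 2 ^ k"
  have s: "s \<ge> 0" using assms by (simp add: s_def)
  have "nrm ((J s ^^ 2 ^ k) x - (id ^^ 2 ^ k) x) \<le> real (2 ^ k) * nrm (J s x - id x)"
    using s assms by (intro funpow_diff_le nonexp_J) (auto simp: nonexp_def)
  also have "\<dots> \<le> real (2 ^ k) * (s * nrm (T x))"
    using J_near[OF s assms(2)] by (intro mult_left_mono) auto
  finally show "nrm (Q k t x - x) \<le> t * nrm (T x)"
    by (simp add: Q_def s_def)
qed (use assms in auto)

text \<open>The Euler increments are \<open>s\<close> times an iterate of \<open>J s\<close> at
  \<open>T x\<close>, so the error is governed by the oscillation of that orbit. Orbits move slowly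
  when they start in \<open>D\<close>, where \<open>T x\<close> need not lie; hence the free
  \<open>y\<close> in \<open>D\<close>, chosen close to \<open>T x\<close> later.\<close>

lemma S_first_order:
  assumes "t \<ge> 0" "x \<in> D" "y \<in> D"
  shows "nrm (S t x - x - t *\<^sub>r T x) \<le> t * (2 * nrm (T x - y) + t * nrm (T y))"
proof -
  have "nrm (Q k t x - (x + t *\<^sub>r T x)) \<le> t * (2 * nrm (T x - y) + t * nrm (T y))" for k
  proof -
    define s where "s = t / 2 ^ k"
    define e where "e = 2 * nrm (T x - y) + t * nrm (T y)"
    have s: "s \<ge> 0" using assms by (simp add: s_def)
    note Jn = nonexpD[OF nonexp_funpow[OF nonexp_J[OF s]]]
    \<comment> \<open>The factor 2 in \<open>e\<close> pays for exchanging \<open>T x\<close> and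
      \<open>y\<close> at both ends of the orbit; the rest is at most 2^k slow steps of total length
      \<open>t\<close>.\<close>
    have osc: "nrm ((J s ^^ n) (T x) - T x) \<le> e" if n: "n \<le> 2 ^ k" for n
    proof -
      have "nrm ((J s ^^ n) y - (id ^^ n) y) \<le> real n * nrm (J s y - id y)"
        using s assms by (intro funpow_diff_le nonexp_J) (auto simp: nonexp_def)
      also have "\<dots> \<le> real n * (s * nrm (T y))"
        using J_near[OF s assms(3)] by (intro mult_left_mono) auto
      also have "\<dots> \<le> real (2 ^ k) * (s * nrm (T y))"
        using n s assms by (intro mult_right_mono) (auto simp only: of_nat_le_iff nrm_ge0 T_car mult_nonneg_nonneg)
      finally have "nrm ((J s ^^ n) y - y) \<le> t * nrm (T y)"
        by (simp add: s_def)
      moreover have "nrm ((J s ^^ n) (T x) - (J s ^^ n) y) \<le> nrm (T x - y)"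
        using Jn(2)[of "T x - y" n] Jn(3)[of "T x" y n] assms by simp
      ultimately show ?thesis
        using nrm_dist_triangle[of "(J s ^^ n) (T x)" "(J s ^^ n) y" "T x"]
          nrm_dist_triangle[of "(J s ^^ n) y" y "T x"] nrm_minus_commute[of y "T x"] assms Jn(1)
        by (simp add: e_def)
    qed
    have "nrm ((J s ^^ n) x - x - (real n * s) *\<^sub>r T x) \<le> real n * s * e" if "n \<le> 2 ^ k" for n
      using that
    proof (induction n)
      case (Suc n)
      have "J s x - x = s *\<^sub>r J s (T x)"
        using J_D[OF s assms(2)] J_T[OF s assms(2)] by (metis diff_add_cancel add_diff_cancel_left')
      moreover have "(J s ^^ n) (s *\<^sub>r J s (T x)) = s *\<^sub>r (J s ^^ Suc n) (T x)"
      proof -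
        have "(J s ^^ n) (c *\<^sub>C z) = c *\<^sub>C (J s ^^ n) z" if "z \<in> car" for c z
          using that s Jn(1) by (induction n) (auto simp: J_scale)
        then show ?thesis using s assms by (simp add: funpow_swap1)
      qed
      ultimately have "(J s ^^ Suc n) x - (J s ^^ n) x = s *\<^sub>r (J s ^^ Suc n) (T x)"
        using Jn(3)[of "J s x" x n] s assms by (simp add: funpow_swap1)
      then have "(J s ^^ Suc n) x - x - (real (Suc n) * s) *\<^sub>r T x =
          ((J s ^^ n) x - x - (real n * s) *\<^sub>r T x) + s *\<^sub>r ((J s ^^ Suc n) (T x) - T x)"
        by (simp add: algebra_simps cvec.scale_right_diff_distrib cvec.scale_left_distrib)
      also have "nrm \<dots> \<le> nrm ((J s ^^ n) x - x - (real n * s) *\<^sub>r T x) + s * nrm ((J s ^^ Suc n) (T x) - T x)"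
        using nrm_triangle[of "(J s ^^ n) x - x - (real n * s) *\<^sub>r T x" "s *\<^sub>r ((J s ^^ Suc n) (T x) - T x)"]
          assms s Jn(1)[of x n] Jn(1)[of "T x" "Suc n"] nrm_scale[of "(J s ^^ Suc n) (T x) - T x" "complex_of_real s"]
        by (simp del: funpow.simps)
      also have "\<dots> \<le> real n * s * e + s * e"
        using Suc osc[of "Suc n"] s by (intro add_mono mult_left_mono) auto
      finally show ?case by (simp add: algebra_simps)
    qed simp
    from this[of "2 ^ k"] show ?thesis
      by (simp add: s_def Q_def e_def diff_diff_eq)
  qed
  then have "nrm (S t x - (x + t *\<^sub>r T x)) \<le> t * (2 * nrm (T x - y) + t * nrm (T y))"
    using assms by (intro S_bound) auto
  then show ?thesis by (simp add: diff_diff_eq)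
qed

text \<open>\<open>Q k s (Q k t x)\<close> takes 2^k steps of each of the sizes s / 2^k and t / 2^k.
  Their mean is the step size of \<open>Q (Suc k) (s + t)\<close>, which takes as many steps
  altogether, so the comparison estimate bounds the difference by a multiple of 2^-k.\<close>

lemma S_semigroup_D2:
  assumes st: "s \<ge> 0" "t \<ge> 0" and x: "x \<in> D2"
  shows "S (s + t) x = S s (S t x)"
proof (rule S_eqI)
  have xc: "x \<in> car" using x by simp
  \<comment> \<open>Stability: the inner argument converges and \<open>Q k s\<close> does not expand
    the error.\<close>
  have A: "(\<lambda>k. nrm (Q k s (Q k t x) - S s (S t x))) \<longlonglongrightarrow> 0"
  proof (rule squeeze_zero)
    show "(\<lambda>k. nrm (Q k t x - S t x) + nrm (Q k s (S t x) - S s (S t x))) \<longlonglongrightarrow> 0"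
      using tendsto_add[OF S_conv(2)[OF st(2) xc, unfolded hconv_def]
          S_conv(2)[OF st(1) S_car[OF st(2) xc], unfolded hconv_def]] by simp
    show "\<forall>\<^sub>F k in sequentially. 0 \<le> nrm (Q k s (Q k t x) - S s (S t x)) \<and>
        nrm (Q k s (Q k t x) - S s (S t x)) \<le> nrm (Q k t x - S t x) + nrm (Q k s (S t x) - S s (S t x))"
    proof (intro always_eventually allI conjI)
      fix k
      have "nrm (Q k s (Q k t x) - Q k s (S t x)) \<le> nrm (Q k t x - S t x)"
        using Q_nrm[OF st(1), of "Q k t x - S t x" k] Q_diff[OF st(1), of "Q k t x" "S t x" k] st xc by simp
      then show "nrm (Q k s (Q k t x) - S s (S t x)) \<le> nrm (Q k t x - S t x) + nrm (Q k s (S t x) - S s (S t x))"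
        using nrm_dist_triangle[of "Q k s (Q k t x)" "Q k s (S t x)" "S s (S t x)"] st xc by simp
    qed (use st xc in auto)
  qed
  have B: "(\<lambda>k. nrm (Q (Suc k) (s + t) x - Q k s (Q k t x))) \<longlonglongrightarrow> 0"
  proof (rule squeeze_zero)
    define c where "c = ((s - t) / 2)\<^sup>2 * nrm (T (T x))"
    have "(\<lambda>k. c * (1 / 2) ^ k) \<longlonglongrightarrow> c * 0"
      by (intro tendsto_intros LIMSEQ_realpow_zero) auto
    then show "(\<lambda>k. c * (1 / 2) ^ k) \<longlonglongrightarrow> 0"
      by simp
    show "\<forall>\<^sub>F k in sequentially. 0 \<le> nrm (Q (Suc k) (s + t) x - Q k s (Q k t x)) \<and>
        nrm (Q (Suc k) (s + t) x - Q k s (Q k t x)) \<le> c * (1 / 2) ^ k"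
    proof (intro always_eventually allI conjI)
      fix k
      have "s / 2 ^ k \<ge> 0" "t / 2 ^ k \<ge> 0" using st by auto
      from funpow_J_compare[OF this x, of "2 ^ k"]
      have "nrm (Q k s (Q k t x) - Q (Suc k) (s + t) x) \<le>
          real (2 ^ k) * (((s / 2 ^ k - t / 2 ^ k) / 2)\<^sup>2 * nrm (T (T x)))"
        by (simp add: Q_def add_divide_distrib mult.commute)
      also have "\<dots> = c * (1 / 2) ^ k"
        by (simp add: c_def power2_eq_square field_simps)
      finally show "nrm (Q (Suc k) (s + t) x - Q k s (Q k t x)) \<le> c * (1 / 2) ^ k"
        using nrm_minus_commute st xc by simp
    qed (use st xc in auto)
  qed
  have "(\<lambda>k. nrm (Q (Suc k) (s + t) x - S s (S t x))) \<longlonglongrightarrow> 0"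
  proof (rule squeeze_zero)
    show "(\<lambda>k. nrm (Q (Suc k) (s + t) x - Q k s (Q k t x)) + nrm (Q k s (Q k t x) - S s (S t x))) \<longlonglongrightarrow> 0"
      using tendsto_add[OF B A] by simp
    show "\<forall>\<^sub>F k in sequentially. 0 \<le> nrm (Q (Suc k) (s + t) x - S s (S t x)) \<and>
        nrm (Q (Suc k) (s + t) x - S s (S t x)) \<le>
          nrm (Q (Suc k) (s + t) x - Q k s (Q k t x)) + nrm (Q k s (Q k t x) - S s (S t x))"
      using st xc by (intro always_eventually allI conjI nrm_dist_triangle) auto
  qed
  then have "(\<lambda>k. nrm (Q k (s + t) x - S s (S t x))) \<longlonglongrightarrow> 0"
    by (rule LIMSEQ_imp_Suc)
  then show "hconv V (\<lambda>k. Q k (s + t) x) (S s (S t x))"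
    by (simp add: hconv_def)
qed (use assms in auto)

lemma S_semigroup:
  assumes st: "s \<ge> 0" "t \<ge> 0" and x: "x \<in> car"
  shows "S (s + t) x = S s (S t x)"
proof -
  have "nrm (S (s + t) x - S s (S t x)) \<le> 0 + e" if e: "e > 0" for e
  proof -
    obtain y where y: "y \<in> D2" "nrm (x - y) < e / 2"
      using D2_dense[OF x, of "e / 2"] e by auto
    have yc: "y \<in> car" using y by simp
    have "S (s + t) x - S s (S t x) = S (s + t) (x - y) - S s (S t (x - y))"
      using st x yc S_semigroup_D2[OF st y(1)] by (simp add: S_diff)
    also have "nrm \<dots> \<le> nrm (S (s + t) (x - y)) + nrm (S s (S t (x - y)))"
      using st x yc by (intro nrm_triangle_diff) auto
    also have "\<dots> \<le> nrm (x - y) + nrm (x - y)"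
      using st x yc by (intro add_mono S_nrm order_trans[OF S_nrm S_nrm]) auto
    finally show ?thesis using y by simp
  qed
  then have "nrm (S (s + t) x - S s (S t x)) \<le> 0"
    by (rule field_le_epsilon)
  then show ?thesis
    using nrm_eq0[of "S (s + t) x - S s (S t x)"] nrm_ge0[of "S (s + t) x - S s (S t x)"] st x
    by (simp add: order_antisym)
qed

section \<open>Strong continuity and the generator\<close>

lemma tendsto_at_right_zeroI:
  fixes f :: "real \<Rightarrow> real"
  assumes "\<And>t. t > 0 \<Longrightarrow> 0 \<le> f t" "\<And>e. e > 0 \<Longrightarrow> \<exists>C\<ge>0. \<forall>t>0. f t \<le> e + t * C"
  shows "(f \<longlongrightarrow> 0) (at_right 0)"
proof (rule tendstoI)
  fix e :: real assume e: "e > 0"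
  then obtain C where C: "C \<ge> 0" "\<And>t. t > 0 \<Longrightarrow> f t \<le> e / 2 + t * C"
    using assms(2)[of "e / 2"] by auto
  have "dist (f t) 0 < e" if t: "0 < t" "t < e / (2 * (C + 1))" for t
  proof -
    have "t * C \<le> t * (C + 1)" using t by simp
    also have "\<dots> < e / 2" using t C by (simp add: field_simps)
    finally show ?thesis using C(2)[of t] assms(1)[of t] t by simp
  qed
  moreover have "e / (2 * (C + 1)) > 0" using e C by simp
  ultimately show "\<forall>\<^sub>F t in at_right 0. dist (f t) 0 < e"
    unfolding eventually_at_right_field by blast
qed

lemma S_strongly_continuous:
  assumes x: "x \<in> car"
  shows "((\<lambda>t. nrm (S t x - x)) \<longlongrightarrow> 0) (at_right 0)"
proof (rule tendsto_at_right_zeroI)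
  fix e :: real assume "e > 0"
  then obtain y where y: "y \<in> D2" "nrm (x - y) < e / 2"
    using D2_dense[OF x, of "e / 2"] by auto
  have "nrm (S t x - x) \<le> e + t * nrm (T y)" if t: "t > 0" for t
  proof -
    have yc: "y \<in> car" using y by simp
    have "nrm (S t x - S t y) \<le> nrm (x - y)"
      using S_nrm[of t "x - y"] S_diff[of t x y] t x yc by simp
    then show ?thesis
      using nrm_dist_triangle[of "S t x" "S t y" x] nrm_dist_triangle[of "S t y" y x]
        nrm_minus_commute[of y x] S_near[of t y] t x y by simp
  qed
  \<comment> \<open>The constant depends on \<open>e\<close> through the approximant
    \<open>y\<close> and may blow up as \<open>e\<close> shrinks, which the convergence criterion
    permits.\<close>
  then show "\<exists>C\<ge>0. \<forall>t>0. nrm (S t x - x) \<le> e + t * C"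
    using y by (intro exI[of _ "nrm (T y)"]) auto
qed (use x in auto)

lemma S_derivative:
  assumes x: "x \<in> D"
  shows "((\<lambda>h. nrm ((1 / h) *\<^sub>r (S h x - x) - T x)) \<longlongrightarrow> 0) (at_right 0)"
proof (rule tendsto_at_right_zeroI)
  fix e :: real assume "e > 0"
  then obtain y where y: "y \<in> D2" "nrm (T x - y) < e / 2"
    using D2_dense[OF T_car[OF x], of "e / 2"] by auto
  have "nrm ((1 / h) *\<^sub>r (S h x - x) - T x) \<le> e + h * nrm (T y)" if h: "h > 0" for h
  proof -
    have "(1 / h) *\<^sub>r (S h x - x) - T x = (1 / h) *\<^sub>r (S h x - x - h *\<^sub>r T x)"
      using h by (simp add: cvec.scale_right_diff_distrib flip: of_real_mult)
    then have "nrm ((1 / h) *\<^sub>r (S h x - x) - T x) = (1 / h) * nrm (S h x - x - h *\<^sub>r T x)"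
      using h x nrm_scale[of "S h x - x - h *\<^sub>r T x" "complex_of_real (1 / h)"]
      by (simp add: norm_divide)
    also have "\<dots> \<le> (1 / h) * (h * (2 * nrm (T x - y) + h * nrm (T y)))"
      using h x y by (intro mult_left_mono S_first_order) auto
    finally show ?thesis using h y by simp
  qed
  then show "\<exists>C\<ge>0. \<forall>h>0. nrm ((1 / h) *\<^sub>r (S h x - x) - T x) \<le> e + h * C"
    using y by (intro exI[of _ "nrm (T y)"]) auto
qed (use x in auto)

text \<open>The generator of \<open>S\<close> is a dissipative extension of \<open>T\<close>, hence equal to \<open>T\<close> because \<open>1 - T\<close>
  is already onto.\<close>

lemma S_generator_domain:
  assumes x: "x \<in> car" and y: "y \<in> car"
    and lim: "((\<lambda>h. nrm ((1 / h) *\<^sub>r (S h x - x) - y)) \<longlongrightarrow> 0) (at_right 0)"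
  shows "x \<in> D"
proof -
  \<comment> \<open>\<open>x - y\<close> is what \<open>1 - T\<close> would give at \<open>x\<close>
    if \<open>T x\<close> were \<open>y\<close>; so \<open>d = x - x'\<close> has right derivative
    \<open>d\<close> along \<open>S\<close>.\<close>
  obtain x' where x': "x' \<in> D" "1 *\<^sub>r x' - T x' = x - y"
    using range[of 1 "x - y"] x y by auto
  define d where "d = x - x'"
  have d: "d \<in> car" and d_eq: "y - T x' = d"
    using x x' by (auto simp: d_def algebra_simps)
  have "((\<lambda>h. nrm ((1 / h) *\<^sub>r (S h d - d) - d)) \<longlongrightarrow> 0) (at_right 0)"
  proof (rule squeeze_zero)
    show "((\<lambda>h. nrm ((1 / h) *\<^sub>r (S h x - x) - y) + nrm ((1 / h) *\<^sub>r (S h x' - x') - T x')) \<longlongrightarrow> 0) (at_right 0)"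
      using tendsto_add[OF lim S_derivative[OF x'(1)]] by simp
    show "\<forall>\<^sub>F h in at_right 0. 0 \<le> nrm ((1 / h) *\<^sub>r (S h d - d) - d) \<and>
        nrm ((1 / h) *\<^sub>r (S h d - d) - d) \<le>
        nrm ((1 / h) *\<^sub>r (S h x - x) - y) + nrm ((1 / h) *\<^sub>r (S h x' - x') - T x')"
      unfolding eventually_at_right_field
    proof (intro exI[of _ 1] conjI allI impI)
      fix h :: real assume h: "0 < h"
      have "(1 / h) *\<^sub>r (S h d - d) - (y - T x') =
          ((1 / h) *\<^sub>r (S h x - x) - y) - ((1 / h) *\<^sub>r (S h x' - x') - T x')"
        using h x x'(1) by (simp add: d_def S_diff cvec.scale_right_diff_distrib)
      then have "(1 / h) *\<^sub>r (S h d - d) - d =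
          ((1 / h) *\<^sub>r (S h x - x) - y) - ((1 / h) *\<^sub>r (S h x' - x') - T x')"
        unfolding d_eq .
      then show "nrm ((1 / h) *\<^sub>r (S h d - d) - d) \<le>
          nrm ((1 / h) *\<^sub>r (S h x - x) - y) + nrm ((1 / h) *\<^sub>r (S h x' - x') - T x')"
        using h x x' y by (metis D_car T_car mem(3,5) nrm_triangle_diff S_car less_imp_le)
    qed (use d in auto)
  qed
  \<comment> \<open>A contraction semigroup admits no growth: \<open>Re (ip (S h d - d) d)\<close>
    is nonpositive, which in the limit contradicts the derivative \<open>d\<close> unless
    \<open>d = 0\<close>.\<close>
  moreover have "\<forall>\<^sub>F h in at_right 0. (nrm d)\<^sup>2 \<le> nrm ((1 / h) *\<^sub>r (S h d - d) - d) * nrm d"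
    unfolding eventually_at_right_field
  proof (intro exI[of _ 1] conjI allI impI)
    fix h :: real assume h: "0 < h"
    have "Re (ip (S h d - d) d) \<le> nrm (S h d) * nrm d - (nrm d)\<^sup>2"
      using h d Re_ip_le[of "S h d" d] by (simp add: ip_diff_left nrm_sq)
    also have "\<dots> \<le> 0"
      using h d S_nrm[of h d] by (simp add: power2_eq_square mult_right_mono)
    finally have "Re (ip ((1 / h) *\<^sub>r (S h d - d)) d) \<le> 0"
      using h d by (subst ip_scale_left) (auto simp: divide_le_0_iff simp flip: of_real_divide)
    then have "(nrm d)\<^sup>2 \<le> Re (ip (d - (1 / h) *\<^sub>r (S h d - d)) d)"
      using h d by (simp add: ip_diff_left nrm_sq)
    also have "\<dots> \<le> nrm (d - (1 / h) *\<^sub>r (S h d - d)) * nrm d"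
      using h d by (intro Re_ip_le) auto
    finally show "(nrm d)\<^sup>2 \<le> nrm ((1 / h) *\<^sub>r (S h d - d) - d) * nrm d"
      using h d by (simp add: nrm_minus_commute[of d])
  qed simp
  ultimately have "(nrm d)\<^sup>2 \<le> 0 * nrm d"
    by (intro tendsto_lowerbound[of "\<lambda>h. nrm ((1 / h) *\<^sub>r (S h d - d) - d) * nrm d" _ "at_right 0"])
      (auto intro!: tendsto_mult_left_zero)
  then have "d = 0"
    using nrm_eq0[OF d] by simp
  then show ?thesis
    using x' by (simp add: d_def)
qed

lemma generates: "generates_C0 V D T"
  unfolding generates_C0_def
proof (intro exI[of _ S] conjI allI ballI impI)
  show "bounded_op V V (S t)" if "t \<ge> 0" for t
    unfolding bounded_op_def clinear_on_def using that
    by (auto simp: S_add S_scale car_subspace intro!: exI[of _ 1] S_nrm)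
  show "D = {x\<in>car. \<exists>y\<in>car. ((\<lambda>h. nrm ((1 / h) *\<^sub>r (S h x - x) - y)) \<longlongrightarrow> 0) (at_right 0)}"
    using S_generator_domain S_derivative T_car D_car by blast
qed (auto simp: S_0 S_semigroup S_strongly_continuous simp del: of_real_divide of_real_1 intro: S_derivative)

lemma resolvent: "resolvent_nonempty V D T"
  unfolding resolvent_nonempty_def
proof (rule exI[of _ 1], intro conjI ballI)
  fix y assume y: "y \<in> car"
  have "J 1 y \<in> D" "J 1 y - T (J 1 y) = y"
    using J_dom[of 1 y] y by auto
  then show "\<exists>!x. x \<in> D \<and> 1 *\<^sub>C x - T x = y"
    using resolvent_inj[of _ _ 1] by (intro ex1I[of _ "J 1 y"]) auto
next
  show "\<exists>C. \<forall>x\<in>D. nrm x \<le> C * nrm (1 *\<^sub>C x - T x)"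
    using nrm_le_resolvent[of _ 1] by (intro exI[of _ 1]) auto
qed

end

section \<open>Dissipative systems with boundary feedback\<close>

context ips
begin

lemma tendsto_nrm_filter:
  assumes "\<forall>\<^sub>F s in F. q s \<in> car" "w \<in> car" "((\<lambda>s. nrm (q s - w)) \<longlongrightarrow> 0) F"
  shows "((\<lambda>s. nrm (q s)) \<longlongrightarrow> nrm w) F"
proof (rule LIM_zero_cancel, rule tendsto_rabs_zero_cancel, rule squeeze_zero[OF assms(3)])
  show "\<forall>\<^sub>F s in F. 0 \<le> \<bar>nrm (q s) - nrm w\<bar> \<and> \<bar>nrm (q s) - nrm w\<bar> \<le> nrm (q s - w)"
    using assms(1) by eventually_elim (auto simp: nrm_diff_abs assms(2))
qed

lemma tendsto_ip_filter:
  assumes "\<forall>\<^sub>F s in F. q s \<in> car" "w \<in> car" "y \<in> car" "((\<lambda>s. nrm (q s - w)) \<longlongrightarrow> 0) F"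
  shows "((\<lambda>s. ip (q s) y) \<longlongrightarrow> ip w y) F"
proof (rule LIM_zero_cancel, rule tendsto_norm_zero_cancel, rule squeeze_zero)
  show "((\<lambda>s. nrm (q s - w) * nrm y) \<longlongrightarrow> 0) F"
    using assms(4) by (rule tendsto_mult_left_zero)
  show "\<forall>\<^sub>F s in F. 0 \<le> cmod (ip (q s) y - ip w y) \<and> cmod (ip (q s) y - ip w y) \<le> nrm (q s - w) * nrm y"
    using assms(1)
  proof eventually_elim
    case (elim s)
    then show ?case
      using cauchy_schwarz[of "q s - w" y] assms(2,3) by (simp add: ip_diff_left)
  qed
qed

text \<open>For the difference quotient \<open>q\<close> of \<open>z\<close>, the quotient of the
  squared norms is exactly \<open>2 * Re (ip (q s) (z t)) + (s - t) * (nrm (q s))\<^sup>2\<close>,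
  and the second term vanishes in the limit.\<close>

lemma hderiv_nrm_sq:
  assumes z: "hderiv H z z'" and t: "t \<ge> 0"
  shows "((\<lambda>s. (nrm (z s))\<^sup>2) has_real_derivative 2 * Re (ip (z' t) (z t))) (at t within {0..})"
  unfolding has_field_derivative_iff
proof -
  define q where "q s = (1 / (s - t)) *\<^sub>r (z s - z t)" for s
  have zc: "z s \<in> car" if "s \<ge> 0" for s using z that by (simp add: hderiv_def)
  have z'c: "z' t \<in> car" using z t by (simp add: hderiv_def)
  have lim: "((\<lambda>s. nrm (q s - z' t)) \<longlongrightarrow> 0) (at t within {0..})"
    using z t by (simp add: hderiv_def q_def)
  have ev: "\<forall>\<^sub>F s in at t within {0..}. s \<in> {0..} \<and> s \<noteq> t"
    by (simp add: eventually_at_filter)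
  then have qc: "\<forall>\<^sub>F s in at t within {0..}. q s \<in> car"
    by eventually_elim (use zc t in \<open>simp add: q_def\<close>)
  have "((\<lambda>s. 2 * Re (ip (q s) (z t)) + (s - t) * (nrm (q s))\<^sup>2) \<longlongrightarrow>
      2 * Re (ip (z' t) (z t)) + (t - t) * (nrm (z' t))\<^sup>2) (at t within {0..})"
    using z'c zc[OF t] qc lim by (intro tendsto_intros tendsto_ip_filter tendsto_nrm_filter)
  moreover have "\<forall>\<^sub>F s in at t within {0..}. 2 * Re (ip (q s) (z t)) + (s - t) * (nrm (q s))\<^sup>2 =
      ((nrm (z s))\<^sup>2 - (nrm (z t))\<^sup>2) / (s - t)"
    using ev
  proof eventually_elim
    case (elim s)
    then have d: "z s - z t \<in> car" and st: "s - t \<noteq> 0" using zc t by auto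
    have "ip (q s) (z t) = complex_of_real (1 / (s - t)) * ip (z s - z t) (z t)"
      unfolding q_def using d zc[OF t] by (rule ip_scale_left)
    then have 1: "Re (ip (q s) (z t)) = Re (ip (z s - z t) (z t)) / (s - t)"
      by simp
    have "nrm (q s) = nrm (z s - z t) / \<bar>s - t\<bar>"
      unfolding q_def nrm_scale[OF d] by (simp add: norm_divide flip: of_real_diff)
    then have 2: "(s - t) * (nrm (q s))\<^sup>2 = (nrm (z s - z t))\<^sup>2 / (s - t)"
      using st by (simp add: power_divide power2_eq_square)
    have "(nrm (z s))\<^sup>2 = (nrm (z s - z t))\<^sup>2 + 2 * Re (ip (z s - z t) (z t)) + (nrm (z t))\<^sup>2"
      using nrm_add_sq[OF d zc[OF t]] by simp
    then show ?case
      unfolding 1 2 by (simp add: add_divide_distrib)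
  qed
  ultimately show "((\<lambda>s. ((nrm (z s))\<^sup>2 - (nrm (z t))\<^sup>2) / (s - t)) \<longlongrightarrow> 2 * Re (ip (z' t) (z t))) (at t within {0..})"
    using tendsto_cong by force
qed

end

text \<open>What the feedback argument uses of the second-order system: dissipation up to a boundary
  term, solvability with \<open>a z + b z\<close> prescribed, and traces bounded in the graph norm
  of \<open>L\<close>. In wave terms \<open>a z + b z\<close> is the incoming and
  \<open>a z - b z\<close> the outgoing signal.\<close>

locale boundary_system = V: hil V + U: hil U
  for V :: "'v::cvec hs" and U :: "'u::cvec hs" +
  fixes Z :: "'v set" and L :: "'v \<Rightarrow> 'v" and a b :: "'v \<Rightarrow> 'u" and C :: real
  assumes Z_sub: "Z \<subseteq> hs_set V"
    and L_lin: "clinear_on Z L" and a_lin: "clinear_on Z a" and b_lin: "clinear_on Z b"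
    and L_mem [simp]: "\<And>z. z \<in> Z \<Longrightarrow> L z \<in> hs_set V"
    and a_mem [simp]: "\<And>z. z \<in> Z \<Longrightarrow> a z \<in> hs_set U"
    and b_mem [simp]: "\<And>z. z \<in> Z \<Longrightarrow> b z \<in> hs_set U"
    and green: "\<And>z. z \<in> Z \<Longrightarrow> Re (hs_ip V (L z) z) \<le> Re (hs_ip U (a z) (b z))"
    and solve: "\<And>l f q. l > 0 \<Longrightarrow> f \<in> hs_set V \<Longrightarrow> q \<in> hs_set U \<Longrightarrow>
        \<exists>z\<in>Z. l *\<^sub>r z - L z = f \<and> a z + b z = q"
    and bound_a: "\<And>z. z \<in> Z \<Longrightarrow> hnorm U (a z) \<le> C * (hnorm V z + hnorm V (L z))"
    and bound_b: "\<And>z. z \<in> Z \<Longrightarrow> hnorm U (b z) \<le> C * (hnorm V z + hnorm V (L z))"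
begin

lemma Z_V [simp]: "z \<in> Z \<Longrightarrow> z \<in> V.car"
  using Z_sub by blast

lemma Z_mem:
  "x \<in> Z \<Longrightarrow> y \<in> Z \<Longrightarrow> x + y \<in> Z" "x \<in> Z \<Longrightarrow> y \<in> Z \<Longrightarrow> x - y \<in> Z"
  "x \<in> Z \<Longrightarrow> c *\<^sub>C x \<in> Z" "0 \<in> Z"
  using clinear_on_subspace[OF L_lin] by (auto simp: cadd_mem cdiff_mem cscale_mem czero_mem)

lemmas lin_simps = clinear_on_simps[OF L_lin] clinear_on_simps[OF a_lin] clinear_on_simps[OF b_lin]

lemma energy: "z \<in> Z \<Longrightarrow> 4 * Re (V.ip (L z) z) \<le> (U.nrm (a z + b z))\<^sup>2 - (U.nrm (a z - b z))\<^sup>2"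
  using green[of z] U.polarization[of "a z" "b z"] by simp

lemma solve_feedback:
  assumes Q_lin: "clinear_on U.car Q" and Q_mem: "\<And>x. x \<in> U.car \<Longrightarrow> Q x \<in> U.car"
    and Q_contr: "\<And>x. x \<in> U.car \<Longrightarrow> U.nrm (Q x) \<le> U.nrm x"
    and l: "l > 0" and f: "f \<in> V.car" and q: "q \<in> U.car"
  shows "\<exists>z\<in>Z. l *\<^sub>r z - L z = f \<and> (a z + b z) - Q (a z - b z) = q"
proof -
  have "\<forall>r\<in>U.car. \<exists>z\<in>Z. l *\<^sub>r z - L z = f \<and> a z + b z = r"
    using solve l f by blast
  then obtain s where s: "\<And>r. r \<in> U.car \<Longrightarrow> s r \<in> Z"
    "\<And>r. r \<in> U.car \<Longrightarrow> l *\<^sub>r s r - L (s r) = f" "\<And>r. r \<in> U.car \<Longrightarrow> a (s r) + b (s r) = r"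
    by metis
  \<comment> \<open>At least 1, so that \<open>\<epsilon>\<close> is at most 1 for every
    \<open>l\<close> and its denominator is positive.\<close>
  define C' where "C' = \<bar>C\<bar> + 1"
  have C': "C' \<ge> 1" "C \<le> C'" by (auto simp: C'_def)
  \<comment> \<open>The energy balance loses \<open>4 * l * (V.nrm d)\<^sup>2\<close>, and the trace
    bounds with \<open>L d = l *\<^sub>r d\<close> give
    \<open>U.nrm (r - r') \<le> 2 * C' * (1 + l) * V.nrm d\<close>. Hence the loss is at least the
    fraction \<open>\<epsilon>\<close> of the squared norm of \<open>r - r'\<close>.\<close>
  define \<epsilon> where "\<epsilon> = 4 * l / (2 * C' * (1 + l))\<^sup>2"
  have \<epsilon>: "0 < \<epsilon>" using l C' by (simp add: \<epsilon>_def)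
  have "4 * l \<le> (2 * (1 + l))\<^sup>2"
    using l by (simp add: power2_eq_square algebra_simps)
  also have "\<dots> \<le> (2 * C' * (1 + l))\<^sup>2"
    using l C' by (intro power_mono mult_right_mono) auto
  finally have \<epsilon>1: "\<epsilon> \<le> 1"
    using l C' by (simp add: \<epsilon>_def)
  define F where "F r = Q (a (s r) - b (s r)) + q" for r
  have "\<exists>r\<in>U.car. F r = r"
  proof (rule U.banach_fixpoint[of _ "sqrt (1 - \<epsilon>)"])
    fix r r' assume r: "r \<in> U.car" "r' \<in> U.car"
    define d where "d = s r - s r'"
    have d: "d \<in> Z" using r s by (simp add: d_def Z_mem)
    have Ld: "L d = l *\<^sub>r d"
    proof -
      have "l *\<^sub>r d - L d = (l *\<^sub>r s r - L (s r)) - (l *\<^sub>r s r' - L (s r'))"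
        using r s(1) by (simp add: d_def lin_simps cvec.scale_right_diff_distrib)
      then show ?thesis using s(2) r by simp
    qed
    have abd: "a d + b d = r - r'"
    proof -
      have "a d + b d = (a (s r) + b (s r)) - (a (s r') + b (s r'))"
        using r s(1) by (simp add: d_def lin_simps)
      then show ?thesis using s(3) r by simp
    qed
    have "F r - F r' = Q (a d - b d)"
    proof -
      have "a d - b d = (a (s r) - b (s r)) - (a (s r') - b (s r'))"
        using r s(1) by (simp add: d_def lin_simps)
      then show ?thesis
        using r s(1) by (simp add: F_def clinear_on_diff[OF Q_lin])
    qed
    then have "(U.nrm (F r - F r'))\<^sup>2 \<le> (U.nrm (a d - b d))\<^sup>2"
      using Q_contr[of "a d - b d"] Q_mem[of "a d - b d"] d by (simp add: power_mono)
    also have "\<dots> \<le> (U.nrm (r - r'))\<^sup>2 - 4 * l * (V.nrm d)\<^sup>2"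
      using energy[OF d] d by (simp add: Ld V.ip_scale_left abd V.nrm_sq)
    also have "\<dots> \<le> (U.nrm (r - r'))\<^sup>2 - \<epsilon> * (U.nrm (r - r'))\<^sup>2"
    proof -
      have nLd: "V.nrm (L d) = l * V.nrm d"
        using d l by (simp add: Ld V.nrm_scale)
      have "U.nrm (r - r') \<le> U.nrm (a d) + U.nrm (b d)"
        using U.nrm_triangle[of "a d" "b d"] d abd by simp
      also have "\<dots> \<le> 2 * (C * (V.nrm d + V.nrm (L d)))"
        using bound_a[OF d] bound_b[OF d] by simp
      also have "\<dots> \<le> 2 * (C' * (V.nrm d + V.nrm (L d)))"
        using C' d by (intro mult_left_mono mult_right_mono) auto
      also have "\<dots> = 2 * C' * (1 + l) * V.nrm d"
        by (simp add: nLd algebra_simps)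
      finally have "(U.nrm (r - r'))\<^sup>2 \<le> (2 * C' * (1 + l) * V.nrm d)\<^sup>2"
        using r by (intro power_mono) auto
      then have "\<epsilon> * (U.nrm (r - r'))\<^sup>2 \<le> \<epsilon> * ((2 * C' * (1 + l))\<^sup>2 * (V.nrm d)\<^sup>2)"
        using \<epsilon> by (simp add: power_mult_distrib)
      also have "\<dots> = 4 * l * (V.nrm d)\<^sup>2"
        using l C' by (simp add: \<epsilon>_def)
      finally show ?thesis by simp
    qed
    also have "\<dots> = (sqrt (1 - \<epsilon>) * U.nrm (r - r'))\<^sup>2"
      using \<epsilon>1 by (simp add: power_mult_distrib algebra_simps)
    finally show "U.nrm (F r - F r') \<le> sqrt (1 - \<epsilon>) * U.nrm (r - r')"
      by (rule power2_le_imp_le) (use \<epsilon>1 r in simp)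
  qed (use s \<epsilon> \<epsilon>1 Q_mem q in \<open>auto simp: F_def\<close>)
  then obtain r where r: "r \<in> U.car" "F r = r" by blast
  then have "(a (s r) + b (s r)) - Q (a (s r) - b (s r)) = q"
    using s(3)[OF r(1)] by (simp add: F_def algebra_simps)
  then show ?thesis
    using s r by blast
qed

text \<open>The limit data determine some \<open>z'\<close> by Robin solvability, and the energy
  estimate for \<open>X n - z'\<close> forces \<open>X n\<close> to converge to it, so
  \<open>z = z'\<close>. Only then do the graph norm bounds give convergence of \<open>a\<close> and
  \<open>b\<close> separately.\<close>

lemma closed_graph:
  assumes X: "\<And>n. X n \<in> Z" and z: "z \<in> V.car" "hconv V X z" and v: "v \<in> V.car" "hconv V (\<lambda>n. L (X n)) v"
    and q: "q \<in> U.car" "hconv U (\<lambda>n. a (X n) + b (X n)) q"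
  shows "z \<in> Z" "L z = v" "hconv U (\<lambda>n. a (X n)) (a z)" "hconv U (\<lambda>n. b (X n)) (b z)"
proof -
  obtain z' where z': "z' \<in> Z" "1 *\<^sub>r z' - L z' = z - v" "a z' + b z' = q"
    using solve[of 1 "z - v" q] z v q by auto
  define d where "d n = X n - z'" for n
  have d: "d n \<in> Z" for n using X z' by (simp add: d_def Z_mem)
  \<comment> \<open>Dissipativity with nonzero incoming signal; the outgoing term has the favourable
    sign and is dropped.\<close>
  have est: "(V.nrm (d n))\<^sup>2 \<le> (V.nrm (X n - z) + V.nrm (L (X n) - v)) * V.nrm (d n) +
      (U.nrm (a (X n) + b (X n) - q))\<^sup>2 / 4" for n
  proof -
    have 1: "d n - L (d n) = (X n - z) - (L (X n) - v)"
      using X z' by (simp add: d_def lin_simps algebra_simps)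
    have 2: "a (d n) + b (d n) = a (X n) + b (X n) - q"
      using X z'(1) z'(3)[symmetric] by (simp add: d_def lin_simps)
    have "(V.nrm (d n))\<^sup>2 = Re (V.ip (d n - L (d n)) (d n)) + Re (V.ip (L (d n)) (d n))"
      using d[of n] by (simp add: V.ip_diff_left V.nrm_sq)
    moreover have "Re (V.ip (d n - L (d n)) (d n)) \<le> V.nrm (d n - L (d n)) * V.nrm (d n)"
      using d[of n] by (intro V.Re_ip_le) auto
    moreover have "V.nrm (d n - L (d n)) * V.nrm (d n) \<le> (V.nrm (X n - z) + V.nrm (L (X n) - v)) * V.nrm (d n)"
      unfolding 1 using X z v d[of n] by (intro mult_right_mono V.nrm_triangle_diff) auto
    moreover have "4 * Re (V.ip (L (d n)) (d n)) \<le> (U.nrm (a (X n) + b (X n) - q))\<^sup>2 - (U.nrm (a (d n) - b (d n)))\<^sup>2"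
      using energy[OF d[of n]] unfolding 2 .
    ultimately show ?thesis
      using zero_le_power2[of "U.nrm (a (d n) - b (d n))"] by linarith
  qed
  have "(\<lambda>n. V.nrm (d n)) \<longlonglongrightarrow> V.nrm (z - z')"
    unfolding d_def using V.hconv_nrm_diff[of X z z'] X z z' by simp
  moreover have "(\<lambda>n. (V.nrm (X n - z) + V.nrm (L (X n) - v)) * V.nrm (d n) +
      (U.nrm (a (X n) + b (X n) - q))\<^sup>2 / 4) \<longlonglongrightarrow> (0 + 0) * V.nrm (z - z') + 0\<^sup>2 / 4"
    using z(2) v(2) q(2) \<open>(\<lambda>n. V.nrm (d n)) \<longlonglongrightarrow> V.nrm (z - z')\<close>
    unfolding hconv_def by (intro tendsto_intros) auto
  ultimately have "(V.nrm (z - z'))\<^sup>2 \<le> (0 + 0) * V.nrm (z - z') + 0\<^sup>2 / 4"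
    using est by (intro LIMSEQ_le[OF tendsto_power]) auto
  then have "z - z' = 0"
    using V.nrm_eq0[of "z - z'"] z z' by simp
  then have zz: "z = z'" by simp
  show "z \<in> Z" "L z = v" using z' by (auto simp: zz)
  have conv: "hconv U (\<lambda>n. g (X n)) (g z)"
    if g: "clinear_on Z g" "\<And>z. z \<in> Z \<Longrightarrow> g z \<in> U.car"
      "\<And>z. z \<in> Z \<Longrightarrow> U.nrm (g z) \<le> C * (V.nrm z + V.nrm (L z))" for g
    unfolding hconv_def
  proof (rule squeeze_zero)
    have "(\<lambda>n. C * (V.nrm (X n - z) + V.nrm (L (X n) - v))) \<longlonglongrightarrow> C * (0 + 0)"
      using z(2) v(2) unfolding hconv_def by (intro tendsto_intros)
    then show "(\<lambda>n. C * (V.nrm (X n - z) + V.nrm (L (X n) - v))) \<longlonglongrightarrow> 0"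
      by simp
    have "U.nrm (g (X n) - g z) \<le> C * (V.nrm (X n - z) + V.nrm (L (X n) - v))" for n
      using g(3)[of "X n - z"] X \<open>z \<in> Z\<close> \<open>L z = v\<close>
      by (simp add: clinear_on_diff[OF g(1)] lin_simps Z_mem)
    then show "\<forall>\<^sub>F n in sequentially. 0 \<le> U.nrm (g (X n) - g z) \<and>
        U.nrm (g (X n) - g z) \<le> C * (V.nrm (X n - z) + V.nrm (L (X n) - v))"
      using X \<open>z \<in> Z\<close> g(2) by simp
  qed
  show "hconv U (\<lambda>n. a (X n)) (a z)" "hconv U (\<lambda>n. b (X n)) (b z)"
    using conv[OF a_lin a_mem bound_a] conv[OF b_lin b_mem bound_b] by auto
qed

text \<open>Two contractions appear so that one statement covers the node (\<open>Q = R = P\<close>)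
  and its Cayley transform (\<open>Q = 0\<close>, \<open>R = P\<close>). The condition expressing
  \<open>a z + b z\<close> by \<open>G z\<close> and \<open>K z\<close> serves closedness: it turns
  convergence of input and output into convergence of the incoming signal.\<close>

lemma internally_well_posed_feedback:
  assumes Q_lin: "clinear_on U.car Q" and Q_mem: "\<And>x. x \<in> U.car \<Longrightarrow> Q x \<in> U.car"
    and Q_contr: "\<And>x. x \<in> U.car \<Longrightarrow> U.nrm (Q x) \<le> U.nrm x"
    and R_lin: "clinear_on U.car R" and R_mem: "\<And>x. x \<in> U.car \<Longrightarrow> R x \<in> U.car"
    and R_contr: "\<And>x. x \<in> U.car \<Longrightarrow> U.nrm (R x) \<le> U.nrm x"
    and c: "c \<noteq> 0"
    and G: "\<And>z. z \<in> Z \<Longrightarrow> G z = c *\<^sub>C ((a z + b z) - Q (a z - b z))"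
    and K: "\<And>z. z \<in> Z \<Longrightarrow> K z = c' *\<^sub>C (a z + b z) + c'' *\<^sub>C R (a z - b z)"
    and GK: "\<And>z. z \<in> Z \<Longrightarrow> a z + b z = \<alpha> *\<^sub>C G z + \<beta> *\<^sub>C K z"
  shows "internally_well_posed U V U Z G L K"
proof -
  have G_mem: "G z \<in> U.car" if "z \<in> Z" for z using that Q_mem by (simp add: G)
  have K_mem: "K z \<in> U.car" if "z \<in> Z" for z using that R_mem by (simp add: K)
  have Zs: "csubspace Z" using L_lin clinear_on_subspace by blast
  have G_lin: "clinear_on Z G"
    unfolding clinear_on_def
  proof (intro conjI ballI allI Zs)
    fix x y assume xy: "x \<in> Z" "y \<in> Z"
    have "a (x + y) - b (x + y) = (a x - b x) + (a y - b y)"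
      using xy by (simp add: lin_simps)
    then have "Q (a (x + y) - b (x + y)) = Q (a x - b x) + Q (a y - b y)"
      using xy by (simp only:) (simp add: clinear_on_add[OF Q_lin])
    then show "G (x + y) = G x + G y"
      using xy by (simp only: G Z_mem lin_simps flip: cvec.scale_right_distrib)
        (simp add: algebra_simps)
  next
    fix k x assume x: "x \<in> Z"
    have "a (k *\<^sub>C x) - b (k *\<^sub>C x) = k *\<^sub>C (a x - b x)"
      using x by (simp add: lin_simps cvec.scale_right_diff_distrib)
    then have "Q (a (k *\<^sub>C x) - b (k *\<^sub>C x)) = k *\<^sub>C Q (a x - b x)"
      using x by (simp only:) (simp add: clinear_on_scale[OF Q_lin])
    then show "G (k *\<^sub>C x) = k *\<^sub>C G x"
      using x by (simp only: G Z_mem) (simp add: lin_simps mult.commute[of k]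
          cvec.scale_right_diff_distrib cvec.scale_right_distrib)
  qed
  have K_lin: "clinear_on Z K"
    unfolding clinear_on_def
  proof (intro conjI ballI allI Zs)
    fix x y assume xy: "x \<in> Z" "y \<in> Z"
    have "a (x + y) - b (x + y) = (a x - b x) + (a y - b y)"
      using xy by (simp add: lin_simps)
    then have "R (a (x + y) - b (x + y)) = R (a x - b x) + R (a y - b y)"
      using xy by (simp only:) (simp add: clinear_on_add[OF R_lin])
    then show "K (x + y) = K x + K y"
      using xy by (simp only: K Z_mem) (simp add: lin_simps cvec.scale_right_distrib)
  next
    fix k x assume x: "x \<in> Z"
    have "a (k *\<^sub>C x) - b (k *\<^sub>C x) = k *\<^sub>C (a x - b x)"
      using x by (simp add: lin_simps cvec.scale_right_diff_distrib)
    then have "R (a (k *\<^sub>C x) - b (k *\<^sub>C x)) = k *\<^sub>C R (a x - b x)"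
      using x by (simp only:) (simp add: clinear_on_scale[OF R_lin])
    then show "K (k *\<^sub>C x) = k *\<^sub>C K x"
      using x by (simp only: K Z_mem) (simp add: lin_simps mult.commute[of k]
          cvec.scale_right_diff_distrib cvec.scale_right_distrib)
  qed
  define D where "D = {z\<in>Z. G z = 0}"
  interpret D: maximal_dissipative V D L
  proof
    show "clinear_on D L"
      using L_lin G_lin unfolding clinear_on_def csubspace_def D_def
      by (auto simp: clinear_on_zero[OF G_lin])
    show "Re (V.ip (L x) x) \<le> 0" if "x \<in> D" for x
    proof -
      have x: "x \<in> Z" "a x + b x = Q (a x - b x)" using that c by (auto simp: D_def G)
      then have "(U.nrm (a x + b x))\<^sup>2 \<le> (U.nrm (a x - b x))\<^sup>2"
        using Q_contr[of "a x - b x"] Q_mem by (simp add: power_mono)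
      then show ?thesis using energy[OF x(1)] by simp
    qed
    show "\<exists>x\<in>D. l *\<^sub>r x - L x = y" if "l > 0" "y \<in> V.car" for l y
      using solve_feedback[OF Q_lin Q_mem Q_contr that U.mem(1)] by (auto simp: D_def G)
  qed (auto simp: D_def)
  have surj: "G ` Z = U.car"
  proof
    show "U.car \<subseteq> G ` Z"
    proof
      fix u assume u: "u \<in> U.car"
      have "\<exists>z\<in>Z. 1 *\<^sub>r z - L z = 0 \<and> (a z + b z) - Q (a z - b z) = (1 / c) *\<^sub>C u"
        by (rule solve_feedback[OF Q_lin Q_mem Q_contr]) (use u in auto)
      then show "u \<in> G ` Z"
        using c by (auto simp: G intro!: image_eqI)
    qed
  qed (use G_mem in blast)
  have "boundary_node U V U Z G L K"
    unfolding boundary_node_def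
  proof (intro conjI allI impI)
    show "colligation U V U Z G L K"
      unfolding colligation_def using G_lin K_lin L_lin G_mem K_mem Z_sub by auto
    show "G ` Z = U.car" by fact
    show "dense_in V {z \<in> Z. G z = 0}" "resolvent_nonempty V {z \<in> Z. G z = 0} L"
      using D.D_dense D.resolvent by (auto simp: D_def)
  next
    fix X z u v w
    assume *: "(\<forall>n. X n \<in> Z) \<and> z \<in> V.car \<and> u \<in> U.car \<and> v \<in> V.car \<and> w \<in> U.car \<and>
      hconv V X z \<and> hconv U (\<lambda>n. G (X n)) u \<and> hconv V (\<lambda>n. L (X n)) v \<and> hconv U (\<lambda>n. K (X n)) w"
    then have X: "X n \<in> Z" for n by blast
    from * have lims: "z \<in> V.car" "hconv V X z" "v \<in> V.car" "hconv V (\<lambda>n. L (X n)) v"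
      "u \<in> U.car" "hconv U (\<lambda>n. G (X n)) u" "w \<in> U.car" "hconv U (\<lambda>n. K (X n)) w"
      by blast+
    have "hconv U (\<lambda>n. \<alpha> *\<^sub>C G (X n) + \<beta> *\<^sub>C K (X n)) (\<alpha> *\<^sub>C u + \<beta> *\<^sub>C w)"
      using lims X G_mem K_mem by (intro U.hconv_add U.hconv_scale) simp_all
    then have q: "hconv U (\<lambda>n. a (X n) + b (X n)) (\<alpha> *\<^sub>C u + \<beta> *\<^sub>C w)"
      using X by (simp add: GK)
    have "\<alpha> *\<^sub>C u + \<beta> *\<^sub>C w \<in> U.car"
      using lims by simp
    note cl = closed_graph[OF X lims(1-4) this q]
    have ab: "hconv U (\<lambda>n. a (X n) + b (X n)) (a z + b z)" "hconv U (\<lambda>n. a (X n) - b (X n)) (a z - b z)"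
      using X cl by (simp_all add: U.hconv_add U.hconv_diff)
    have contr: "hconv U (\<lambda>n. T (a (X n) - b (X n))) (T (a z - b z))"
      if T: "clinear_on U.car T" "\<And>x. x \<in> U.car \<Longrightarrow> T x \<in> U.car" "\<And>x. x \<in> U.car \<Longrightarrow> U.nrm (T x) \<le> U.nrm x" for T
      unfolding hconv_def
    proof (rule squeeze_zero)
      show "(\<lambda>n. U.nrm ((a (X n) - b (X n)) - (a z - b z))) \<longlonglongrightarrow> 0"
        using ab(2) by (simp add: hconv_def)
      show "\<forall>\<^sub>F n in sequentially. 0 \<le> U.nrm (T (a (X n) - b (X n)) - T (a z - b z)) \<and>
          U.nrm (T (a (X n) - b (X n)) - T (a z - b z)) \<le> U.nrm ((a (X n) - b (X n)) - (a z - b z))"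
        using X cl(1) T by (intro always_eventually allI) (simp flip: clinear_on_diff[OF T(1)])
    qed
    have "hconv U (\<lambda>n. c *\<^sub>C ((a (X n) + b (X n)) - Q (a (X n) - b (X n)))) (c *\<^sub>C ((a z + b z) - Q (a z - b z)))"
      using X cl Q_mem ab contr[OF Q_lin Q_mem Q_contr] by (intro U.hconv_scale U.hconv_diff) auto
    then have "hconv U (\<lambda>n. G (X n)) (G z)"
      using X cl(1) by (simp add: G)
    then have Gz: "G z = u"
      using lims X cl(1) G_mem by (intro U.hconv_unique[of "\<lambda>n. G (X n)" "G z" u]) simp_all
    have "hconv U (\<lambda>n. c' *\<^sub>C (a (X n) + b (X n)) + c'' *\<^sub>C R (a (X n) - b (X n)))
        (c' *\<^sub>C (a z + b z) + c'' *\<^sub>C R (a z - b z))"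
      using X cl R_mem ab contr[OF R_lin R_mem R_contr] by (intro U.hconv_scale U.hconv_add) auto
    then have "hconv U (\<lambda>n. K (X n)) (K z)"
      using X cl(1) by (simp add: K)
    then have "K z = w"
      using lims X cl(1) K_mem by (intro U.hconv_unique[of "\<lambda>n. K (X n)" "K z" w]) simp_all
    then show "z \<in> Z" "G z = u" "L z = v" "K z = w"
      using Gz cl by auto
  qed
  then show ?thesis
    unfolding internally_well_posed_def using D.generates by (simp add: D_def)
qed

lemma scattering_passiveI:
  assumes "internally_well_posed U V U Z G L K"
    and balance: "\<And>z. z \<in> Z \<Longrightarrow> 2 * Re (V.ip (L z) z) + (U.nrm (K z))\<^sup>2 \<le> (U.nrm (G z))\<^sup>2"
  shows "scattering_passive U V U Z G L K"
  unfolding scattering_passive_def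
proof (intro conjI allI impI)
  fix u z y t
  assume s: "smooth_solution U V U Z G L K u z y" and t: "(t::real) \<ge> 0"
  have zt: "z t \<in> Z" "u t = G (z t)" "y t = K (z t)" and hd: "hderiv V z (\<lambda>t. L (z t))"
    using s t unfolding smooth_solution_def by blast+
  show "\<exists>d. ((\<lambda>s. (V.nrm (z s))\<^sup>2) has_real_derivative d) (at t within {0..}) \<and>
      d + (U.nrm (y t))\<^sup>2 \<le> (U.nrm (u t))\<^sup>2"
    using V.hderiv_nrm_sq[OF hd t] balance[OF zt(1)] zt by auto
qed (rule assms(1))

lemma impedance_passive_feedback:
  assumes P_lin: "clinear_on U.car P" and P_mem: "\<And>x. x \<in> U.car \<Longrightarrow> P x \<in> U.car"
    and P_contr: "\<And>x. x \<in> U.car \<Longrightarrow> U.nrm (P x) \<le> U.nrm x"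
    and G: "\<And>z. z \<in> Z \<Longrightarrow> G z = (1 / 2) *\<^sub>C ((a z - P (a z)) + (b z + P (b z)))"
    and K: "\<And>z. z \<in> Z \<Longrightarrow> K z = (1 / 2) *\<^sub>C ((a z + P (a z)) + (b z - P (b z)))"
  shows "internally_well_posed U V U Z G L K \<and> impedance_passive U V Z G L K"
proof
  have half: "x = (1 / 2 :: complex) *\<^sub>C (x + x)" for x :: 'u
  proof -
    have "(1 / 2 :: complex) *\<^sub>C (x + x) = (1 / 2 + 1 / 2 :: complex) *\<^sub>C x"
      by (simp only: cvec.scale_right_distrib cvec.scale_left_distrib)
    then show ?thesis by simp
  qed
  have Pd: "P (a z - b z) = P (a z) - P (b z)" if "z \<in> Z" for z
    using that by (simp add: clinear_on_diff[OF P_lin])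
  have GK: "G z + K z = a z + b z" "G z - K z = - P (a z - b z)" if z: "z \<in> Z" for z
  proof -
    have "G z + K z = (1 / 2) *\<^sub>C ((a z + b z) + (a z + b z))"
      unfolding G[OF z] K[OF z] by (simp add: algebra_simps flip: cvec.scale_right_distrib)
    then show "G z + K z = a z + b z" using half[of "a z + b z"] by simp
    have "G z - K z = (1 / 2) *\<^sub>C (- P (a z - b z) + - P (a z - b z))"
      unfolding G[OF z] K[OF z] Pd[OF z] by (simp add: algebra_simps flip: cvec.scale_right_diff_distrib)
    then show "G z - K z = - P (a z - b z)" using half[of "- P (a z - b z)"] by simp
  qed
  show "internally_well_posed U V U Z G L K"
  proof (rule internally_well_posed_feedback[OF P_lin P_mem P_contr P_lin P_mem P_contr])
    show "G z = (1 / 2) *\<^sub>C ((a z + b z) - P (a z - b z))" if "z \<in> Z" for z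
      using that by (simp add: G Pd algebra_simps)
    show "K z = (1 / 2) *\<^sub>C (a z + b z) + (1 / 2) *\<^sub>C P (a z - b z)" if "z \<in> Z" for z
      using that by (simp add: K Pd algebra_simps flip: cvec.scale_right_distrib)
    show "a z + b z = 1 *\<^sub>C G z + 1 *\<^sub>C K z" if "z \<in> Z" for z
      using GK[OF that] by simp
  qed auto
  define \<gamma> where "\<gamma> = 1 / sqrt 2"
  have \<gamma>: "\<gamma> > 0" "\<gamma>\<^sup>2 = 1 / 2" by (simp_all add: \<gamma>_def power_divide)
  define G1 where "G1 = cayley_in 1 G K"
  define K1 where "K1 = cayley_out 1 G K"
  have G1: "G1 z = \<gamma> *\<^sub>r (a z + b z)" if "z \<in> Z" for z
    using GK[OF that] by (simp add: G1_def cayley_in_def \<gamma>_def)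
  have K1: "K1 z = (- \<gamma>) *\<^sub>r P (a z - b z)" if "z \<in> Z" for z
    using GK[OF that] by (simp add: K1_def cayley_out_def \<gamma>_def)
  have "scattering_passive U V U Z G1 L K1"
  proof (rule scattering_passiveI)
    have zero_lin: "clinear_on U.car (\<lambda>_. 0)"
      by (simp add: clinear_on_def U.car_subspace)
    show "internally_well_posed U V U Z G1 L K1"
    proof (rule internally_well_posed_feedback[where Q = "\<lambda>_. 0" and R = P])
      show "complex_of_real \<gamma> \<noteq> 0" using \<gamma> by simp
      show "G1 z = \<gamma> *\<^sub>r (a z + b z - 0)" if "z \<in> Z" for z using G1 that by simp
      show "K1 z = 0 *\<^sub>C (a z + b z) + complex_of_real (- \<gamma>) *\<^sub>C P (a z - b z)" if "z \<in> Z" for z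
        using K1 that by simp
      \<comment> \<open>The input alone determines the incoming signal, so the output gets
        coefficient 0.\<close>
      show "a z + b z = complex_of_real (1 / \<gamma>) *\<^sub>C G1 z + 0 *\<^sub>C K1 z" if "z \<in> Z" for z
        using G1 that \<gamma> by (simp flip: of_real_mult)
    qed (use zero_lin P_lin P_mem P_contr in auto)
    fix z assume z: "z \<in> Z"
    have d: "a z - b z \<in> U.car" "P (a z - b z) \<in> U.car" "a z + b z \<in> U.car" using z P_mem by auto
    \<comment> \<open>Both squared signals carry the factor \<open>\<gamma>\<^sup>2 = 1 / 2\<close>,
      which turns the coefficient 4 of \<open>energy\<close> into the 2 of the scattering
      balance.\<close>
    have "(U.nrm (K1 z))\<^sup>2 = (U.nrm (P (a z - b z)))\<^sup>2 / 2"
      unfolding K1[OF z] U.nrm_scale[OF d(2)] norm_of_real power_mult_distrib power2_abs by (simp add: \<gamma>)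
    also have "\<dots> \<le> (U.nrm (a z - b z))\<^sup>2 / 2"
      using P_contr[OF d(1)] d by (simp add: power_mono)
    finally have k: "(U.nrm (K1 z))\<^sup>2 \<le> (U.nrm (a z - b z))\<^sup>2 / 2" .
    have "(U.nrm (G1 z))\<^sup>2 = (U.nrm (a z + b z))\<^sup>2 / 2"
      unfolding G1[OF z] U.nrm_scale[OF d(3)] norm_of_real power_mult_distrib power2_abs by (simp add: \<gamma>)
    then show "2 * Re (V.ip (L z) z) + (U.nrm (K1 z))\<^sup>2 \<le> (U.nrm (G1 z))\<^sup>2"
      using energy[OF z] k by simp
  qed
  then show "impedance_passive U V Z G L K"
    unfolding impedance_passive_def G1_def K1_def by (intro exI[of _ 1]) simp
qed

end

section \<open>Products and duals\<close>

lemma hs_pair [simp]: "hs_set (S, i) = S" "hs_ip (S, i) = i"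
  by (simp_all add: hs_set_def hs_ip_def)

lemma prod_hs_simps [simp]:
  "hs_set (prod_hs H1 H2) = hs_set H1 \<times> hs_set H2"
  "hs_ip (prod_hs H1 H2) x y = hs_ip H1 (fst x) (fst y) + hs_ip H2 (snd x) (snd y)"
  by (simp_all add: prod_hs_def)

lemma scaleC_prod_simps [simp]: "fst (c *\<^sub>C x) = c *\<^sub>C fst x" "snd (c *\<^sub>C x) = c *\<^sub>C snd x"
  "c *\<^sub>C (u, v) = (c *\<^sub>C u, c *\<^sub>C v)"
  by (simp_all add: scaleC_prod_def)

lemma csubspace_UNIV [simp]: "csubspace UNIV"
  by (simp add: csubspace_def)

lemma csubspace_image:
  assumes T: "clinear_on D T"
  shows "csubspace (T ` D)"
proof -
  have D: "csubspace D" using T by (rule clinear_on_subspace)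
  have "T x + T y \<in> T ` D" if "x \<in> D" "y \<in> D" for x y
    using that cadd_mem[OF D] by (simp flip: clinear_on_add[OF T])
  moreover have "c *\<^sub>C T x \<in> T ` D" if "x \<in> D" for c x
    using that cscale_mem[OF D] by (simp flip: clinear_on_scale[OF T])
  moreover have "0 \<in> T ` D"
    using czero_mem[OF D] clinear_on_zero[OF T] by (metis image_eqI)
  ultimately show ?thesis
    by (auto simp: csubspace_def)
qed

section \<open>Products of Hilbert structures\<close>

locale hil_prod = H1: hil H1 + H2: hil H2 for H1 :: "'a::cvec hs" and H2 :: "'b::cvec hs"
begin

abbreviation "HP \<equiv> prod_hs H1 H2"

lemma nrm_prod_sq:
  "x \<in> hs_set HP \<Longrightarrow> (hnorm HP x)\<^sup>2 = (H1.nrm (fst x))\<^sup>2 + (H2.nrm (snd x))\<^sup>2"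
  using H1.ip_ge0[of "fst x"] H2.ip_ge0[of "snd x"]
  by (auto simp: hnorm_def)

lemma nrm_prod_bounds:
  assumes "x \<in> hs_set HP"
  shows "H1.nrm (fst x) \<le> hnorm HP x" "H2.nrm (snd x) \<le> hnorm HP x"
    "hnorm HP x \<le> H1.nrm (fst x) + H2.nrm (snd x)"
proof -
  have m: "fst x \<in> H1.car" "snd x \<in> H2.car" using assms by auto
  have ge: "hnorm HP x \<ge> 0"
    using m H1.ip_ge0[OF m(1)] H2.ip_ge0[OF m(2)] by (simp add: hnorm_def)
  show "H1.nrm (fst x) \<le> hnorm HP x"
    by (rule power2_le_imp_le) (use ge nrm_prod_sq[OF assms] in auto)
  show "H2.nrm (snd x) \<le> hnorm HP x"
    by (rule power2_le_imp_le) (use ge nrm_prod_sq[OF assms] in auto)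
  show "hnorm HP x \<le> H1.nrm (fst x) + H2.nrm (snd x)"
    by (rule power2_le_imp_le) (use m nrm_prod_sq[OF assms] in \<open>auto simp: power2_sum\<close>)
qed

sublocale hil HP
proof
  show "inner_on HP"
    unfolding inner_on_def
  proof (intro conjI ballI allI impI)
    show "csubspace (hs_set HP)"
      by (auto simp: csubspace_def zero_prod_def)
    fix x y z c assume x: "x \<in> hs_set HP"
    show "0 \<le> Re (hs_ip HP x x)"
      using x H1.ip_ge0 H2.ip_ge0 by auto
    show "x = 0" if "hs_ip HP x x = 0"
    proof -
      have "hnorm HP x = 0"
        unfolding hnorm_def that by simp
      then have "H1.nrm (fst x) = 0 \<and> H2.nrm (snd x) = 0"
        using nrm_prod_sq[OF x] by (simp add: sum_power2_eq_zero_iff)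
      then show ?thesis
        using x H1.nrm_eq0[of "fst x"] H2.nrm_eq0[of "snd x"] by (auto simp: prod_eq_iff)
    qed
    assume y: "y \<in> hs_set HP"
    show "hs_ip HP (c *\<^sub>C x) y = c * hs_ip HP x y"
      using x y by (auto simp: H1.ip_simps H2.ip_simps algebra_simps)
    show "hs_ip HP y x = cnj (hs_ip HP x y)"
      using x y H1.ip_commute[of "fst x" "fst y"] H2.ip_commute[of "snd x" "snd y"] by auto
    assume z: "z \<in> hs_set HP"
    show "hs_ip HP (x + y) z = hs_ip HP x z + hs_ip HP y z"
      using x y z by (auto simp: H1.ip_simps H2.ip_simps)
  qed
  fix X assume X: "\<And>n. X n \<in> hs_set HP" and c: "hcauchy HP X"
  have d: "X m - X n \<in> hs_set HP" for m n
    using X[of m] X[of n] by (auto simp: mem_Times_iff)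
  have le1: "H1.nrm (fst (X m) - fst (X n)) \<le> hnorm HP (X m - X n)"
    and le2: "H2.nrm (snd (X m) - snd (X n)) \<le> hnorm HP (X m - X n)" for m n
    using nrm_prod_bounds(1,2)[OF d[of m n]] by simp_all
  have "hcauchy H1 (\<lambda>n. fst (X n))"
    using c le1 unfolding hcauchy_def by (meson order_le_less_trans)
  moreover have "hcauchy H2 (\<lambda>n. snd (X n))"
    using c le2 unfolding hcauchy_def by (meson order_le_less_trans)
  ultimately obtain x1 x2 where x: "x1 \<in> H1.car" "hconv H1 (\<lambda>n. fst (X n)) x1"
      "x2 \<in> H2.car" "hconv H2 (\<lambda>n. snd (X n)) x2"
    using H1.complete[of "\<lambda>n. fst (X n)"] H2.complete[of "\<lambda>n. snd (X n)"] X by (auto simp: mem_Times_iff)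
  have dx: "X n - (x1, x2) \<in> hs_set HP" for n
    using X[of n] x by (auto simp: mem_Times_iff)
  have "hconv HP X (x1, x2)"
    unfolding hconv_def
  proof (rule squeeze_zero)
    show "(\<lambda>n. H1.nrm (fst (X n) - x1) + H2.nrm (snd (X n) - x2)) \<longlonglongrightarrow> 0"
      using tendsto_add[OF x(2)[unfolded hconv_def] x(4)[unfolded hconv_def]] by simp
    show "\<forall>\<^sub>F n in sequentially. 0 \<le> hnorm HP (X n - (x1, x2)) \<and>
        hnorm HP (X n - (x1, x2)) \<le> H1.nrm (fst (X n) - x1) + H2.nrm (snd (X n) - x2)"
    proof (intro always_eventually allI conjI)
      fix n
      show "0 \<le> hnorm HP (X n - (x1, x2))"
        using H1.nrm_ge0 dx[of n] by (intro order_trans[OF _ nrm_prod_bounds(1)[OF dx[of n]]])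
          (simp add: mem_Times_iff)
      show "hnorm HP (X n - (x1, x2)) \<le> H1.nrm (fst (X n) - x1) + H2.nrm (snd (X n) - x2)"
        using nrm_prod_bounds(3)[OF dx[of n]] by simp
    qed
  qed
  then show "\<exists>x\<in>hs_set HP. hconv HP X x"
    using x by (intro bexI[of _ "(x1, x2)"]) auto
qed

end

section \<open>The anti-dual, equivalent norms, and bounded maps\<close>

context hil
begin

lemma riesz_apply: "x \<in> car \<Longrightarrow> riesz H h x = ip h x"
  by (simp add: riesz_def)

lemma riesz_antidual: "h \<in> car \<Longrightarrow> riesz H h \<in> antidual H"
  unfolding antidual_def using cauchy_schwarz[of h]
  by (auto simp: riesz_def ip_simps intro!: exI[of _ "nrm h"])

lemma riesz_inj: "h \<in> car \<Longrightarrow> k \<in> car \<Longrightarrow> riesz H h = riesz H k \<Longrightarrow> h = k"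
proof -
  assume hk: "h \<in> car" "k \<in> car" "riesz H h = riesz H k"
  have "ip h (h - k) = ip k (h - k)"
    using hk riesz_apply[of "h - k" h] riesz_apply[of "h - k" k] by simp
  then have "ip (h - k) (h - k) = 0"
    using hk by (simp add: ip_diff_left)
  then show "h = k"
    using ip_eq0[of "h - k"] hk by simp
qed

lemma riesz_surj:
  assumes "\<phi> \<in> antidual H"
  shows "\<exists>h\<in>car. riesz H h = \<phi>"
proof -
  obtain K where "\<forall>x\<in>car. cmod (\<phi> x) \<le> K * nrm x"
    using assms unfolding antidual_def by blast
  then have K: "cmod (\<phi> x) \<le> K * nrm x" if "x \<in> car" for x
    using that by blast
  obtain h where "h \<in> car" "\<forall>x\<in>car. \<phi> x = ip h x"
    using riesz_representation[of \<phi> K, OF _ _ K] assms by (auto simp: antidual_def)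
  then show ?thesis
    using assms by (intro bexI[of _ h]) (auto simp: riesz_def antidual_def)
qed

lemma riesz_inv_riesz: "h \<in> car \<Longrightarrow> riesz_inv H (riesz H h) = h"
  unfolding riesz_inv_def by (rule the_equality) (auto dest: riesz_inj)

lemma riesz_inv:
  assumes "\<phi> \<in> antidual H"
  shows "riesz_inv H \<phi> \<in> car" "riesz H (riesz_inv H \<phi>) = \<phi>"
  using riesz_surj[OF assms] riesz_inv_riesz by auto

lemma riesz_add: "h \<in> car \<Longrightarrow> k \<in> car \<Longrightarrow> riesz H (h + k) = riesz H h + riesz H k"
  by (auto simp: riesz_def ip_simps fun_eq_iff)

lemma riesz_scale: "h \<in> car \<Longrightarrow> riesz H (c *\<^sub>C h) = c *\<^sub>C riesz H h"
  by (auto simp: riesz_def ip_simps fun_eq_iff scaleC_fun_def scaleC_complex_def)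

lemma antidual_subspace: "csubspace (antidual H)"
  unfolding csubspace_def
proof (intro conjI ballI allI)
  show "0 \<in> antidual H"
    using riesz_antidual[of 0] riesz_scale[of 0 0] by simp
  show "\<phi> + \<psi> \<in> antidual H" if "\<phi> \<in> antidual H" "\<psi> \<in> antidual H" for \<phi> \<psi>
    using that riesz_inv riesz_add riesz_antidual by (metis mem(2))
  show "c *\<^sub>C \<phi> \<in> antidual H" if "\<phi> \<in> antidual H" for c \<phi>
    using that riesz_inv riesz_scale riesz_antidual by (metis mem(5))
qed

lemma riesz_diff: "h \<in> car \<Longrightarrow> k \<in> car \<Longrightarrow> riesz H (h - k) = riesz H h - riesz H k"
  using riesz_add[of h "-k"] riesz_scale[of k "-1"] by simp

lemma riesz_inv_add: "\<phi> \<in> antidual H \<Longrightarrow> \<psi> \<in> antidual H \<Longrightarrow>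
    riesz_inv H (\<phi> + \<psi>) = riesz_inv H \<phi> + riesz_inv H \<psi>"
  by (metis riesz_inv riesz_add riesz_inv_riesz mem(2))

lemma riesz_inv_scale: "\<phi> \<in> antidual H \<Longrightarrow> riesz_inv H (c *\<^sub>C \<phi>) = c *\<^sub>C riesz_inv H \<phi>"
  by (metis riesz_inv riesz_scale riesz_inv_riesz mem(5))

lemma riesz_inv_diff: "\<phi> \<in> antidual H \<Longrightarrow> \<psi> \<in> antidual H \<Longrightarrow>
    riesz_inv H (\<phi> - \<psi>) = riesz_inv H \<phi> - riesz_inv H \<psi>"
  using riesz_inv_add[of \<phi> "-\<psi>"] riesz_inv_scale[of \<psi> "-1"] cneg_mem[OF antidual_subspace, of \<psi>] by simp

lemma dual_simps [simp]:
  "hs_set (dual_hs H) = antidual H" "hs_ip (dual_hs H) \<phi> \<psi> = ip (riesz_inv H \<phi>) (riesz_inv H \<psi>)"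
  by (simp_all add: dual_hs_def)

lemma dual_nrm: "hnorm (dual_hs H) \<phi> = nrm (riesz_inv H \<phi>)"
  by (simp add: hnorm_def)

lemma dual_ip_apply: "\<phi> \<in> antidual H \<Longrightarrow> h \<in> car \<Longrightarrow> ip (riesz_inv H \<phi>) h = \<phi> h"
  by (metis riesz_apply riesz_inv(2))

text \<open>\<open>riesz_inv\<close> is linear, and isometric by the definition of the inner product
  of \<open>dual_hs\<close>, so the axioms and Cauchy sequences are pulled back to \<open>H\<close>
  and the limit is returned by \<open>riesz\<close>.\<close>

lemma hil_dual: "hil (dual_hs H)"
proof
  show "inner_on (dual_hs H)"
    unfolding inner_on_def
  proof (intro conjI ballI allI impI)
    show "csubspace (hs_set (dual_hs H))" by (simp add: antidual_subspace)
    fix x y z c assume "x \<in> hs_set (dual_hs H)"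
    then have x: "x \<in> antidual H" "riesz_inv H x \<in> car" by (auto simp: riesz_inv)
    show "0 \<le> Re (hs_ip (dual_hs H) x x)"
      using x ip_ge0 by simp
    show "x = 0" if "hs_ip (dual_hs H) x x = 0"
    proof -
      have "riesz_inv H x = 0" using that x ip_eq0 by simp
      then have "x = riesz H 0" using riesz_inv(2)[OF x(1)] by simp
      then show ?thesis using riesz_scale[of 0 0] by simp
    qed
    assume "y \<in> hs_set (dual_hs H)"
    then have y: "y \<in> antidual H" "riesz_inv H y \<in> car" by (auto simp: riesz_inv)
    show "hs_ip (dual_hs H) (c *\<^sub>C x) y = c * hs_ip (dual_hs H) x y"
      using x y by (simp add: riesz_inv_scale ip_simps)
    show "hs_ip (dual_hs H) y x = cnj (hs_ip (dual_hs H) x y)"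
      using ip_commute[OF x(2) y(2)] by simp
    assume "z \<in> hs_set (dual_hs H)"
    then have z: "z \<in> antidual H" "riesz_inv H z \<in> car" by (auto simp: riesz_inv)
    show "hs_ip (dual_hs H) (x + y) z = hs_ip (dual_hs H) x z + hs_ip (dual_hs H) y z"
      using x y z by (simp add: riesz_inv_add ip_simps)
  qed
  fix X assume "\<And>n. X n \<in> hs_set (dual_hs H)" and c: "hcauchy (dual_hs H) X"
  then have X: "X n \<in> antidual H" for n by simp
  have "hcauchy H (\<lambda>n. riesz_inv H (X n))"
    using c X unfolding hcauchy_def by (simp add: dual_nrm riesz_inv_diff)
  then obtain h where h: "h \<in> car" "hconv H (\<lambda>n. riesz_inv H (X n)) h"
    using complete[of "\<lambda>n. riesz_inv H (X n)"] X riesz_inv by auto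
  have "hconv (dual_hs H) X (riesz H h)"
    using h X unfolding hconv_def by (simp add: dual_nrm riesz_inv_diff riesz_antidual riesz_inv_riesz)
  then show "\<exists>x\<in>hs_set (dual_hs H). hconv (dual_hs H) X x"
    using h riesz_antidual by auto
qed

lemma hil_equivalent:
  assumes H': "inner_on H'" and car': "hs_set H' = car"
    and c: "c > 0" "\<And>x. x \<in> car \<Longrightarrow> c * nrm x \<le> hnorm H' x"
    and C: "\<And>x. x \<in> car \<Longrightarrow> hnorm H' x \<le> C * nrm x"
  shows "hil H'"
proof
  interpret H': ips H' using H' by unfold_locales
  show "inner_on H'" by fact
  fix X assume X: "\<And>n. X n \<in> hs_set H'" and ca: "hcauchy H' X"
  then have Xc: "X n \<in> car" for n by (simp add: car')
  have "hcauchy H X"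
    unfolding hcauchy_def
  proof (intro allI impI)
    fix e :: real assume "e > 0"
    then obtain N where "\<forall>m\<ge>N. \<forall>n\<ge>N. hnorm H' (X m - X n) < c * e"
      using ca c(1) unfolding hcauchy_def by (meson mult_pos_pos)
    then have "\<forall>m\<ge>N. \<forall>n\<ge>N. c * nrm (X m - X n) < c * e"
      using c(2) Xc by (meson mem(3) order_le_less_trans)
    then show "\<exists>N. \<forall>m\<ge>N. \<forall>n\<ge>N. nrm (X m - X n) < e"
      using c(1) by auto
  qed
  then obtain x where x: "x \<in> car" "hconv H X x"
    using complete Xc by blast
  have "hconv H' X x"
    unfolding hconv_def
  proof (rule squeeze_zero)
    show "(\<lambda>n. C * nrm (X n - x)) \<longlonglongrightarrow> 0"
      using x(2) tendsto_mult_right_zero by (auto simp: hconv_def)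
    have "X n - x \<in> hs_set H'" for n using Xc x by (simp add: car')
    then show "\<forall>\<^sub>F n in sequentially. 0 \<le> hnorm H' (X n - x) \<and> hnorm H' (X n - x) \<le> C * nrm (X n - x)"
      using C H'.nrm_ge0 by (simp add: car')
  qed
  then show "\<exists>x\<in>hs_set H'. hconv H' X x"
    using x car' by blast
qed

text \<open>Uniform boundedness on the image of the unit ball of \<open>N\<close>, then homogeneity.
  \<open>N\<close> is abstract because the graph norms in question are sums of two norms;
  completeness is used only in the target.\<close>

lemma bounded_if_weakly_bounded:
  assumes T: "clinear_on E T" "\<And>x. x \<in> E \<Longrightarrow> T x \<in> car"
    and N: "\<And>x. x \<in> E \<Longrightarrow> 0 \<le> N x" "\<And>x. x \<in> E \<Longrightarrow> N x = 0 \<Longrightarrow> x = 0"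
      "\<And>c x. x \<in> E \<Longrightarrow> N (c *\<^sub>C x) = cmod c * N x"
    and weak: "\<And>g. g \<in> car \<Longrightarrow> \<exists>K\<ge>0. \<forall>x\<in>E. cmod (ip (T x) g) \<le> K * N x"
  shows "\<exists>C\<ge>0. \<forall>x\<in>E. nrm (T x) \<le> C * N x"
proof -
  have E: "csubspace E" using T(1) clinear_on_subspace by blast
  have "\<exists>C. \<forall>f\<in>T ` {x\<in>E. N x \<le> 1}. nrm f \<le> C"
  proof (rule uniform_boundedness)
    fix g assume "g \<in> car"
    then obtain K where "K \<ge> 0" "\<forall>x\<in>E. cmod (ip (T x) g) \<le> K * N x"
      using weak by blast
    then have "\<forall>f\<in>T ` {x\<in>E. N x \<le> 1}. cmod (ip f g) \<le> K"
      by (auto intro: order_trans mult_left_le)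
    then show "\<exists>K. \<forall>f\<in>T ` {x\<in>E. N x \<le> 1}. cmod (ip f g) \<le> K" ..
  qed (use T(2) in auto)
  then obtain C where C: "\<And>x. x \<in> E \<Longrightarrow> N x \<le> 1 \<Longrightarrow> nrm (T x) \<le> C"
    by auto
  have "nrm (T x) \<le> max C 0 * N x" if x: "x \<in> E" for x
  proof (cases "N x = 0")
    case True
    then have "T x = 0" using N(2)[OF x] clinear_on_zero[OF T(1)] by simp
    then show ?thesis using True by simp
  next
    case False
    then have pos: "N x > 0" using N(1)[OF x] by simp
    define y where "y = (1 / N x) *\<^sub>r x"
    have "nrm (T y) \<le> C"
      using pos x by (intro C) (auto simp: y_def N(3) norm_divide cscale_mem[OF E])
    moreover have "nrm (T y) = nrm (T x) / N x"
      unfolding y_def clinear_on_scale[OF T(1) x] nrm_scale[OF T(2)[OF x]] using pos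
      by (simp add: norm_divide)
    ultimately have "nrm (T x) \<le> C * N x"
      using pos by (simp add: field_simps)
    also have "\<dots> \<le> max C 0 * N x"
      using pos by (intro mult_right_mono) auto
    finally show ?thesis .
  qed
  then show ?thesis by (intro exI[of _ "max C 0"]) auto
qed

end

section \<open>The second-order system\<close>

text \<open>Both traces have values in one space \<open>E\<close>, so that Green's identity has a
  single boundary term. Under the condition \<open>\<Lambda> w - \<Gamma> v = e\<close> this term
  contributes the nonnegative \<open>E.ip (\<Lambda> w) (\<Lambda> w)\<close> to the Robin
  form.\<close>

locale wave_system = X: hil X + Y: hil Y + E: hil E
  for X :: "'x::cvec hs" and Y :: "'y::cvec hs" and E :: "'e::cvec hs" +
  fixes domA :: "'x set" and A :: "'x \<Rightarrow> 'y" and domB :: "'y set" and B :: "'y \<Rightarrow> 'x"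
    and \<Lambda> :: "'x \<Rightarrow> 'e" and \<Gamma> :: "'y \<Rightarrow> 'e" and M D :: "'x \<Rightarrow> 'x"
  assumes X_UNIV [simp]: "hs_set X = UNIV" and Y_UNIV [simp]: "hs_set Y = UNIV"
    and A_closed: "closed_op X Y domA A"
    and A_below: "\<exists>c>0. \<forall>x\<in>domA. hnorm Y (A x) \<ge> c * hnorm X x"
    and B_lin: "clinear_on domB B"
    and A_adj: "adjoint_subset_neg X Y domA A domB B"
    and \<Lambda>_lin: "clinear_on domA \<Lambda>" and \<Lambda>_surj: "\<Lambda> ` domA = hs_set E"
    and \<Gamma>_lin: "clinear_on domB \<Gamma>" and \<Gamma>_surj: "\<Gamma> ` domB = hs_set E"
    and green: "\<And>x y. y \<in> domB \<Longrightarrow> x \<in> domA \<Longrightarrow>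
        - hs_ip X (B y) x - hs_ip Y y (A x) = hs_ip E (\<Gamma> y) (\<Lambda> x)"
    and M_bdd: "bounded_op X X M"
    and M_sa: "\<And>x x'. hs_ip X (M x) x' = hs_ip X x (M x')"
    and M_pos: "\<exists>\<delta>>0. \<forall>x. Re (hs_ip X (M x) x) \<ge> \<delta> * (hnorm X x)\<^sup>2"
    and D_bdd: "bounded_op X X D"
    and D_diss: "\<And>x. Re (hs_ip X (D x) x) \<ge> 0"
begin

lemma A_lin: "clinear_on domA A"
  using A_closed by (simp add: closed_op_def)

lemma M_lin: "clinear_on UNIV M" and D_lin: "clinear_on UNIV D"
  using M_bdd D_bdd by (simp_all add: bounded_op_def)

lemma domA_sub: "csubspace domA" and domB_sub: "csubspace domB"
  using A_lin B_lin clinear_on_subspace by blast+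

lemmas dom_mem = cadd_mem[OF domA_sub] cscale_mem[OF domA_sub] cdiff_mem[OF domA_sub] czero_mem[OF domA_sub]
  cadd_mem[OF domB_sub] cscale_mem[OF domB_sub] cdiff_mem[OF domB_sub] czero_mem[OF domB_sub]

lemmas lin_simps = clinear_on_simps[OF A_lin] clinear_on_simps[OF B_lin]
  clinear_on_simps[OF \<Lambda>_lin] clinear_on_simps[OF \<Gamma>_lin]
  clinear_on_simps[OF M_lin, simplified] clinear_on_simps[OF D_lin, simplified]

lemma \<Lambda>_mem [simp]: "x \<in> domA \<Longrightarrow> \<Lambda> x \<in> hs_set E" and \<Gamma>_mem [simp]: "y \<in> domB \<Longrightarrow> \<Gamma> y \<in> hs_set E"
  using \<Lambda>_surj \<Gamma>_surj by auto

lemma A_lower: obtains k where "k > 0" "\<And>x. x \<in> domA \<Longrightarrow> X.nrm x \<le> k * Y.nrm (A x)"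
proof -
  obtain c where c: "c > 0" "\<And>x. x \<in> domA \<Longrightarrow> c * X.nrm x \<le> Y.nrm (A x)"
    using A_below by blast
  then show ?thesis
    by (intro that[of "1 / c"]) (auto simp: field_simps)
qed

lemma D_bounded: obtains k where "k \<ge> 0" "\<And>x. X.nrm (D x) \<le> k * X.nrm x"
proof -
  obtain K where K: "\<And>x. X.nrm (D x) \<le> K * X.nrm x"
    using D_bdd by (auto simp: bounded_op_def)
  \<comment> \<open>\<open>bounded_op\<close> leaves the sign of its constant open.\<close>
  have "X.nrm (D x) \<le> max K 0 * X.nrm x" for x
    using K[of x] by (smt (verit) X.nrm_ge0 X_UNIV UNIV_I mult_right_mono)
  then show ?thesis using that[of "max K 0"] by simp
qed

lemma M_bounded: obtains k where "k > 0" "\<And>x. X.nrm (M x) \<le> k * X.nrm x"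
proof -
  obtain K where K: "\<And>x. X.nrm (M x) \<le> K * X.nrm x"
    using M_bdd by (auto simp: bounded_op_def)
  have "X.nrm (M x) \<le> max K 1 * X.nrm x" for x
    using K[of x] by (smt (verit) X.nrm_ge0 X_UNIV UNIV_I mult_right_mono)
  then show ?thesis using that[of "max K 1"] by simp
qed

text \<open>\<open>inv M\<close> in the weighted inner product is a genuine inverse only after this.
  Uniform positivity is coercivity of the form \<open>X.ip (M w) x\<close>, so surjectivity is an
  instance of Lax-Milgram.\<close>

lemma M_bij: "bij M"
proof (rule bijI)
  obtain \<delta> where \<delta>: "\<delta> > 0" "\<And>x. Re (X.ip (M x) x) \<ge> \<delta> * (X.nrm x)\<^sup>2"
    using M_pos by blast
  show "inj M"
  proof (rule injI)
    fix x y assume "M x = M y"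
    then have "M (x - y) = 0" by (simp add: lin_simps)
    then have "\<delta> * (X.nrm (x - y))\<^sup>2 \<le> 0"
      using \<delta>(2)[of "x - y"] by (simp add: X.ip_zero_left)
    then have "(X.nrm (x - y))\<^sup>2 \<le> 0"
      using \<delta>(1) by (simp add: mult_le_0_iff)
    then show "x = y" using X.nrm_eq0[of "x - y"] by simp
  qed
  obtain k where k: "k > 0" "\<And>x. X.nrm (M x) \<le> k * X.nrm x"
    by (rule M_bounded) (rule that)
  show "surj M"
    unfolding surj_def
  proof
    fix y
    have "\<exists>w\<in>X.car. \<forall>x\<in>X.car. X.ip (M w) x = X.ip y x"
    proof (rule X.lax_milgram[where a = "\<lambda>w x. X.ip (M w) x" and l = "\<lambda>x. X.ip y x"
          and \<alpha> = \<delta> and C = k and K = "X.nrm y"])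
      show "cmod (X.ip (M w) x) \<le> k * X.nrm w * X.nrm x" for w x
        using X.cauchy_schwarz[of "M w" x] k(2)[of w] X.nrm_ge0[of x]
        by (smt (verit, best) X_UNIV UNIV_I mult_right_mono)
      show "cmod (X.ip y x) \<le> X.nrm y * X.nrm x" for x
        using X.cauchy_schwarz by simp
    qed (use \<delta> in \<open>simp_all add: lin_simps X.ip_simps\<close>)
    then obtain w where w: "\<And>x. X.ip (M w) x = X.ip y x" by auto
    have "M w - y = 0"
      using X.ip_eq0[of "M w - y"] w by (simp add: X.ip_diff_left)
    then show "\<exists>w. y = M w" by (intro exI[of _ w]) simp
  qed
qed

lemma inv_M [simp]: "M (inv M x) = x" "inv M (M x) = x"
  using M_bij by (simp_all add: bij_is_surj surj_f_inv_f bij_is_inj)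

section \<open>The weighted state space and the range of \<open>A\<close>\<close>

definition XM :: "'x hs" where "XM = (UNIV, \<lambda>x x'. X.ip (inv M x) x')"
definition Y1 :: "'y hs" where "Y1 = (A ` domA, Y.ip)"

lemma XM_simps [simp]: "hs_set XM = UNIV" "hs_ip XM x x' = X.ip (inv M x) x'"
  by (simp_all add: XM_def)

lemma Y1_simps [simp]: "hs_set Y1 = A ` domA" "hs_ip Y1 = Y.ip" "hnorm Y1 y = Y.nrm y"
  by (simp_all add: Y1_def hnorm_def)

lemma inv_M_add: "inv M (x + y) = inv M x + inv M y"
  using clinear_on_add[OF M_lin, of "inv M x" "inv M y"] inv_M by (metis UNIV_I)

lemma inv_M_scale: "inv M (c *\<^sub>C x) = c *\<^sub>C inv M x"
  using clinear_on_scale[OF M_lin, of "inv M x" c] inv_M by (metis UNIV_I)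

lemma inv_M_zero: "inv M 0 = 0"
  using inv_M_scale[of 0 0] by simp

lemma ip_inv_M: "X.ip (inv M x) (M y) = X.ip x y"
  using M_sa[of "inv M x" y] by simp

text \<open>The squared weighted norm of \<open>M w\<close> is \<open>Re (X.ip w (M w))\<close>, so
  uniform positivity reads as a lower bound.\<close>

lemma M_lower: obtains c where "c > 0" "\<And>w. c * X.nrm w \<le> hnorm XM (M w)"
proof -
  obtain \<delta> where \<delta>: "\<delta> > 0" "\<And>x. Re (X.ip (M x) x) \<ge> \<delta> * (X.nrm x)\<^sup>2"
    using M_pos by blast
  have "sqrt \<delta> * X.nrm w \<le> hnorm XM (M w)" for w
  proof -
    have "sqrt \<delta> * X.nrm w = sqrt (\<delta> * (X.nrm w)\<^sup>2)"
      by (simp add: real_sqrt_mult)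
    also have "\<dots> \<le> sqrt (Re (X.ip w (M w)))"
      using \<delta>(2)[of w] M_sa[of w w] by simp
    also have "\<dots> = hnorm XM (M w)"
      by (simp add: hnorm_def)
    finally show ?thesis .
  qed
  with \<delta> show ?thesis
    by (intro that[of "sqrt \<delta>"]) auto
qed

lemma XM_inner: "inner_on XM"
  unfolding inner_on_def
proof (intro conjI ballI allI impI)
  obtain c where c: "c > 0" "\<And>w. c * X.nrm w \<le> hnorm XM (M w)"
    by (rule M_lower) (rule that)
  obtain \<delta> where \<delta>: "\<delta> > 0" "\<And>x. Re (X.ip (M x) x) \<ge> \<delta> * (X.nrm x)\<^sup>2"
    using M_pos by blast
  show "csubspace (hs_set XM)" by simp
  fix x y z k
  have "X.ip (inv M x) x = X.ip (inv M x) (M (inv M x))" by simp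
  also have "Re \<dots> \<ge> 0"
    using \<delta>(2)[of "inv M x"] \<delta>(1) M_sa[of "inv M x" "inv M x"] by (simp add: order_trans[rotated])
  finally show "0 \<le> Re (hs_ip XM x x)" by simp
  show "x = 0" if "hs_ip XM x x = 0"
  proof -
    have "hnorm XM (M (inv M x)) = 0"
      unfolding hnorm_def inv_M that by simp
    then have "c * X.nrm (inv M x) \<le> 0"
      using c(2)[of "inv M x"] by simp
    then have "inv M x = 0"
      using c(1) X.nrm_eq0[of "inv M x"] X.nrm_ge0[of "inv M x"] by (simp add: mult_le_0_iff order_antisym)
    then have "x = M 0" using inv_M(1)[of x] by simp
    then show ?thesis by (simp add: lin_simps)
  qed
  show "hs_ip XM (k *\<^sub>C x) y = k * hs_ip XM x y"
    by (simp add: inv_M_scale X.ip_simps)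
  show "hs_ip XM (x + y) z = hs_ip XM x z + hs_ip XM y z"
    by (simp add: inv_M_add X.ip_simps)
  have "X.ip (inv M y) x = X.ip (inv M y) (M (inv M x))" by simp
  also have "\<dots> = X.ip y (inv M x)" by (rule ip_inv_M)
  also have "\<dots> = cnj (X.ip (inv M x) y)" by (rule X.ip_commute) auto
  finally show "hs_ip XM y x = cnj (hs_ip XM x y)" by simp
qed

lemma XM_lower: obtains c where "c > 0" "\<And>x. c * X.nrm x \<le> hnorm XM x"
proof -
  obtain c where c: "c > 0" "\<And>w. c * X.nrm w \<le> hnorm XM (M w)"
    by (rule M_lower) (rule that)
  obtain k where k: "k > 0" "\<And>x. X.nrm (M x) \<le> k * X.nrm x"
    by (rule M_bounded) (rule that)
  have "c / k * X.nrm x \<le> hnorm XM x" for x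
  proof -
    have "c / k * X.nrm x \<le> c / k * (k * X.nrm (inv M x))"
      using c(1) k(1) k(2)[of "inv M x"] by (intro mult_left_mono) auto
    also have "\<dots> \<le> hnorm XM x"
      using c(2)[of "inv M x"] k(1) by simp
    finally show ?thesis .
  qed
  then show ?thesis
    using c k by (intro that[of "c / k"]) auto
qed

text \<open>Completeness is inherited through equivalence of norms. The upper bound rests on
  \<open>X.nrm (inv M x) \<le> X.nrm x / \<delta>\<close>, which is positivity tested at
  \<open>inv M x\<close>.\<close>

lemma hil_XM: "hil XM"
proof -
  obtain c where c: "c > 0" "\<And>x. c * X.nrm x \<le> hnorm XM x"
    by (rule XM_lower) (rule that)
  obtain \<delta> where \<delta>: "\<delta> > 0" "\<And>x. Re (X.ip (M x) x) \<ge> \<delta> * (X.nrm x)\<^sup>2"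
    using M_pos by blast
  have "hnorm XM x \<le> sqrt (1 / \<delta>) * X.nrm x" for x
  proof -
    define w where "w = inv M x"
    have x: "x = M w" by (simp add: w_def)
    have "\<delta> * (X.nrm w)\<^sup>2 \<le> X.nrm x * X.nrm w"
      using \<delta>(2)[of w] X.Re_ip_le[of x w] by (simp add: x)
    then have "\<delta> * X.nrm w * X.nrm w \<le> X.nrm x * X.nrm w"
      by (simp add: power2_eq_square mult.assoc)
    then have "\<delta> * X.nrm w \<le> X.nrm x"
      using X.nrm_ge0[of w] X.nrm_ge0[of x]
      by (cases "X.nrm w = 0") (auto intro: mult_right_le_imp_le simp: order.strict_iff_order)
    then have "X.nrm w \<le> X.nrm x / \<delta>"
      using \<delta>(1) by (simp add: field_simps)
    then have "X.nrm w * X.nrm x \<le> (X.nrm x / \<delta>) * X.nrm x"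
      by (intro mult_right_mono) auto
    then have "Re (X.ip w x) \<le> 1 / \<delta> * (X.nrm x)\<^sup>2"
      using X.Re_ip_le[of w x] by (simp add: power2_eq_square)
    then have "sqrt (Re (X.ip w x)) \<le> sqrt (1 / \<delta> * (X.nrm x)\<^sup>2)"
      by (rule real_sqrt_le_mono)
    moreover have "hnorm XM x = sqrt (Re (X.ip w x))"
      by (simp add: hnorm_def w_def)
    ultimately show ?thesis
      by (simp add: real_sqrt_mult real_sqrt_divide)
  qed
  then show ?thesis
    using c by (intro X.hil_equivalent[OF XM_inner]) auto
qed

text \<open>The range is closed: as \<open>A\<close> is bounded below, preimages of a Cauchy
  sequence are Cauchy, and closedness of \<open>A\<close> identifies the limit.\<close>

lemma hil_Y1: "hil Y1"
  unfolding Y1_def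
proof (rule hil_closed_subspace[OF Y.hil_axioms])
  show "csubspace (A ` domA)"
    by (rule csubspace_image[OF A_lin])
next
  fix Z z assume Z: "\<And>n. Z n \<in> A ` domA" and z: "hconv Y Z z"
  then have "\<forall>n. \<exists>x\<in>domA. Z n = A x" by blast
  then obtain x where x: "\<And>n. x n \<in> domA" "\<And>n. Z n = A (x n)" by metis
  obtain k where k: "k > 0" "\<And>x. x \<in> domA \<Longrightarrow> X.nrm x \<le> k * Y.nrm (A x)"
    by (rule A_lower) (rule that)
  have "hcauchy Y Z"
    using z Y.hconv_hcauchy by simp
  have "hcauchy X x"
    unfolding hcauchy_def
  proof (intro allI impI)
    fix e :: real assume "e > 0"
    then obtain N where N: "\<forall>m\<ge>N. \<forall>n\<ge>N. Y.nrm (Z m - Z n) < e / k"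
      using \<open>hcauchy Y Z\<close> k(1) unfolding hcauchy_def by (meson divide_pos_pos)
    have "X.nrm (x m - x n) < e" if "m \<ge> N" "n \<ge> N" for m n
    proof -
      have "X.nrm (x m - x n) \<le> k * Y.nrm (Z m - Z n)"
        using k(2)[of "x m - x n"] x by (simp add: lin_simps dom_mem)
      also have "\<dots> < k * (e / k)"
        using N that k(1) by (intro mult_strict_left_mono) auto
      finally show ?thesis using k(1) by simp
    qed
    then show "\<exists>N. \<forall>m\<ge>N. \<forall>n\<ge>N. X.nrm (x m - x n) < e" by blast
  qed
  then obtain x' where "hconv X x x'"
    using X.complete[of x] by auto
  moreover have "Z = (\<lambda>n. A (x n))" using x(2) by blast
  then have "hconv Y (\<lambda>n. A (x n)) z" using z by simp
  ultimately have "x' \<in> domA \<and> A x' = z"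
    using A_closed x(1) unfolding closed_op_def by (metis UNIV_I X_UNIV Y_UNIV)
  then show "z \<in> A ` domA" by blast
qed simp

text \<open>The space X_h of the theorem, and the form domain of the Robin problem. It is complete
  because \<open>A\<close> maps it isometrically onto \<open>Y1\<close>.\<close>

definition XA :: "'x hs" where "XA = (domA, \<lambda>x y. Y.ip (A x) (A y))"

lemma XA_simps [simp]: "hs_set XA = domA" "hs_ip XA x y = Y.ip (A x) (A y)" "hnorm XA x = Y.nrm (A x)"
  by (simp_all add: XA_def hnorm_def)

lemma hil_XA: "hil XA"
proof
  interpret Y1: hil Y1 by (rule hil_Y1)
  show "inner_on XA"
    unfolding inner_on_def
  proof (intro conjI ballI allI impI)
    show "csubspace (hs_set XA)" using domA_sub by simp
    fix x y z c assume x: "x \<in> hs_set XA"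
    show "0 \<le> Re (hs_ip XA x x)" using Y.ip_ge0 by simp
    show "x = 0" if "hs_ip XA x x = 0"
    proof -
      obtain k where k: "k > 0" "\<And>x. x \<in> domA \<Longrightarrow> X.nrm x \<le> k * Y.nrm (A x)"
        by (rule A_lower) (rule that)
      have "A x = 0" using that Y.ip_eq0 by simp
      then have "X.nrm x \<le> 0" using k(2)[of x] x by simp
      then show ?thesis using X.nrm_eq0[of x] X.nrm_ge0[of x] by (simp add: order_antisym)
    qed
    show "hs_ip XA (c *\<^sub>C x) y = c * hs_ip XA x y"
      using x by (simp add: lin_simps Y.ip_simps)
    show "hs_ip XA y x = cnj (hs_ip XA x y)"
      using Y.ip_commute[of "A x" "A y"] by simp
    show "hs_ip XA (x + y) z = hs_ip XA x z + hs_ip XA y z" if "y \<in> hs_set XA"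
      using x that by (simp add: lin_simps Y.ip_simps)
  qed
  fix Z assume "\<And>n. Z n \<in> hs_set XA" and c: "hcauchy XA Z"
  then have Z: "Z n \<in> domA" for n by simp
  have "hcauchy Y1 (\<lambda>n. A (Z n))"
    using c Z unfolding hcauchy_def by (simp add: lin_simps)
  then obtain y where "y \<in> A ` domA" "hconv Y1 (\<lambda>n. A (Z n)) y"
    using Y1.complete[of "\<lambda>n. A (Z n)"] Z by auto
  then obtain x where x: "x \<in> domA" "hconv Y1 (\<lambda>n. A (Z n)) (A x)" by blast
  then have "hconv XA Z x"
    using Z by (simp add: hconv_def lin_simps)
  then show "\<exists>x\<in>hs_set XA. hconv XA Z x"
    using x by auto
qed

section \<open>Boundedness of the traces in the graph norms\<close>

lemma green_bound:
  assumes "x \<in> domA" "y \<in> domB"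
  shows "cmod (E.ip (\<Gamma> y) (\<Lambda> x)) \<le> (X.nrm (B y) + Y.nrm y) * (X.nrm x + Y.nrm (A x))"
    "cmod (E.ip (\<Gamma> y) (\<Lambda> x)) \<le> (X.nrm x + Y.nrm (A x)) * (Y.nrm y + X.nrm (B y))"
proof -
  have "cmod (E.ip (\<Gamma> y) (\<Lambda> x)) \<le> cmod (X.ip (B y) x) + cmod (Y.ip y (A x))"
    unfolding green[OF assms(2,1), symmetric] using norm_triangle_ineq4[of "- X.ip (B y) x" "Y.ip y (A x)"] by simp
  also have "\<dots> \<le> X.nrm (B y) * X.nrm x + Y.nrm y * Y.nrm (A x)"
    by (intro add_mono X.cauchy_schwarz Y.cauchy_schwarz) auto
  also have "\<dots> \<le> (X.nrm (B y) + Y.nrm y) * (X.nrm x + Y.nrm (A x))"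
    using X.nrm_ge0[of "B y"] X.nrm_ge0[of x] Y.nrm_ge0[of y] Y.nrm_ge0[of "A x"]
    by (simp add: algebra_simps)
  finally show "cmod (E.ip (\<Gamma> y) (\<Lambda> x)) \<le> (X.nrm (B y) + Y.nrm y) * (X.nrm x + Y.nrm (A x))" .
  then show "cmod (E.ip (\<Gamma> y) (\<Lambda> x)) \<le> (X.nrm x + Y.nrm (A x)) * (Y.nrm y + X.nrm (B y))"
    by (simp add: algebra_simps)
qed

text \<open>Surjectivity of the other trace enters here: every \<open>g\<close> in \<open>E\<close>
  is some \<open>\<Gamma> y\<close>, so Green's identity bounds \<open>E.ip (\<Lambda> x) g\<close>
  by a multiple of the graph norm of \<open>x\<close>. The bound for \<open>\<Gamma>\<close> is the
  mirror image.\<close>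

lemma \<Lambda>_bounded: "\<exists>C\<ge>0. \<forall>x\<in>domA. E.nrm (\<Lambda> x) \<le> C * (X.nrm x + Y.nrm (A x))"
proof (rule E.bounded_if_weakly_bounded[OF \<Lambda>_lin])
  fix g assume g: "g \<in> E.car"
  then have "g \<in> \<Gamma> ` domB" by (simp only: \<Gamma>_surj)
  then obtain y where y: "y \<in> domB" "g = \<Gamma> y" by (rule imageE)
  have "cmod (E.ip (\<Lambda> x) g) \<le> (X.nrm (B y) + Y.nrm y) * (X.nrm x + Y.nrm (A x))" if "x \<in> domA" for x
    using green_bound(1)[OF that y(1)] E.ip_commute[OF g \<Lambda>_mem[OF that]] y(2) by simp
  then show "\<exists>K\<ge>0. \<forall>x\<in>domA. cmod (E.ip (\<Lambda> x) g) \<le> K * (X.nrm x + Y.nrm (A x))"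
    by (intro exI[of _ "X.nrm (B y) + Y.nrm y"]) simp
next
  fix x assume "X.nrm x + Y.nrm (A x) = 0"
  then show "x = 0"
    using X.nrm_eq0[of x] X.nrm_ge0[of x] Y.nrm_ge0[of "A x"] by (simp add: add_nonneg_eq_0_iff)
qed (auto simp: lin_simps X.nrm_scale Y.nrm_scale algebra_simps)

lemma \<Gamma>_bounded: "\<exists>C\<ge>0. \<forall>y\<in>domB. E.nrm (\<Gamma> y) \<le> C * (Y.nrm y + X.nrm (B y))"
proof (rule E.bounded_if_weakly_bounded[OF \<Gamma>_lin])
  fix g assume "g \<in> E.car"
  then have "g \<in> \<Lambda> ` domA" by (simp only: \<Lambda>_surj)
  then obtain x where x: "x \<in> domA" "g = \<Lambda> x" by (rule imageE)
  have "cmod (E.ip (\<Gamma> y) g) \<le> (X.nrm x + Y.nrm (A x)) * (Y.nrm y + X.nrm (B y))" if "y \<in> domB" for y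
    using green_bound(2)[OF x(1) that] x by simp
  then show "\<exists>K\<ge>0. \<forall>y\<in>domB. cmod (E.ip (\<Gamma> y) g) \<le> K * (Y.nrm y + X.nrm (B y))"
    by (intro exI[of _ "X.nrm x + Y.nrm (A x)"]) simp
next
  fix y assume "Y.nrm y + X.nrm (B y) = 0"
  then show "y = 0"
    using Y.nrm_eq0[of y] Y.nrm_ge0[of y] X.nrm_ge0[of "B y"] by (simp add: add_nonneg_eq_0_iff)
qed (auto simp: lin_simps X.nrm_scale Y.nrm_scale algebra_simps)

text \<open>Origin of the form: eliminate \<open>v\<close> through
  \<open>l *\<^sub>r v - A w = f\<close>, pair \<open>l *\<^sub>r M w - (B v - D w) = g\<close> with
  \<open>x\<close>, and replace \<open>X.ip (B v) x\<close> by Green's identity with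
  \<open>\<Gamma> v = \<Lambda> w - e\<close>. The term with \<open>1 / l\<close> alone is coercive
  on the form domain; the other three have nonnegative real part at \<open>x = w\<close>.\<close>

lemma weak_solution:
  assumes "l > 0" and e: "e \<in> E.car"
  shows "\<exists>w\<in>domA. \<forall>x\<in>domA.
    complex_of_real l * X.ip (M w) x + X.ip (D w) x + complex_of_real (1 / l) * Y.ip (A w) (A x) + E.ip (\<Lambda> w) (\<Lambda> x)
    = X.ip g x - complex_of_real (1 / l) * Y.ip f (A x) + E.ip e (\<Lambda> x)"
proof -
  interpret XA: hil XA by (rule hil_XA)
  define a where "a w x = complex_of_real l * X.ip (M w) x + X.ip (D w) x +
    complex_of_real (1 / l) * Y.ip (A w) (A x) + E.ip (\<Lambda> w) (\<Lambda> x)" for w x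
  define r where "r x = X.ip g x - complex_of_real (1 / l) * Y.ip f (A x) + E.ip e (\<Lambda> x)" for x
  obtain k where k: "k > 0" "\<And>x. x \<in> domA \<Longrightarrow> X.nrm x \<le> k * Y.nrm (A x)"
    by (rule A_lower) (rule that)
  obtain kM where kM: "kM > 0" "\<And>x. X.nrm (M x) \<le> kM * X.nrm x"
    by (rule M_bounded) (rule that)
  obtain kD where kD: "kD \<ge> 0" "\<And>x. X.nrm (D x) \<le> kD * X.nrm x"
    by (rule D_bounded) (rule that)
  obtain c where c: "c \<ge> 0" "\<And>x. x \<in> domA \<Longrightarrow> E.nrm (\<Lambda> x) \<le> c * (X.nrm x + Y.nrm (A x))"
    using \<Lambda>_bounded by blast
  \<comment> \<open>As \<open>A\<close> is bounded below, the graph norm is at most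
    \<open>k + 1\<close> times \<open>Y.nrm (A x)\<close>; \<open>c'\<close> is the trace bound in
    that norm.\<close>
  define c' where "c' = c * (k + 1)"
  have c': "c' \<ge> 0" "E.nrm (\<Lambda> x) \<le> c' * Y.nrm (A x)" if "x \<in> domA" for x
  proof -
    show "c' \<ge> 0" using c k by (simp add: c'_def)
    have "E.nrm (\<Lambda> x) \<le> c * (k * Y.nrm (A x) + Y.nrm (A x))"
      using c(2)[OF that] k(2)[OF that] c(1) by (smt (verit) mult_left_mono)
    then show "E.nrm (\<Lambda> x) \<le> c' * Y.nrm (A x)" by (simp add: c'_def algebra_simps)
  qed
  have "\<exists>w\<in>hs_set XA. \<forall>x\<in>hs_set XA. a w x = r x"
  proof (rule XA.lax_milgram[where \<alpha> = "1 / l" and C = "l * kM * k\<^sup>2 + kD * k\<^sup>2 + 1 / l + c'\<^sup>2"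
        and K = "X.nrm g * k + 1 / l * Y.nrm f + E.nrm e * c'"])
    fix w x assume "w \<in> hs_set XA" "x \<in> hs_set XA"
    then have wx: "w \<in> domA" "x \<in> domA" by auto
    have XX: "X.nrm w * X.nrm x \<le> (k * Y.nrm (A w)) * (k * Y.nrm (A x))"
      using wx k by (intro mult_mono) auto
    have "cmod (X.ip (M w) x) \<le> kM * X.nrm w * X.nrm x"
      using X.cauchy_schwarz[of "M w" x] kM(2)[of w] X.nrm_ge0[of x] by (smt (verit, best) X_UNIV UNIV_I mult_right_mono)
    also have "\<dots> \<le> kM * ((k * Y.nrm (A w)) * (k * Y.nrm (A x)))"
      using XX kM(1) by (simp add: mult.assoc)
    finally have 1: "cmod (complex_of_real l * X.ip (M w) x) \<le> l * (kM * ((k * Y.nrm (A w)) * (k * Y.nrm (A x))))"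
      using \<open>l > 0\<close> by (simp add: norm_mult)
    have "cmod (X.ip (D w) x) \<le> kD * X.nrm w * X.nrm x"
      using X.cauchy_schwarz[of "D w" x] kD(2)[of w] X.nrm_ge0[of x] by (smt (verit, best) X_UNIV UNIV_I mult_right_mono)
    also have "\<dots> \<le> kD * ((k * Y.nrm (A w)) * (k * Y.nrm (A x)))"
      using XX kD(1) by (simp add: mult.assoc mult_left_mono)
    finally have 2: "cmod (X.ip (D w) x) \<le> kD * ((k * Y.nrm (A w)) * (k * Y.nrm (A x)))" .
    have 3: "cmod (complex_of_real (1 / l) * Y.ip (A w) (A x)) \<le> 1 / l * (Y.nrm (A w) * Y.nrm (A x))"
      using Y.cauchy_schwarz[of "A w" "A x"] \<open>l > 0\<close> by (simp add: norm_mult norm_divide divide_right_mono)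
    have "cmod (E.ip (\<Lambda> w) (\<Lambda> x)) \<le> E.nrm (\<Lambda> w) * E.nrm (\<Lambda> x)"
      using wx by (intro E.cauchy_schwarz) auto
    also have "\<dots> \<le> (c' * Y.nrm (A w)) * (c' * Y.nrm (A x))"
      using wx c' by (intro mult_mono) auto
    finally have 4: "cmod (E.ip (\<Lambda> w) (\<Lambda> x)) \<le> (c' * Y.nrm (A w)) * (c' * Y.nrm (A x))" .
    have "cmod (a w x) \<le> cmod (complex_of_real l * X.ip (M w) x) + cmod (X.ip (D w) x) +
        cmod (complex_of_real (1 / l) * Y.ip (A w) (A x)) + cmod (E.ip (\<Lambda> w) (\<Lambda> x))"
      unfolding a_def by (intro order_trans[OF norm_triangle_ineq] add_right_mono order_refl)
    also have "\<dots> \<le> l * (kM * ((k * Y.nrm (A w)) * (k * Y.nrm (A x)))) + kD * ((k * Y.nrm (A w)) * (k * Y.nrm (A x)))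
        + 1 / l * (Y.nrm (A w) * Y.nrm (A x)) + (c' * Y.nrm (A w)) * (c' * Y.nrm (A x))"
      by (intro add_mono 1 2 3 4)
    also have "\<dots> = (l * kM * k\<^sup>2 + kD * k\<^sup>2 + 1 / l + c'\<^sup>2) * hnorm XA w * hnorm XA x"
      by (simp add: power2_eq_square algebra_simps)
    finally show "cmod (a w x) \<le> (l * kM * k\<^sup>2 + kD * k\<^sup>2 + 1 / l + c'\<^sup>2) * hnorm XA w * hnorm XA x" .
  next
    fix w assume "w \<in> hs_set XA"
    then have w: "w \<in> domA" by simp
    have "0 \<le> Re (X.ip (M w) w)"
      using M_pos by (smt (verit, best) mult_nonneg_nonneg zero_le_power2)
    then show "1 / l * (hnorm XA w)\<^sup>2 \<le> Re (a w w)"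
      using w \<open>l > 0\<close> D_diss[of w] E.ip_ge0[of "\<Lambda> w"]
      by (simp add: a_def Y.nrm_sq)
  next
    fix x assume "x \<in> hs_set XA"
    then have x: "x \<in> domA" by simp
    have "cmod (X.ip g x) \<le> X.nrm g * (k * Y.nrm (A x))"
      using k(2)[OF x] by (intro order_trans[OF X.cauchy_schwarz] mult_left_mono) auto
    moreover have "cmod (complex_of_real (1 / l) * Y.ip f (A x)) \<le> 1 / l * (Y.nrm f * Y.nrm (A x))"
      using Y.cauchy_schwarz[of f "A x"] \<open>l > 0\<close> by (simp add: norm_mult norm_divide divide_right_mono)
    moreover have "cmod (E.ip e (\<Lambda> x)) \<le> E.nrm e * (c' * Y.nrm (A x))"
      using c'[OF x] e x by (intro order_trans[OF E.cauchy_schwarz] mult_left_mono) auto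
    moreover have "cmod (r x) \<le> cmod (X.ip g x) + cmod (complex_of_real (1 / l) * Y.ip f (A x)) + cmod (E.ip e (\<Lambda> x))"
      unfolding r_def by (intro order_trans[OF norm_triangle_ineq] add_right_mono norm_triangle_ineq4)
    ultimately show "cmod (r x) \<le> (X.nrm g * k + 1 / l * Y.nrm f + E.nrm e * c') * hnorm XA x"
      by (simp add: algebra_simps)
  qed (use \<open>l > 0\<close> e in \<open>auto simp: a_def r_def lin_simps X.ip_simps Y.ip_simps E.ip_simps algebra_simps\<close>)
  then show ?thesis
    by (auto simp: a_def r_def)
qed

text \<open>A weak solution has \<open>v\<close> in \<open>dom B\<close>: subtracting some \<open>y\<close> in \<open>dom B\<close> with the right
  boundary values leaves an element of \<open>dom A*\<close>.\<close>

lemma solve: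
  assumes l: "l > 0" and f: "f \<in> A ` domA" and e: "e \<in> E.car"
  shows "\<exists>v w. v \<in> domB \<inter> A ` domA \<and> w \<in> domA \<and> l *\<^sub>r v - A w = f \<and>
    l *\<^sub>r M w - (B v - D w) = g \<and> \<Lambda> w - \<Gamma> v = e"
proof -
  obtain w where w: "w \<in> domA" and weak: "\<And>x. x \<in> domA \<Longrightarrow>
    complex_of_real l * X.ip (M w) x + X.ip (D w) x + complex_of_real (1 / l) * Y.ip (A w) (A x) + E.ip (\<Lambda> w) (\<Lambda> x)
    = X.ip g x - complex_of_real (1 / l) * Y.ip f (A x) + E.ip e (\<Lambda> x)"
    using weak_solution[OF l e, of g f] by blast
  \<comment> \<open>Forced by the first equation; \<open>h\<close> below is the value that the
    second equation forces on \<open>B v\<close>.\<close>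
  define v where "v = (1 / l) *\<^sub>r (f + A w)"
  define h where "h = l *\<^sub>r M w + D w - g"
  obtain y where y: "y \<in> domB" "\<Gamma> y = \<Lambda> w - e"
    using \<Gamma>_surj w e by (metis E.mem(3) \<Lambda>_mem imageE)
  \<comment> \<open>The weak equation minus Green's identity for \<open>y\<close>: the boundary
    terms cancel by the choice of \<open>\<Gamma> y\<close>, and what remains puts
    \<open>v - y\<close> into the domain of the adjoint.\<close>
  have orth: "Y.ip (v - y) (A x) = - X.ip (h - B y) x" if x: "x \<in> domA" for x
  proof -
    have "Y.ip v (A x) = complex_of_real (1 / l) * Y.ip f (A x) + complex_of_real (1 / l) * Y.ip (A w) (A x)"
      unfolding v_def by (simp add: Y.ip_simps distrib_left)
    moreover have "X.ip h x = complex_of_real l * X.ip (M w) x + X.ip (D w) x - X.ip g x"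
      by (simp add: h_def X.ip_simps)
    moreover have "E.ip (\<Lambda> w - e) (\<Lambda> x) = E.ip (\<Lambda> w) (\<Lambda> x) - E.ip e (\<Lambda> x)"
      using w e x by (simp add: E.ip_simps)
    ultimately have "- X.ip h x - Y.ip v (A x) = - X.ip (B y) x - Y.ip y (A x)"
      using weak[OF x] green[OF y(1) x] unfolding y(2) by algebra
    then show ?thesis
      by (simp add: X.ip_simps Y.ip_simps algebra_simps)
  qed
  have "Y.ip (A x) (v - y) = X.ip x (- (h - B y))" if x: "x \<in> domA" for x
  proof -
    have "Y.ip (A x) (v - y) = cnj (Y.ip (v - y) (A x))" by (rule Y.ip_commute) auto
    also have "\<dots> = cnj (X.ip (- (h - B y)) x)" by (simp only: orth[OF x] X.ip_neg_left X_UNIV UNIV_I)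
    also have "\<dots> = X.ip x (- (h - B y))" by (rule X.ip_commute[symmetric]) auto
    finally show ?thesis .
  qed
  then have d: "v - y \<in> domB" "- (h - B y) = - B (v - y)"
    using A_adj unfolding adjoint_subset_neg_def by auto
  then have v: "v \<in> domB" using dom_mem(5)[OF d(1) y(1)] by simp
  have Bv: "B v = h"
    using d(2) v y(1) by (simp add: lin_simps)
  \<comment> \<open>By \<open>orth\<close> the boundary term of \<open>v - y\<close> vanishes
    against every \<open>\<Lambda> x\<close>; as \<open>\<Lambda>\<close> is onto, it can be tested
    against \<open>\<Gamma> (v - y)\<close> itself.\<close>
  obtain x where x: "x \<in> domA" "\<Lambda> x = \<Gamma> (v - y)"
    using \<Lambda>_surj d(1) by (metis \<Gamma>_mem imageE)
  have "E.ip (\<Gamma> (v - y)) (\<Gamma> (v - y)) = - X.ip (B (v - y)) x - Y.ip (v - y) (A x)"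
    using green[OF d(1) x(1)] x(2) by simp
  also have "B (v - y) = h - B y"
    using d(2) by (metis neg_equal_iff_equal)
  also have "- X.ip (h - B y) x - Y.ip (v - y) (A x) = 0"
    by (simp add: orth[OF x(1)])
  finally have "\<Gamma> (v - y) = 0"
    using E.ip_eq0 d(1) by simp
  then have "\<Gamma> v = \<Lambda> w - e"
    using v y by (simp add: lin_simps)
  moreover have "l *\<^sub>r v = f + A w"
    using l by (simp add: v_def flip: of_real_mult)
  \<comment> \<open>\<open>f\<close> in the range of \<open>A\<close> keeps \<open>v\<close> in that
    range, hence in the state space.\<close>
  moreover obtain x0 where x0: "x0 \<in> domA" "f = A x0" using f by blast
  have "v = A ((1 / l) *\<^sub>r (x0 + w))"
    unfolding v_def x0(2) using x0(1) w by (simp add: lin_simps dom_mem)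
  then have "v \<in> A ` domA"
    using x0(1) w dom_mem(1,2) by blast
  ultimately show ?thesis
    using v w Bv by (intro exI[of _ v] exI[of _ w]) (auto simp: h_def)
qed

section \<open>The first-order system on the state space\<close>

abbreviation "V \<equiv> prod_hs Y1 XM"

lemma hil_V: "hil V"
proof -
  interpret hil_prod Y1 XM using hil_Y1 hil_XM by (simp add: hil_prod_def)
  show ?thesis by (rule hil_axioms)
qed

text \<open>The inverse weight cancels against \<open>M w\<close> in the second component; the
  remaining cross terms form Green's identity, and the contribution of \<open>D\<close> has the
  right sign.\<close>

lemma energy:
  assumes "v \<in> domB" "w \<in> domA"
  shows "Re (hs_ip V (A w, B v - D w) (v, M w)) \<le> - Re (E.ip (\<Gamma> v) (\<Lambda> w))"
proof -
  have "Re (hs_ip V (A w, B v - D w) (v, M w)) = Re (Y.ip v (A w)) + Re (X.ip (B v) w) - Re (X.ip (D w) w)"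
    using Y.Re_ip_commute[of v "A w"] by (simp add: ip_inv_M X.ip_simps)
  also have "\<dots> \<le> - Re (- X.ip (B v) w - Y.ip v (A w))"
    using D_diss[of w] by simp
  finally show ?thesis
    unfolding green[OF assms] .
qed

text \<open>The graph norm controls all that the trace bounds ask for: \<open>v\<close> and
  \<open>A w\<close> are components, \<open>w\<close> is recovered from \<open>M w\<close> by
  positivity, and \<open>B v\<close> from \<open>B v - D w\<close> as \<open>D\<close> is bounded.
  Both traces are bounded together because \<open>a\<close> and \<open>b\<close> each mix components
  of \<open>\<Lambda>\<close> and \<open>\<Gamma>\<close>.\<close>

lemma boundary_bounded:
  "\<exists>C\<ge>0. \<forall>v\<in>domB \<inter> A ` domA. \<forall>w\<in>domA.
    E.nrm (\<Lambda> w) + E.nrm (\<Gamma> v) \<le> C * (hnorm V (v, M w) + hnorm V (A w, B v - D w))"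
proof -
  interpret hil_prod Y1 XM using hil_Y1 hil_XM by (simp add: hil_prod_def)
  obtain k1 where k1: "k1 > 0" "\<And>w. k1 * X.nrm w \<le> hnorm XM (M w)"
    by (rule M_lower) (rule that)
  obtain k2 where k2: "k2 > 0" "\<And>x. k2 * X.nrm x \<le> hnorm XM x"
    by (rule XM_lower) (rule that)
  obtain kD where kD: "kD \<ge> 0" "\<And>x. X.nrm (D x) \<le> kD * X.nrm x"
    by (rule D_bounded) (rule that)
  obtain c1 where c1: "c1 \<ge> 0" "\<And>x. x \<in> domA \<Longrightarrow> E.nrm (\<Lambda> x) \<le> c1 * (X.nrm x + Y.nrm (A x))"
    using \<Lambda>_bounded by blast
  obtain c2 where c2: "c2 \<ge> 0" "\<And>y. y \<in> domB \<Longrightarrow> E.nrm (\<Gamma> y) \<le> c2 * (Y.nrm y + X.nrm (B y))"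
    using \<Gamma>_bounded by blast
  define C where "C = c1 * (1 / k1 + 1) + c2 * (1 + 1 / k2 + kD / k1)"
  have C: "C \<ge> 0" using k1 k2 kD c1 c2 by (simp add: C_def)
  have "E.nrm (\<Lambda> w) + E.nrm (\<Gamma> v) \<le> C * (hnorm V (v, M w) + hnorm V (A w, B v - D w))"
    if v: "v \<in> domB" "v \<in> A ` domA" and w: "w \<in> domA" for v w
  proof -
    define p where "p = hnorm V (v, M w)"
    define r where "r = hnorm V (A w, B v - D w)"
    have p: "Y.nrm v \<le> p" "hnorm XM (M w) \<le> p"
      using nrm_prod_bounds[of "(v, M w)"] v by (simp_all add: p_def)
    have r: "Y.nrm (A w) \<le> r" "hnorm XM (B v - D w) \<le> r"
      using nrm_prod_bounds[of "(A w, B v - D w)"] w by (simp_all add: r_def)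
    have p0: "p \<ge> 0" and r0: "r \<ge> 0"
      using order_trans[OF Y.nrm_ge0 p(1)] order_trans[OF Y.nrm_ge0 r(1)] by auto
    have w1: "X.nrm w \<le> p / k1"
      using k1(1) order_trans[OF k1(2) p(2)] by (simp add: field_simps)
    have "X.nrm (B v - D w) \<le> r / k2"
      using k2(1) order_trans[OF k2(2) r(2)] by (simp add: field_simps)
    moreover have "kD * X.nrm w \<le> kD * (p / k1)"
      using w1 kD(1) by (rule mult_left_mono)
    ultimately have "X.nrm (B v) \<le> r / k2 + kD * (p / k1)"
      using X.nrm_triangle[of "B v - D w" "D w"] kD(2)[of w] by simp
    then have g: "E.nrm (\<Gamma> v) \<le> c2 * (p + (r / k2 + kD * (p / k1)))"
      using p(1) by (intro order_trans[OF c2(2)[OF v(1)]] mult_left_mono add_mono c2(1))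
    have "E.nrm (\<Lambda> w) \<le> c1 * (p / k1 + r)"
      using w1 r(1) by (intro order_trans[OF c1(2)[OF w]] mult_left_mono add_mono c1(1))
    also have "\<dots> \<le> c1 * ((1 / k1 + 1) * (p + r))"
      using p0 divide_nonneg_pos[OF r0 k1(1)]
      by (intro mult_left_mono c1(1)) (simp add: algebra_simps add_divide_distrib)
    finally have 1: "E.nrm (\<Lambda> w) \<le> c1 * (1 / k1 + 1) * (p + r)"
      by simp
    have "c2 * (p + (r / k2 + kD * (p / k1))) \<le> c2 * ((1 + 1 / k2 + kD / k1) * (p + r))"
      using r0 divide_nonneg_pos[OF p0 k2(1)] divide_nonneg_pos[OF mult_nonneg_nonneg[OF kD(1) r0] k1(1)]
      by (intro mult_left_mono c2(1)) (simp add: algebra_simps add_divide_distrib)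
    then have 2: "E.nrm (\<Gamma> v) \<le> c2 * (1 + 1 / k2 + kD / k1) * (p + r)"
      using g by simp
    show ?thesis
      using add_mono[OF 1 2] by (simp add: C_def p_def r_def algebra_simps)
  qed
  with C show ?thesis by blast
qed

end

section \<open>The given traces as an instance of the abstract systems\<close>

lemma clinear_on_Pair: "clinear_on D (\<lambda>x. (f x, g x)) \<longleftrightarrow> clinear_on D f \<and> clinear_on D g"
  by (auto simp: clinear_on_def)

lemma clinear_on_compose:
  "clinear_on D f \<Longrightarrow> f ` D \<subseteq> S \<Longrightarrow> clinear_on S g \<Longrightarrow> clinear_on D (\<lambda>x. g (f x))"
  by (auto simp: clinear_on_def image_subset_iff)

lemma clinear_on_uminus: "clinear_on D f \<Longrightarrow> clinear_on D (\<lambda>x. - f x)"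
  by (auto simp: clinear_on_def)

lemma clinear_on_minus: "clinear_on D f \<Longrightarrow> clinear_on D g \<Longrightarrow> clinear_on D (\<lambda>x. f x - g x)"
  by (auto simp: clinear_on_def cvec.scale_right_diff_distrib)

lemma (in hil) clinear_on_riesz: "clinear_on car (riesz H)"
  by (simp add: clinear_on_def car_subspace riesz_add riesz_scale)

lemma (in hil) clinear_on_riesz_inv: "clinear_on (antidual H) (riesz_inv H)"
  by (simp add: clinear_on_def antidual_subspace riesz_inv_add riesz_inv_scale)

lemma mem_domBM_iff:
  assumes "bij M"
  shows "z \<in> domBM domA A domB M \<longleftrightarrow> fst z \<in> domB \<and> fst z \<in> A ` domA \<and> inv M (snd z) \<in> domA"
proof -
  have M: "M (inv M x) = x" "inv M (M x) = x" for x
    using assms by (simp_all add: bij_is_surj surj_f_inv_f bij_is_inj)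
  have "snd z \<in> M ` domA \<longleftrightarrow> inv M (snd z) \<in> domA"
    using M image_eqI[of "snd z" M "inv M (snd z)" domA] by auto
  then show ?thesis
    by (cases z) (auto simp: domBM_def domAM_def image_iff)
qed

theorem theorem3p10:
  fixes ipX :: "'x::cvec \<Rightarrow> 'x \<Rightarrow> complex"
    and ipY :: "'y::cvec \<Rightarrow> 'y \<Rightarrow> complex"
    and ip1 :: "'g1::cvec \<Rightarrow> 'g1 \<Rightarrow> complex"
    and ip2 :: "'g2::cvec \<Rightarrow> 'g2 \<Rightarrow> complex"
    and domA :: "'x set" and A :: "'x \<Rightarrow> 'y"
    and domB :: "'y set" and B :: "'y \<Rightarrow> 'x"
    and \<Lambda>1 :: "'x \<Rightarrow> 'g1" and \<Lambda>2 :: "'x \<Rightarrow> ('g2 \<Rightarrow> complex)"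
    and \<Pi>1 :: "'y \<Rightarrow> ('g1 \<Rightarrow> complex)" and \<Pi>2 :: "'y \<Rightarrow> 'g2"
    and M D :: "'x \<Rightarrow> 'x"
    and P :: "('g1 \<Rightarrow> complex) \<times> ('g2 \<Rightarrow> complex) \<Rightarrow> ('g1 \<Rightarrow> complex) \<times> ('g2 \<Rightarrow> complex)"
  assumes X_hilbert: "hilbert (UNIV, ipX)" and Y_hilbert: "hilbert (UNIV, ipY)"
    and G1_hilbert: "hilbert (UNIV, ip1)" and G2_hilbert: "hilbert (UNIV, ip2)"
    and A_closed: "closed_op (UNIV, ipX) (UNIV, ipY) domA A"
    and A_dense: "dense_in (UNIV, ipX) domA"
    and A_below: "\<exists>c>0. \<forall>x\<in>domA. hnorm (UNIV, ipY) (A x) \<ge> c * hnorm (UNIV, ipX) x"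
    and B_closed: "closed_op (UNIV, ipY) (UNIV, ipX) domB B"
    and B_dense: "dense_in (UNIV, ipY) domB"
    and A_adj: "adjoint_subset_neg (UNIV, ipX) (UNIV, ipY) domA A domB B"
    and \<Lambda>_lin: "clinear_on domA (\<lambda>x. (\<Lambda>1 x, \<Lambda>2 x))"
    and \<Lambda>_surj: "(\<lambda>x. (\<Lambda>1 x, \<Lambda>2 x)) ` domA = UNIV \<times> antidual (UNIV, ip2)"
    and \<Pi>_lin: "clinear_on domB (\<lambda>y. (\<Pi>1 y, \<Pi>2 y))"
    and \<Pi>_surj: "(\<lambda>y. (\<Pi>1 y, \<Pi>2 y)) ` domB = antidual (UNIV, ip1) \<times> UNIV"
    and green: "\<forall>y\<in>domB. \<forall>x\<in>domA.
        - ipX (B y) x - ipY y (A x) = \<Pi>1 y (\<Lambda>1 x) - cnj (\<Lambda>2 x (\<Pi>2 y))"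
    and M_bdd: "bounded_op (UNIV, ipX) (UNIV, ipX) M"
    and M_sa: "\<forall>x x'. ipX (M x) x' = ipX x (M x')"
    and M_pos: "\<exists>\<delta>>0. \<forall>x. Re (ipX (M x) x) \<ge> \<delta> * (hnorm (UNIV, ipX) x)\<^sup>2"
    and D_bdd: "bounded_op (UNIV, ipX) (UNIV, ipX) D"
    and D_diss: "\<forall>x. Re (ipX (D x) x) \<ge> 0"
    and P_bdd: "bounded_op (Gstar_hs ip1 ip2) (Gstar_hs ip1 ip2) P"
    and P_contr: "\<forall>\<phi>\<in>hs_set (Gstar_hs ip1 ip2). hnorm (Gstar_hs ip1 ip2) (P \<phi>) \<le> hnorm (Gstar_hs ip1 ip2) \<phi>"
  shows "internally_well_posed (Gstar_hs ip1 ip2) (prod_hs (Y1_hs ipY domA A) (XM_hs ipX M))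
           (Gstar_hs ip1 ip2) (domBM domA A domB M)
           (Gin ip1 ip2 \<Lambda>1 \<Lambda>2 \<Pi>1 \<Pi>2 M P) (BM A B D M) (Kout ip1 ip2 \<Lambda>1 \<Lambda>2 \<Pi>1 \<Pi>2 M P)
       \<and> impedance_passive (Gstar_hs ip1 ip2) (prod_hs (Y1_hs ipY domA A) (XM_hs ipX M))
           (domBM domA A domB M)
           (Gin ip1 ip2 \<Lambda>1 \<Lambda>2 \<Pi>1 \<Pi>2 M P) (BM A B D M) (Kout ip1 ip2 \<Lambda>1 \<Lambda>2 \<Pi>1 \<Pi>2 M P)"
proof -
  let ?X = "(UNIV, ipX)" and ?Y = "(UNIV, ipY)" and ?H1 = "(UNIV, ip1)" and ?H2 = "(UNIV, ip2)"
  interpret H1: hil ?H1 using G1_hilbert by (simp add: hilbert_iff_hil)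
  interpret H2: hil ?H2 using G2_hilbert by (simp add: hilbert_iff_hil)
  interpret D1: hil "dual_hs ?H1" by (rule H1.hil_dual)
  interpret D2: hil "dual_hs ?H2" by (rule H2.hil_dual)
  interpret E: hil_prod ?H1 "dual_hs ?H2" by unfold_locales
  interpret U: hil_prod "dual_hs ?H1" "dual_hs ?H2" by unfold_locales
  let ?E = "prod_hs ?H1 (dual_hs ?H2)" and ?U = "prod_hs (dual_hs ?H1) (dual_hs ?H2)"
  let ?R1 = "riesz ?H1" and ?R2 = "riesz ?H2" and ?S1 = "riesz_inv ?H1" and ?S2 = "riesz_inv ?H2"
  define \<Lambda> where "\<Lambda> x = (\<Lambda>1 x, \<Lambda>2 x)" for x
  \<comment> \<open>The Riesz maps and a sign bring both pairings of Green's identity into one inner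
    product: the first becomes the inner product of \<open>G1\<close>, the second, with its minus
    sign, that of the anti-dual of \<open>G2\<close>.\<close>
  define \<Gamma> where "\<Gamma> y = (?S1 (\<Pi>1 y), - ?R2 (\<Pi>2 y))" for y
  have \<Lambda>12_lin: "clinear_on domA \<Lambda>1" "clinear_on domA \<Lambda>2"
    using \<Lambda>_lin by (simp_all add: clinear_on_Pair)
  have \<Pi>12_lin: "clinear_on domB \<Pi>1" "clinear_on domB \<Pi>2"
    using \<Pi>_lin by (simp_all add: clinear_on_Pair)
  have \<Lambda>2_mem: "\<Lambda>2 x \<in> antidual ?H2" if "x \<in> domA" for x
    using \<Lambda>_surj that by (auto dest: equalityD1)
  have \<Pi>1_mem: "\<Pi>1 y \<in> antidual ?H1" if "y \<in> domB" for y
    using \<Pi>_surj that by (auto dest: equalityD1)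
  have R_mem: "?R1 h \<in> antidual ?H1" "?R2 k \<in> antidual ?H2" for h k
    by (simp_all add: H1.riesz_antidual H2.riesz_antidual)
  have S1_neg: "?S1 (- \<phi>) = - ?S1 \<phi>" if "\<phi> \<in> antidual ?H1" for \<phi>
    using that H1.riesz_inv_scale[of \<phi> "-1"] by simp
  have S2_neg: "?S2 (- \<psi>) = - ?S2 \<psi>" if "\<psi> \<in> antidual ?H2" for \<psi>
    using that H2.riesz_inv_scale[of \<psi> "-1"] by simp
  have SR: "?S1 (?R1 h) = h" "?S2 (?R2 k) = k" for h k
    by (simp_all add: H1.riesz_inv_riesz H2.riesz_inv_riesz)

  interpret W: wave_system ?X ?Y ?E domA A domB B \<Lambda> \<Gamma> M D
  proof (intro wave_system.intro wave_system_axioms.intro)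
    show "hil ?X" "hil ?Y"
      using X_hilbert Y_hilbert by (simp_all only: hilbert_iff_hil)
    show "hil ?E" by (rule E.hil_axioms)
    show "clinear_on domB B"
      using B_closed by (simp only: closed_op_def)
    show "hs_ip ?X (M x) x' = hs_ip ?X x (M x')" for x x'
      using M_sa by simp
    show "\<exists>\<delta>>0. \<forall>x. \<delta> * (hnorm ?X x)\<^sup>2 \<le> Re (hs_ip ?X (M x) x)"
      using M_pos by simp
    show "0 \<le> Re (hs_ip ?X (D x) x)" for x
      using D_diss by simp
    show "clinear_on domA \<Lambda>" "\<Lambda> ` domA = hs_set ?E"
      using \<Lambda>_lin \<Lambda>_surj by (simp_all add: \<Lambda>_def[abs_def])
    show "clinear_on domB \<Gamma>"
      unfolding \<Gamma>_def[abs_def] clinear_on_Pair using \<Pi>1_mem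
      by (intro conjI clinear_on_uminus clinear_on_compose[OF \<Pi>12_lin(1) _ H1.clinear_on_riesz_inv]
          clinear_on_compose[OF \<Pi>12_lin(2) _ H2.clinear_on_riesz]) auto
    show "\<Gamma> ` domB = hs_set ?E"
    proof (intro equalityI subsetI)
      fix p assume "p \<in> hs_set ?E"
      then obtain g \<psi> where p: "p = (g, \<psi>)" "\<psi> \<in> antidual ?H2" by auto
      then have "(?R1 g, - ?S2 \<psi>) \<in> (\<lambda>y. (\<Pi>1 y, \<Pi>2 y)) ` domB"
        unfolding \<Pi>_surj using R_mem by simp
      then obtain y where y: "y \<in> domB" "\<Pi>1 y = ?R1 g" "\<Pi>2 y = - ?S2 \<psi>" by auto
      have "?R2 (- ?S2 \<psi>) = - \<psi>"
        using H2.riesz_scale[of "?S2 \<psi>" "-1"] p(2) H2.riesz_inv by simp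
      then have "\<Gamma> y = p"
        using y p SR by (simp add: \<Gamma>_def)
      then show "p \<in> \<Gamma> ` domB" using y by blast
    qed (auto simp: \<Gamma>_def R_mem cneg_mem[OF H2.antidual_subspace])
    show "- hs_ip ?X (B y) x - hs_ip ?Y y (A x) = hs_ip ?E (\<Gamma> y) (\<Lambda> x)" if "y \<in> domB" "x \<in> domA" for x y
    proof -
      have "ip1 (?S1 (\<Pi>1 y)) (\<Lambda>1 x) = \<Pi>1 y (\<Lambda>1 x)"
        using H1.dual_ip_apply[OF \<Pi>1_mem[OF that(1)]] by simp
      moreover have "ip2 (\<Pi>2 y) (?S2 (\<Lambda>2 x)) = cnj (\<Lambda>2 x (\<Pi>2 y))"
        using H2.dual_ip_apply[OF \<Lambda>2_mem[OF that(2)]] H2.ip_commute[of "?S2 (\<Lambda>2 x)" "\<Pi>2 y"] by simp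
      moreover have "ip2 (- \<Pi>2 y) k = - ip2 (\<Pi>2 y) k" for k
        using H2.ip_neg_left[of "\<Pi>2 y" k] by simp
      ultimately show ?thesis
        using green that S2_neg[OF R_mem(2)] by (simp add: \<Gamma>_def \<Lambda>_def SR)
    qed
  qed (simp_all only: hs_pair A_closed A_below A_adj M_bdd D_bdd)

  let ?V = "prod_hs (Y1_hs ipY domA A) (XM_hs ipX M)"
  have V_eq: "?V = W.V"
    by (simp add: Y1_hs_def XM_hs_def W.Y1_def W.XM_def)
  let ?Z = "domBM domA A domB M" and ?L = "BM A B D M"
  define a where "a z = RG ip1 ip2 (Xi0 \<Lambda>1 \<Pi>2 (fst z) (inv M (snd z)))" for z
  define b where "b z = Xi1 \<Pi>1 \<Lambda>2 (fst z) (inv M (snd z))" for z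
  have Z_iff: "z \<in> ?Z \<longleftrightarrow> fst z \<in> domB \<and> fst z \<in> A ` domA \<and> inv M (snd z) \<in> domA" for z
    by (rule mem_domBM_iff[OF W.M_bij])
  have a_eq: "a z = (?R1 (\<Lambda>1 (inv M (snd z))), ?R2 (\<Pi>2 (fst z)))" for z
    by (simp add: a_def RG_def Xi0_def)
  have b_eq: "b z = (- \<Pi>1 (fst z), \<Lambda>2 (inv M (snd z)))" for z
    by (simp add: b_def Xi1_def)
  obtain C where C: "C \<ge> 0" "\<And>v w. v \<in> domB \<Longrightarrow> v \<in> A ` domA \<Longrightarrow> w \<in> domA \<Longrightarrow>
      hnorm ?E (\<Lambda> w) + hnorm ?E (\<Gamma> v) \<le> C * (hnorm W.V (v, M w) + hnorm W.V (A w, B v - D w))"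
    using W.boundary_bounded by blast
  have Z_sub: "csubspace ?Z"
  proof -
    note sub = W.domA_sub W.domB_sub csubspace_image[OF W.A_lin]
    show ?thesis
      unfolding csubspace_def Ball_def Z_iff
      by (simp add: W.inv_M_add W.inv_M_scale W.inv_M_zero sub cadd_mem cscale_mem czero_mem)
  qed
  have fst_lin: "clinear_on ?Z fst" and w_lin: "clinear_on ?Z (\<lambda>z. inv M (snd z))"
    using Z_sub by (auto simp: clinear_on_def W.inv_M_add W.inv_M_scale)
  have fst_dom: "fst ` ?Z \<subseteq> domB" and w_dom: "(\<lambda>z. inv M (snd z)) ` ?Z \<subseteq> domA"
    by (auto simp: Z_iff)
  note fst_comp = clinear_on_compose[OF fst_lin fst_dom] and w_comp = clinear_on_compose[OF w_lin w_dom]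
  interpret V: hil ?V unfolding V_eq by (rule W.hil_V)
  interpret S: boundary_system ?V ?U ?Z ?L a b C
  proof
    show "?Z \<subseteq> hs_set ?V"
      by (auto simp: Z_iff Y1_hs_def XM_hs_def)
    show "clinear_on ?Z ?L"
      unfolding BM_def[abs_def] clinear_on_Pair
      by (intro conjI clinear_on_minus w_comp fst_comp W.A_lin W.B_lin
          clinear_on_compose[OF w_lin _ W.D_lin] subset_UNIV)
    show "clinear_on ?Z a"
      unfolding a_eq[abs_def] clinear_on_Pair
      using clinear_on_compose[OF w_comp[OF \<Lambda>12_lin(1)] _ H1.clinear_on_riesz]
        clinear_on_compose[OF fst_comp[OF \<Pi>12_lin(2)] _ H2.clinear_on_riesz] by simp
    show "clinear_on ?Z b"
      unfolding b_eq[abs_def] clinear_on_Pair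
      by (intro conjI clinear_on_uminus w_comp fst_comp \<Lambda>12_lin \<Pi>12_lin)
    fix z assume z: "z \<in> ?Z"
    define v where "v = fst z"
    define w where "w = inv M (snd z)"
    have zvw: "z = (v, M w)" by (simp add: v_def w_def)
    have v: "v \<in> domB" "v \<in> A ` domA" and w: "w \<in> domA"
      using z by (simp_all add: Z_iff v_def w_def)
    have Lz: "?L z = (A w, B v - D w)" by (simp add: zvw BM_def)
    have az: "a z = (?R1 (\<Lambda>1 w), ?R2 (\<Pi>2 v))" and bz: "b z = (- \<Pi>1 v, \<Lambda>2 w)"
      by (simp_all add: a_eq b_eq zvw)
    show "?L z \<in> hs_set ?V"
      using w by (simp add: Lz Y1_hs_def XM_hs_def)
    show a_U: "a z \<in> hs_set ?U" and b_U: "b z \<in> hs_set ?U"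
      using v w R_mem \<Pi>1_mem \<Lambda>2_mem cneg_mem[OF H1.antidual_subspace] by (simp_all add: az bz)
    have S1: "?S1 (- \<Pi>1 v) = - ?S1 (\<Pi>1 v)" and S2: "?S2 (- ?R2 (\<Pi>2 v)) = - \<Pi>2 v"
      using S1_neg[OF \<Pi>1_mem[OF v(1)]] S2_neg[OF R_mem(2)] by (simp_all add: SR)
    \<comment> \<open>Compared with Green's boundary term, only the first summand has its arguments
      exchanged, and the real part does not see the conjugation.\<close>
    have "Re (hs_ip ?U (a z) (b z)) = Re (ip1 (\<Lambda>1 w) (- ?S1 (\<Pi>1 v))) + Re (ip2 (\<Pi>2 v) (?S2 (\<Lambda>2 w)))"
      by (simp add: az bz SR S1)
    also have "\<dots> = - Re (hs_ip ?E (\<Gamma> v) (\<Lambda> w))"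
      using H1.Re_ip_commute[of "?S1 (\<Pi>1 v)" "\<Lambda>1 w"] H1.ip_neg_right[of "\<Lambda>1 w" "?S1 (\<Pi>1 v)"]
        H2.ip_neg_left[of "\<Pi>2 v" "?S2 (\<Lambda>2 w)"]
      by (simp add: \<Gamma>_def \<Lambda>_def S2)
    also have "\<dots> \<ge> Re (hs_ip ?V (?L z) z)"
      unfolding V_eq Lz unfolding zvw by (rule W.energy[OF v(1) w])
    finally show "Re (hs_ip ?V (?L z) z) \<le> Re (hs_ip ?U (a z) (b z))" .
    have \<Lambda>E: "\<Lambda> w \<in> hs_set ?E" and \<Gamma>E: "\<Gamma> v \<in> hs_set ?E"
      by (rule W.\<Lambda>_mem[OF w], rule W.\<Gamma>_mem[OF v(1)])
    have parts: "H1.nrm (\<Lambda>1 w) \<le> hnorm ?E (\<Lambda> w)" "D2.nrm (\<Lambda>2 w) \<le> hnorm ?E (\<Lambda> w)"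
      "H1.nrm (?S1 (\<Pi>1 v)) \<le> hnorm ?E (\<Gamma> v)" "H2.nrm (\<Pi>2 v) \<le> hnorm ?E (\<Gamma> v)"
      using E.nrm_prod_bounds(1,2)[OF \<Lambda>E] E.nrm_prod_bounds(1,2)[OF \<Gamma>E] H2.nrm_minus[of "\<Pi>2 v"]
      by (simp_all add: \<Lambda>_def \<Gamma>_def H2.dual_nrm S2)
    have bd: "hnorm ?E (\<Lambda> w) + hnorm ?E (\<Gamma> v) \<le> C * (hnorm ?V z + hnorm ?V (?L z))"
      unfolding V_eq Lz unfolding zvw by (rule C(2)[OF v w])
    show "hnorm ?U (a z) \<le> C * (hnorm ?V z + hnorm ?V (?L z))"
      using U.nrm_prod_bounds(3)[OF a_U] parts(1,4) bd by (simp add: az H1.dual_nrm H2.dual_nrm SR)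
    show "hnorm ?U (b z) \<le> C * (hnorm ?V z + hnorm ?V (?L z))"
      using U.nrm_prod_bounds(3)[OF b_U] parts(2,3) bd H1.nrm_minus[of "?S1 (\<Pi>1 v)"]
      by (simp add: bz H1.dual_nrm S1)
  next
    fix l f q assume l: "(l::real) > 0" and f: "f \<in> hs_set ?V" and q: "q \<in> hs_set ?U"
    have f1: "fst f \<in> A ` domA" using f by (auto simp: Y1_hs_def)
    have q12: "fst q \<in> antidual ?H1" "snd q \<in> antidual ?H2" using q by auto
    \<comment> \<open>\<open>\<Lambda> w - \<Gamma> v = e\<close> is the condition
      \<open>a z + b z = q\<close> with its first component moved from the anti-dual back to
      \<open>G1\<close>.\<close>
    then have e: "(?S1 (fst q), snd q) \<in> hs_set ?E" by simp
    obtain v w where v: "v \<in> domB" "v \<in> A ` domA" and w: "w \<in> domA"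
      and eqs: "l *\<^sub>r v - A w = fst f" "l *\<^sub>r M w - (B v - D w) = snd f"
        "\<Lambda> w - \<Gamma> v = (?S1 (fst q), snd q)"
      using W.solve[OF l f1 e, of "snd f"] by blast
    have "?R1 (\<Lambda>1 w - ?S1 (\<Pi>1 v)) = fst q"
      using eqs(3) H1.riesz_inv(2)[OF q12(1)] by (simp add: \<Lambda>_def \<Gamma>_def)
    then have "?R1 (\<Lambda>1 w) - \<Pi>1 v = fst q"
      using H1.riesz_diff[of "\<Lambda>1 w" "?S1 (\<Pi>1 v)"] H1.riesz_inv(2)[OF \<Pi>1_mem[OF v(1)]] by simp
    moreover have "?R2 (\<Pi>2 v) + \<Lambda>2 w = snd q"
      using eqs(3) by (simp add: \<Lambda>_def \<Gamma>_def add.commute)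
    ultimately show "\<exists>z\<in>?Z. l *\<^sub>r z - ?L z = f \<and> a z + b z = q"
      using v w eqs(1,2)
      by (intro bexI[of _ "(v, M w)"]) (auto simp: Z_iff BM_def a_eq b_eq prod_eq_iff)
  qed
  have U_eq: "Gstar_hs ip1 ip2 = ?U" by (simp add: Gstar_hs_def)
  show ?thesis
    unfolding U_eq
  proof (rule S.impedance_passive_feedback)
    show "clinear_on (hs_set ?U) P"
      using P_bdd by (simp only: U_eq bounded_op_def)
    show "P x \<in> hs_set ?U" if "x \<in> hs_set ?U" for x
      using P_bdd that unfolding U_eq bounded_op_def by blast
    show "hnorm ?U (P x) \<le> hnorm ?U x" if "x \<in> hs_set ?U" for x
      using P_contr that unfolding U_eq by blast
  qed (simp_all add: Gin_def Kout_def Let_def a_def b_def)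
qed

end
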